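(* Let $\mathcal H$ be the real vector space (of real dimension $64$) of quadruples $(H_1,H_2,H_3,H_4)$ of Hermitian $4\times4$ matrices with its Euclidean topology, and let $\mathcal E\subset\mathcal H$ be the subset of those quadruples that define exceptional quadrics. Let $\widetilde H=(H_1,H_2,H_3,H_4)\in\mathcal H$ with $$H_1=E_{12}+E_{21},\quad H_2=i(E_{21}-E_{12}),\quad H_3=E_{22},\quad H_4=E_{14}+E_{41}+E_{23}+E_{32},$$ where $E_{pq}$ is the $4\times 4$ matrix whose $(p,q)$ entry is $1$ and whose other entries are $0$. Let $G=SL(4,\mathbb C)\times GL(4,\mathbb R)$ act on $\mathcal H$ by linear changes of the variable $z$ and real linear changes of the variable $w$ (as specified in the context), and let $G\cdot\widetilde H$ denote the orbit of $\widetilde H$. Then there exists a Euclidean neighborhood $U\subset\mathcal H$ of $\widetilde H$ such that $$\mathcal E\cap U=(G\cdot\widetilde H)\cap U.$$ That is, in a neighborhood of $\widetilde H$ the set $\mathcal E$ coincides with the orbit of $\widetilde H$.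
   Context: A tuple $H=(H_1,\dots,H_k)$ of Hermitian matrices of order $n$ is nondegenerate if the matrices are linearly independent over $\mathbb R$ and have no common kernel ($H_1z=\dots=H_kz=0$ implies $z=0$). It defines the vector-valued Hermitian form $\langle z,\bar z\rangle=(H_1z\cdot\bar z,\dots,H_kz\cdot\bar z)$, where $H_jz\cdot\bar z=\sum_{p,q}(H_j)_{pq}z_q\bar z_p$, and the CR quadric of type $(n,k)$ $$Q=\{(z,w)\in\mathbb C^n\times\mathbb C^k:\ \mathrm{Im}\,w=\langle z,\bar z\rangle\}.$$ Let $\mathrm{aut}\,Q$ be the real Lie algebra of infinitesimal holomorphic automorphisms of the germ of $Q$ at the origin: germs at $0$ of holomorphic vector fields $X=\sum_j f_j\,\partial/\partial z_j+\sum_l h_l\,\partial/\partial w_l$ (with $f_j,h_l$ holomorphic in $(z,w)$) such that $2\,\mathrm{Re}\,X$ is tangent to $Q$. Assign weight $1$ to each $z_j$, weight $2$ to each $w_l$, weight $-1$ to $\partial/\partial z_j$ and weight $-2$ to $\partial/\partial w_l$. For nondegenerate $H$, $\mathrm{aut}\,Q$ is a finite-dimensional graded Lie algebra $g_{-2}+g_{-1}+g_0+g_1+\dots+g_d$, $d<\infty$, where $g_j$ is the component of weight $j$ and $g_d\neq 0$. The quadric $Q$ (and the tuple $H$) is called exceptional if it is nondegenerate and $d>2$, i.e. $g_j\ne0$ for some $j\ge3$. Here $n=k=4$. Action of $G$: for $g=(C,\rho)\in SL(4,\mathbb C)\times GL(4,\mathbb R)$ and $H\in\mathcal H$ with associated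 form $\langle z,\bar z\rangle$, the tuple $g\cdot H$ is the one defining the form $\rho^{-1}\langle Cz,\overline{Cz}\rangle$. *)

theory Defs
  imports "HOL-Analysis.Analysis"
begin

definition hermitian_mat :: "complex^'n^'n \<Rightarrow> bool" where
  "hermitian_mat A \<longleftrightarrow> (\<forall>p q. A $ p $ q = cnj (A $ q $ p))"

definition hermitian_tuples :: "(complex^'n^'n^'k) set" where
  "hermitian_tuples = {H. \<forall>l. hermitian_mat (H $ l)}"

text \<open>The form takes values in \<open>complex^'k\<close>; its components are real when the
  \<open>H $ l\<close> are Hermitian.\<close>

definition hform :: "complex^'n^'n^'k \<Rightarrow> complex^'n \<Rightarrow> complex^'k" where
  "hform H z = (\<chi> l. \<Sum>p\<in>UNIV. \<Sum>q\<in>UNIV. H $ l $ p $ q * z $ q * cnj (z $ p))"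

definition nondegenerate :: "complex^'n^'n^'k \<Rightarrow> bool" where
  "nondegenerate H \<longleftrightarrow>
     (\<forall>c :: real^'k. (\<Sum>l\<in>UNIV. c $ l *\<^sub>R H $ l) = 0 \<longrightarrow> c = 0) \<and>
     (\<forall>z. (\<forall>l. H $ l *v z = 0) \<longrightarrow> z = 0)"

definition defining_fn :: "complex^'n^'n^'k \<Rightarrow> (complex^'n) \<times> (complex^'k) \<Rightarrow> complex^'k" where
  "defining_fn H = (\<lambda>(z, w). (\<chi> l. complex_of_real (Im (w $ l))) - hform H z)"

definition quadric :: "complex^'n^'n^'k \<Rightarrow> ((complex^'n) \<times> (complex^'k)) set" where
  "quadric H = {(z, w). \<forall>l. complex_of_real (Im (w $ l)) = hform H z $ l}"

lemma quadric_eq_zeros: "quadric H = {p. defining_fn H p = 0}"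
  by (auto simp: quadric_def defining_fn_def vec_eq_iff)

text \<open>The vector field \<open>\<Sum>j. f j \<partial>/\<partial>z j + \<Sum>l. h l \<partial>/\<partial>w l\<close> is represented by
  the map \<open>X = (f, h)\<close>. A germ at \<open>0\<close> is represented by any function having
  that germ; two functions represent the same germ iff they agree eventually in \<open>nhds 0\<close>.\<close>

definition holomorphic_germ ::
  "((complex^'n) \<times> (complex^'k) \<Rightarrow> (complex^'n) \<times> (complex^'k)) \<Rightarrow> bool" where
  "holomorphic_germ X \<longleftrightarrow>
     (\<forall>\<^sub>F p in nhds 0. \<exists>D. (X has_derivative D) (at p) \<and>
        (\<forall>c z w. D (c *s z, c *s w) = (c *s fst (D (z, w)), c *s snd (D (z, w)))))"

text \<open>The real vector field \<open>2 Re X\<close> acts on a real function \<open>r\<close> by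
  \<open>2 Re (\<Sum>j. f j \<partial>r/\<partial>z j + \<Sum>l. h l \<partial>r/\<partial>w l)\<close>, which is the real differential of \<open>r\<close>
  in the direction \<open>(f, h)\<close>. As the defining function is a submersion onto the real points of
  \<open>complex^'k\<close>, tangency to the quadric at one of its points means that \<open>(f, h)\<close> lies in the
  kernel of the differential there.\<close>

definition tangent_germ ::
  "complex^'n^'n^'k \<Rightarrow> ((complex^'n) \<times> (complex^'k) \<Rightarrow> (complex^'n) \<times> (complex^'k)) \<Rightarrow> bool" where
  "tangent_germ H X \<longleftrightarrow>
     (\<forall>\<^sub>F p in nhds 0. p \<in> quadric H \<longrightarrow>
        (\<exists>D. (defining_fn H has_derivative D) (at p) \<and> D (X p) = 0))"

definition aut_quadric ::
  "complex^'n^'n^'k \<Rightarrow> ((complex^'n) \<times> (complex^'k) \<Rightarrow> (complex^'n) \<times> (complex^'k)) set" where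
  "aut_quadric H = {X. holomorphic_germ X \<and> tangent_germ H X}"

text \<open>Exponents \<open>(a, b)\<close> of the monomials \<open>z^a w^b\<close> of weight \<open>m\<close>; there are none
  if \<open>m < 0\<close>.\<close>

definition exponents_of_weight :: "int \<Rightarrow> (('n::finite \<Rightarrow> nat) \<times> ('k::finite \<Rightarrow> nat)) set" where
  "exponents_of_weight m =
     {(a, b). int ((\<Sum>j\<in>UNIV. a j) + 2 * (\<Sum>l\<in>UNIV. b l)) = m}"

lemma finite_exponents_of_weight:
  "finite (exponents_of_weight m :: (('n::finite \<Rightarrow> nat) \<times> ('k::finite \<Rightarrow> nat)) set)"
proof (rule finite_subset)
  show "exponents_of_weight m \<subseteq>
      (PiE UNIV (\<lambda>_. {..nat m}) :: ('n \<Rightarrow> nat) set) \<times> (PiE UNIV (\<lambda>_. {..nat m}) :: ('k \<Rightarrow> nat) set)"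
  proof (rule subsetI)
    fix x :: "('n \<Rightarrow> nat) \<times> ('k \<Rightarrow> nat)"
    assume "x \<in> exponents_of_weight m"
    then obtain a b where x: "x = (a, b)" and "int (sum a UNIV + 2 * sum b UNIV) = m"
      unfolding exponents_of_weight_def by blast
    then have m: "sum a UNIV + 2 * sum b UNIV = nat m" by linarith
    have "a i \<le> nat m" for i
      using member_le_sum[of i UNIV a] m by simp
    moreover have "b i \<le> nat m" for i
      using member_le_sum[of i UNIV b] m by simp
    ultimately show "x \<in> PiE UNIV (\<lambda>_. {..nat m}) \<times> PiE UNIV (\<lambda>_. {..nat m})"
      by (simp add: x PiE_iff)
  qed
  show "finite ((PiE UNIV (\<lambda>_. {..nat m}) :: ('n \<Rightarrow> nat) set) \<times>
      (PiE UNIV (\<lambda>_. {..nat m}) :: ('k \<Rightarrow> nat) set))"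
    by (intro finite_cartesian_product finite_PiE) auto
qed

definition weighted_homogeneous ::
  "int \<Rightarrow> ((complex^'n) \<times> (complex^'k) \<Rightarrow> complex) \<Rightarrow> bool" where
  "weighted_homogeneous m f \<longleftrightarrow>
     (\<exists>c. \<forall>\<^sub>F (z, w) in nhds 0.
        f (z, w) = (\<Sum>(a, b)\<in>exponents_of_weight m.
          c (a, b) * (\<Prod>j\<in>UNIV. z $ j ^ a j) * (\<Prod>l\<in>UNIV. w $ l ^ b l)))"

text \<open>Since \<open>\<partial>/\<partial>z j\<close> and \<open>\<partial>/\<partial>w l\<close> have weights \<open>-1\<close> and \<open>-2\<close>, a field of weight \<open>j\<close> has
  coefficients of weight \<open>j + 1\<close> and \<open>j + 2\<close> respectively.\<close>

definition aut_component ::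
  "complex^'n^'n^'k \<Rightarrow> int \<Rightarrow> ((complex^'n) \<times> (complex^'k) \<Rightarrow> (complex^'n) \<times> (complex^'k)) set" where
  "aut_component H j = {X \<in> aut_quadric H.
     (\<forall>i. weighted_homogeneous (j + 1) (\<lambda>p. fst (X p) $ i)) \<and>
     (\<forall>l. weighted_homogeneous (j + 2) (\<lambda>p. snd (X p) $ l))}"

definition exceptional_tuple :: "complex^'n^'n^'k \<Rightarrow> bool" where
  "exceptional_tuple H \<longleftrightarrow> H \<in> hermitian_tuples \<and> nondegenerate H \<and>
     (\<exists>j\<ge>3. \<exists>X\<in>aut_component H j. \<not> (\<forall>\<^sub>F p in nhds 0. X p = 0))"

text \<open>The tuple defining the form \<open>z \<mapsto> \<rho>\<^sup>-\<^sup>1 \<langle>C z, C z\<rangle>\<close>; see \<open>hform_tuple_act\<close> below.\<close>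

definition tuple_act ::
  "complex^'n^'n \<Rightarrow> real^'k^'k \<Rightarrow> complex^'n^'n^'k \<Rightarrow> complex^'n^'n^'k" where
  "tuple_act C \<rho> H =
     (\<chi> l. \<Sum>m\<in>UNIV. matrix_inv \<rho> $ l $ m *\<^sub>R (map_matrix cnj (transpose C) ** H $ m ** C))"

definition tuple_orbit :: "complex^'n^'n^'k \<Rightarrow> (complex^'n^'n^'k) set" where
  "tuple_orbit H = {tuple_act C \<rho> H | C \<rho>. det C = 1 \<and> invertible \<rho>}"

lemma hform_eq: "hform H z $ l = (\<Sum>p\<in>UNIV. (H $ l *v z) $ p * cnj (z $ p))"
  by (simp add: hform_def matrix_vector_mult_def sum_distrib_right)

lemma adjoint_mult_cnj:
  "(\<Sum>p\<in>UNIV. (map_matrix cnj (transpose C) *v y) $ p * cnj (z $ p)) =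
   (\<Sum>p\<in>UNIV. y $ p * cnj ((C *v z) $ p))"
  unfolding matrix_vector_mult_def
  by (simp add: sum_distrib_left sum_distrib_right transpose_def mult_ac)
     (rule sum.swap)

lemma hform_tuple_act:
  "hform (tuple_act C \<rho> H) z = map_matrix complex_of_real (matrix_inv \<rho>) *v hform H (C *v z)"
proof -
  have *: "hform (\<chi> l. map_matrix cnj (transpose C) ** H $ l ** C) z = hform H (C *v z)"
    by (simp add: vec_eq_iff hform_eq adjoint_mult_cnj flip: matrix_vector_mul_assoc)
  have "hform (tuple_act C \<rho> H) z = map_matrix complex_of_real (matrix_inv \<rho>) *v
      hform (\<chi> l. map_matrix cnj (transpose C) ** H $ l ** C) z"
    unfolding vec_eq_iff
  proof
    fix l
    let ?M = "\<lambda>m. map_matrix cnj (transpose C) ** H $ m ** C"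
    have "hform (tuple_act C \<rho> H) z $ l = (\<Sum>p\<in>UNIV. \<Sum>q\<in>UNIV. \<Sum>m\<in>UNIV.
        complex_of_real (matrix_inv \<rho> $ l $ m) * (?M m $ p $ q * z $ q * cnj (z $ p)))"
      by (simp add: hform_def tuple_act_def sum_distrib_right mult.assoc
            flip: scaleR_conv_of_real)
    also have "\<dots> = (\<Sum>m\<in>UNIV. \<Sum>p\<in>UNIV. \<Sum>q\<in>UNIV.
        complex_of_real (matrix_inv \<rho> $ l $ m) * (?M m $ p $ q * z $ q * cnj (z $ p)))"
      by (rule trans[OF sum.cong[OF refl sum.swap] sum.swap])
    finally show "hform (tuple_act C \<rho> H) z $ l = (map_matrix complex_of_real (matrix_inv \<rho>) *v
        hform (\<chi> l. ?M l) z) $ l"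
      by (simp add: hform_def matrix_vector_mult_def sum_distrib_left)
  qed
  with * show ?thesis by simp
qed

definition E_mat :: "'n \<Rightarrow> 'n \<Rightarrow> complex^'n^'n" where
  "E_mat p q = (\<chi> i j. if i = p \<and> j = q then 1 else 0)"

definition H_tilde :: "complex^4^4^4" where
  "H_tilde = vector
     [E_mat 1 2 + E_mat 2 1,
      map_matrix ((*) \<i>) (E_mat 2 1 - E_mat 1 2),
      E_mat 2 2,
      E_mat 1 4 + E_mat 4 1 + E_mat 2 3 + E_mat 3 2]"

lemma H_tilde_nth:
  "H_tilde $ 1 = E_mat 1 2 + E_mat 2 1"
  "H_tilde $ 2 = map_matrix ((*) \<i>) (E_mat 2 1 - E_mat 1 2)"
  "H_tilde $ 3 = E_mat 2 2"
  "H_tilde $ 4 = E_mat 1 4 + E_mat 4 1 + E_mat 2 3 + E_mat 3 2"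
  by (simp_all add: H_tilde_def vector_def)

end

theory Submission
  imports Defs
begin

text \<open>Write \<open>\<langle>x, y\<rangle>\<close> for the sesquilinear form of \<open>H\<close> and \<open>(f, h)\<close> for a nonzero weighted homogeneous field tangent to
  the quadric, of weight at least \<open>3\<close>. Expanding the tangency equation in the complexified variables shows
  that \<open>a(w) = f(0, w)\<close> satisfies \<open>\<langle>z, a(\<langle>z, z\<rangle>)\<rangle> = 0\<close> for all \<open>z\<close>; if \<open>a = 0\<close>, the same holds for the derivative
  of \<open>f(\<cdot>, w)\<close> at \<open>0\<close> in any direction, which is the map \<open>a\<close> of a commutator with a field of weight \<open>-1\<close>,
  and not all of these vanish. So exceptional quadrics carry a nonzero polynomial map \<open>a\<close> with this isotropy
  property.

  Conversely let \<open>det H\<^sub>4 \<noteq> 0\<close> and let \<open>\<langle>z, z\<rangle>\<close> cover an open set, which holds near \<open>H_tilde\<close>. Moving \<open>z\<close> in directions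
  that fix \<open>\<langle>z, z\<rangle>\<close> to first order, a dimension count shows that \<open>a(\<langle>z, z\<rangle>)\<close> is a common eigenvector of all
  \<open>H\<^sub>4\<^sup>-\<^sup>1 H\<^sub>l\<close>. The eigenvalues \<open>r\<^sub>l\<close> are constant and real, and the values of \<open>a\<close> span a plane \<open>L\<close> that is isotropic
  for \<open>H\<^sub>4\<close> and killed by \<open>H\<^sub>l - r\<^sub>l H\<^sub>4\<close>. The latter are therefore Hermitian forms on a two-dimensional quotient;
  a Hermitian matrix orthogonal to them must be degenerate, since otherwise there would be two points with
  nonparallel images in the quotient and proportional values of \<open>\<langle>z, z\<rangle>\<close>. So it is \<open>g g\<^sup>*\<close> up to a factor,
  and \<open>g\<close>, on which all these forms vanish, is the first vector of a basis in which \<open>H\<close> is a combination of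
  the components of \<open>H_tilde\<close>.\<close>

subsection \<open>Polynomial functions\<close>

text \<open>The weight of an exceptional field has no upper bound, but the degree of a never
  matters. The lower bound enters once: tangency isolates a from weight 2 on, and the commutator
  costs 1, hence 3.

  The neighbourhood consists of two open conditions. Nondegeneracy of \<open>H $ 4\<close> leaves
  the pencils finitely many eigenvalues. Surjectivity of the derivative of \<langle>z, z\<rangle> at
  one point keeps a nonzero polynomial a from vanishing at all values \<langle>z, z\<rangle>.

  The number four is decisive three times. Two complex numbers have as many real parts as
  \<langle>z, z\<rangle> has components, which yields the eigenvectors. Nonreal eigenvalues would
  confine certain coefficient vectors in R^4 to a plane, which is one dimension too few. Finally L
  is maximal isotropic in C^4, so the Hermitian forms on the quotient have real dimension four,
  while the form with index 4 is zero and at most three others remain; so an orthogonal Hermitian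
  matrix exists. Proportional values of \<langle>z, z\<rangle> at nonparallel points are impossible
  because a is then parallel at both points, and a vector of L is orthogonal to only one line of the
  quotient.\<close>

definition poly_fun :: "(complex \<Rightarrow> complex) \<Rightarrow> bool" where
  "poly_fun g \<longleftrightarrow> (\<exists>p. \<forall>t. g t = poly p t)"

lemma poly_fun_const [simp, intro]: "poly_fun (\<lambda>_. c)"
  unfolding poly_fun_def by (rule exI[of _ "[:c:]"]) simp

lemma poly_fun_id [simp, intro]: "poly_fun (\<lambda>t. t)"
  unfolding poly_fun_def by (rule exI[of _ "[:0, 1:]"]) simp

lemma poly_fun_add [intro]: "poly_fun f \<Longrightarrow> poly_fun g \<Longrightarrow> poly_fun (\<lambda>t. f t + g t)"
  unfolding poly_fun_def by (metis poly_add)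

lemma poly_fun_diff [intro]: "poly_fun f \<Longrightarrow> poly_fun g \<Longrightarrow> poly_fun (\<lambda>t. f t - g t)"
  unfolding poly_fun_def by (metis poly_diff)

lemma poly_fun_mult [intro]: "poly_fun f \<Longrightarrow> poly_fun g \<Longrightarrow> poly_fun (\<lambda>t. f t * g t)"
  unfolding poly_fun_def by (metis poly_mult)

lemma poly_fun_power [intro]: "poly_fun f \<Longrightarrow> poly_fun (\<lambda>t. f t ^ n)"
  unfolding poly_fun_def by (metis poly_power)

lemma poly_fun_sum [intro]: "(\<And>i. i \<in> I \<Longrightarrow> poly_fun (f i)) \<Longrightarrow> poly_fun (\<lambda>t. \<Sum>i\<in>I. f i t)"
  by (induction I rule: infinite_finite_induct) auto

lemma poly_fun_prod [intro]: "(\<And>i. i \<in> I \<Longrightarrow> poly_fun (f i)) \<Longrightarrow> poly_fun (\<lambda>t. \<Prod>i\<in>I. f i t)"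
  by (induction I rule: infinite_finite_induct) auto

lemma poly_fun_compose: "poly_fun f \<Longrightarrow> poly_fun g \<Longrightarrow> poly_fun (\<lambda>t. f (g t))"
  unfolding poly_fun_def by (metis poly_pcompose)

lemma poly_fun_cnj: "poly_fun f \<Longrightarrow> poly_fun (\<lambda>t. cnj (f (cnj t)))"
  unfolding poly_fun_def by (metis complex_cnj_cnj poly_cnj)

lemma poly_fun_finite_zeros:
  assumes "poly_fun f" "f x \<noteq> 0"
  shows "finite {t. f t = 0}"
proof -
  obtain p where p: "\<And>t. f t = poly p t" using assms(1) unfolding poly_fun_def by blast
  with assms(2) have "p \<noteq> 0" by auto
  then show ?thesis using poly_roots_finite[of p] by (simp add: p)
qed

text \<open>The uniqueness principle behind the later continuations: statements in several variables
  are restricted to a curve with one complex parameter, where finiteness of the roots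
  suffices.\<close>

lemma poly_fun_eqI:
  assumes "poly_fun f" "poly_fun g" "infinite S" "\<And>t. t \<in> S \<Longrightarrow> f t = g t"
  shows "f t = g t"
proof (rule ccontr)
  assume "f t \<noteq> g t"
  then have "finite {t. f t - g t = 0}"
    using poly_fun_finite_zeros[OF poly_fun_diff[OF assms(1,2)], of t] by simp
  moreover have "S \<subseteq> {t. f t - g t = 0}" using assms(4) by auto
  ultimately show False using assms(3) finite_subset by blast
qed

lemma poly_fun_eqI_real:
  assumes "poly_fun f" "poly_fun g" "\<And>x::real. x > 0 \<Longrightarrow> f (of_real x) = g (of_real x)"
  shows "f t = g t"
proof (rule poly_fun_eqI[OF assms(1,2), of "of_real ` {0<..}"])
  show "infinite (complex_of_real ` {0<..})"
    by (simp add: finite_image_iff inj_on_def infinite_Ioi)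
qed (use assms(3) in auto)

lemma infinite_circle:
  assumes "r > 0" shows "infinite {t::complex. norm t = r}"
proof
  assume fin: "finite {t::complex. norm t = r}"
  have "(\<lambda>x. Complex x (sqrt (r^2 - x^2))) ` {0<..<r} \<subseteq> {t::complex. norm t = r}"
  proof (rule image_subsetI)
    fix x assume "x \<in> {0<..<r}"
    then have "x^2 \<le> r^2" by (intro power_mono) auto
    then show "Complex x (sqrt (r^2 - x^2)) \<in> {t. norm t = r}" using assms by (simp add: cmod_def)
  qed
  then have "finite ((\<lambda>x. Complex x (sqrt (r^2 - x^2))) ` {0<..<r})"
    using fin finite_subset by blast
  then have "finite {0<..<r}" by (rule finite_imageD) (auto simp: inj_on_def)
  then show False using assms infinite_Ioo by blast
qed

text \<open>On the unit circle conjugation is inversion, so the tangency equation at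
  \<open>e *s z\<close> becomes polynomial in \<open>e\<close> after multiplication by a power of
  \<open>e\<close>. This separates its Fourier modes.\<close>

lemma poly_fun_eqI_circle:
  assumes "poly_fun f" "poly_fun g" "r > 0" "\<And>t. norm t = r \<Longrightarrow> f t = g t"
  shows "f t = g t"
  by (rule poly_fun_eqI[OF assms(1,2) infinite_circle[OF assms(3)]]) (use assms(4) in auto)

text \<open>The cancellation is also valid at 0, where the next coefficient is read off.\<close>

lemma poly_fun_power_mult_eq_0:
  assumes "poly_fun f" "\<And>t. t ^ n * f t = 0"
  shows "f t = 0"
proof -
  have nz: "f s = 0" if "norm s = 1" for s
  proof -
    from that have "s \<noteq> 0" by auto
    with assms(2)[of s] show ?thesis by simp
  qed
  show ?thesis
    by (rule poly_fun_eqI_circle[OF assms(1) poly_fun_const zero_less_one nz])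
qed

text \<open>Closure rules instead of coefficients: restriction to curves and differentiation become
  inductions.\<close>

inductive mpoly_fun :: "((complex^'n) \<times> (complex^'k) \<Rightarrow> complex) \<Rightarrow> bool" where
  const: "mpoly_fun (\<lambda>_. c)"
| fst: "mpoly_fun (\<lambda>p. fst p $ i)"
| snd: "mpoly_fun (\<lambda>p. snd p $ l)"
| add: "mpoly_fun F \<Longrightarrow> mpoly_fun G \<Longrightarrow> mpoly_fun (\<lambda>p. F p + G p)"
| mult: "mpoly_fun F \<Longrightarrow> mpoly_fun G \<Longrightarrow> mpoly_fun (\<lambda>p. F p * G p)"

lemma mpoly_fun_sum: "(\<And>i. i \<in> I \<Longrightarrow> mpoly_fun (F i)) \<Longrightarrow> mpoly_fun (\<lambda>p. \<Sum>i\<in>I. F i p)"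
  by (induction I rule: infinite_finite_induct) (auto intro: mpoly_fun.intros)

lemma mpoly_fun_prod: "(\<And>i. i \<in> I \<Longrightarrow> mpoly_fun (F i)) \<Longrightarrow> mpoly_fun (\<lambda>p. \<Prod>i\<in>I. F i p)"
  by (induction I rule: infinite_finite_induct) (auto intro: mpoly_fun.intros)

lemma mpoly_fun_power: "mpoly_fun F \<Longrightarrow> mpoly_fun (\<lambda>p. F p ^ m)"
  by (induction m) (auto intro: mpoly_fun.intros)

lemma mpoly_fun_diff:
  assumes "mpoly_fun F" "mpoly_fun G" shows "mpoly_fun (\<lambda>p. F p - G p)"
  using mpoly_fun.add[OF assms(1) mpoly_fun.mult[OF mpoly_fun.const[of "-1"] assms(2)]] by simp

lemma mpoly_fun_curve:
  assumes "mpoly_fun F" "\<And>i. poly_fun (\<lambda>t. \<alpha> t $ i)" "\<And>l. poly_fun (\<lambda>t. \<beta> t $ l)"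
  shows "poly_fun (\<lambda>t. F (\<alpha> t, \<beta> t))"
  using assms(1) by induction (auto intro: assms(2,3))

text \<open>Additivity comes with \<open>has_derivative\<close>; only complex homogeneity has to be
  recorded.\<close>

definition clinear_map :: "((complex^'n) \<times> (complex^'k) \<Rightarrow> complex) \<Rightarrow> bool" where
  "clinear_map D \<longleftrightarrow> (\<forall>c z w. D (c *s z, c *s w) = c * D (z, w))"

text \<open>The last conjunct makes the derivative of a polynomial along a polynomial field again
  polynomial, so that commutators stay within polynomial fields.\<close>

lemma mpoly_fun_derivative:
  assumes "mpoly_fun F"
  shows "\<exists>DF. (\<forall>x. (F has_derivative DF x) (at x)) \<and> (\<forall>x. clinear_map (DF x)) \<and>
    (\<forall>G. (\<forall>i. mpoly_fun (\<lambda>p. fst (G p) $ i)) \<longrightarrow> (\<forall>l. mpoly_fun (\<lambda>p. snd (G p) $ l)) \<longrightarrow>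
       mpoly_fun (\<lambda>x. DF x (G x)))"
  using assms
proof induction
  case (const c)
  show ?case
    by (rule exI[of _ "\<lambda>_ _. 0"]) (auto intro: mpoly_fun.intros simp: clinear_map_def)
next
  case (fst i)
  have "((\<lambda>p. fst p $ i) has_derivative (\<lambda>p. fst p $ i)) (at x)" for x :: "(complex^'a) \<times> (complex^'b)"
    by (intro bounded_linear_imp_has_derivative bounded_linear_compose[OF bounded_linear_vec_nth] bounded_linear_fst)
  then show ?case
    by (intro exI[of _ "\<lambda>_ p. fst p $ i"]) (auto simp: clinear_map_def)
next
  case (snd i)
  have "((\<lambda>p. snd p $ i) has_derivative (\<lambda>p. snd p $ i)) (at x)" for x :: "(complex^'a) \<times> (complex^'b)"
    by (intro bounded_linear_imp_has_derivative bounded_linear_compose[OF bounded_linear_vec_nth] bounded_linear_snd)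
  then show ?case
    by (intro exI[of _ "\<lambda>_ p. snd p $ i"]) (auto simp: clinear_map_def)
next
  case (add F G)
  then obtain DF DG where
    D: "\<And>x. (F has_derivative DF x) (at x)" "\<And>x. (G has_derivative DG x) (at x)"
       "\<And>x. clinear_map (DF x)" "\<And>x. clinear_map (DG x)"
    and M: "\<And>K. (\<forall>i. mpoly_fun (\<lambda>p. fst (K p) $ i)) \<Longrightarrow> (\<forall>l. mpoly_fun (\<lambda>p. snd (K p) $ l)) \<Longrightarrow>
       mpoly_fun (\<lambda>x. DF x (K x))"
       "\<And>K. (\<forall>i. mpoly_fun (\<lambda>p. fst (K p) $ i)) \<Longrightarrow> (\<forall>l. mpoly_fun (\<lambda>p. snd (K p) $ l)) \<Longrightarrow>
       mpoly_fun (\<lambda>x. DG x (K x))"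
    by blast
  show ?case
  proof (intro exI[of _ "\<lambda>x d. DF x d + DG x d"] conjI allI impI)
    show "((\<lambda>p. F p + G p) has_derivative (\<lambda>d. DF x d + DG x d)) (at x)" for x
      by (intro has_derivative_add D)
    show "clinear_map (\<lambda>d. DF x d + DG x d)" for x
      using D(3,4)[of x] by (simp add: clinear_map_def distrib_left)
  qed (auto intro!: mpoly_fun.add M)
next
  case (mult F G)
  then obtain DF DG where
    D: "\<And>x. (F has_derivative DF x) (at x)" "\<And>x. (G has_derivative DG x) (at x)"
       "\<And>x. clinear_map (DF x)" "\<And>x. clinear_map (DG x)"
    and M: "\<And>K. (\<forall>i. mpoly_fun (\<lambda>p. fst (K p) $ i)) \<Longrightarrow> (\<forall>l. mpoly_fun (\<lambda>p. snd (K p) $ l)) \<Longrightarrow>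
       mpoly_fun (\<lambda>x. DF x (K x))"
       "\<And>K. (\<forall>i. mpoly_fun (\<lambda>p. fst (K p) $ i)) \<Longrightarrow> (\<forall>l. mpoly_fun (\<lambda>p. snd (K p) $ l)) \<Longrightarrow>
       mpoly_fun (\<lambda>x. DG x (K x))"
    by blast
  show ?case
  proof (intro exI[of _ "\<lambda>x d. F x * DG x d + DF x d * G x"] conjI allI impI)
    show "((\<lambda>p. F p * G p) has_derivative (\<lambda>d. F x * DG x d + DF x d * G x)) (at x)" for x
      by (intro has_derivative_mult D)
    show "clinear_map (\<lambda>d. F x * DG x d + DF x d * G x)" for x
      using D(3,4)[of x] by (simp add: clinear_map_def algebra_simps)
  qed (auto intro!: mpoly_fun.add mpoly_fun.mult M mult.hyps)
qed

subsection \<open>The sesquilinear form\<close>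

definition sform :: "complex^'n^'n^'k \<Rightarrow> complex^'n \<Rightarrow> complex^'n \<Rightarrow> complex^'k" where
  "sform H x y = (\<chi> l. \<Sum>p\<in>UNIV. \<Sum>q\<in>UNIV. H $ l $ p $ q * x $ q * cnj (y $ p))"

lemma hform_eq_sform: "hform H z = sform H z z"
  by (simp add: hform_def sform_def)

lemma sform_nth: "sform H x y $ l = (\<Sum>p\<in>UNIV. (H $ l *v x) $ p * cnj (y $ p))"
  by (simp add: sform_def matrix_vector_mult_def sum_distrib_right)

lemma sform_add_left: "sform H (x + x') y = sform H x y + sform H x' y"
  by (simp add: vec_eq_iff sform_def algebra_simps sum.distrib)

lemma sform_add_right: "sform H x (y + y') = sform H x y + sform H x y'"
  by (simp add: vec_eq_iff sform_def algebra_simps sum.distrib)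

lemma sform_smult_left: "sform H (c *s x) y = c *s sform H x y"
  by (simp add: vec_eq_iff sform_def sum_distrib_left mult_ac)

lemma sform_smult_right: "sform H x (c *s y) = cnj c *s sform H x y"
  by (simp add: vec_eq_iff sform_def sum_distrib_left mult_ac)

lemma sform_scaleR_left: "sform H (r *\<^sub>R x) y = r *\<^sub>R sform H x y"
  by (simp add: vec_eq_iff sform_def scaleR_sum_right)

lemma sform_scaleR_right: "sform H x (r *\<^sub>R y) = r *\<^sub>R sform H x y"
  by (simp add: vec_eq_iff sform_def scaleR_sum_right)

lemma sform_0_left [simp]: "sform H 0 y = 0" and sform_0_right [simp]: "sform H x 0 = 0"
  by (simp_all add: vec_eq_iff sform_def)

lemma sform_diff_left: "sform H (x - x') y = sform H x y - sform H x' y"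
  by (simp add: vec_eq_iff sform_def algebra_simps sum_subtractf)

lemma hermitian_tuplesD: "H \<in> hermitian_tuples \<Longrightarrow> H $ l $ p $ q = cnj (H $ l $ q $ p)"
  unfolding hermitian_tuples_def hermitian_mat_def by blast

lemma sform_cnj:
  assumes "H \<in> hermitian_tuples"
  shows "cnj (sform H x y $ l) = sform H y x $ l"
proof -
  have H: "cnj (H $ l $ p $ q) = H $ l $ q $ p" for p q
    using hermitian_tuplesD[OF assms, of l q p] by simp
  have "cnj (sform H x y $ l) = (\<Sum>p\<in>UNIV. \<Sum>q\<in>UNIV. H $ l $ q $ p * cnj (x $ q) * y $ p)"
    by (simp add: sform_def H)
  also have "\<dots> = sform H y x $ l"
    unfolding sform_def by (subst sum.swap) (auto simp: mult_ac intro!: sum.cong)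
  finally show ?thesis .
qed

lemma hform_real: "H \<in> hermitian_tuples \<Longrightarrow> complex_of_real (Re (hform H z $ l)) = hform H z $ l"
  using sform_cnj[of H z z l] by (simp add: hform_eq_sform complex_eq_iff)

lemma hform_Im: "H \<in> hermitian_tuples \<Longrightarrow> Im (hform H z $ l) = 0"
  by (metis hform_real Im_complex_of_real)

lemma hform_smult: "hform H (c *s z) = complex_of_real ((cmod c)\<^sup>2) *s hform H z"
  using complex_norm_square[of c]
  by (simp add: hform_eq_sform sform_smult_left sform_smult_right vector_smult_assoc)

lemma sform_axis_right: "sform H x (axis p 1) $ l = (H $ l *v x) $ p"
  by (simp add: sform_nth axis_def if_distrib cong: if_cong)

lemma sform_axis: "sform H (axis q 1) (axis p 1) $ l = H $ l $ p $ q"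
  unfolding sform_axis_right by (simp add: matrix_vector_mult_def axis_def if_distrib cong: if_cong)

lemma matrix_mult_eq_0_iff_sform:
  assumes "H \<in> hermitian_tuples"
  shows "H $ l *v y = 0 \<longleftrightarrow> (\<forall>x. sform H x y $ l = 0)"
proof
  assume "H $ l *v y = 0"
  then have "sform H y x $ l = 0" for x by (simp add: sform_nth)
  then show "\<forall>x. sform H x y $ l = 0" using sform_cnj[OF assms] by (metis complex_cnj_zero_iff)
next
  assume "\<forall>x. sform H x y $ l = 0"
  then have "sform H y (axis p 1) $ l = 0" for p
    using sform_cnj[OF assms] by (metis complex_cnj_zero_iff)
  then show "H $ l *v y = 0" by (simp add: sform_axis_right vec_eq_iff)
qed

lemma bounded_bilinear_sform: "bounded_bilinear (sform H)"
proof -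
  have "bilinear (sform H)"
    unfolding bilinear_def by (auto intro!: linearI simp: sform_add_left sform_add_right
        sform_scaleR_left sform_scaleR_right)
  then show ?thesis by (simp add: bilinear_conv_bounded_bilinear)
qed

lemma poly_fun_sform_left:
  "(\<And>i. poly_fun (\<lambda>t. g t $ i)) \<Longrightarrow> poly_fun (\<lambda>t. sform H (g t) y $ l)"
  unfolding sform_def by (auto intro!: poly_fun_sum poly_fun_mult)

text \<open>The second slot is conjugate-linear and therefore receives \<open>cnj t\<close>; for
  real \<open>t\<close> this changes nothing, and the result can be continued in
  \<open>t\<close>.\<close>

lemma poly_fun_sform_right:
  assumes "\<And>i. poly_fun (\<lambda>t. g t $ i)"
  shows "poly_fun (\<lambda>t. sform H x (g (cnj t)) $ l)"
  using poly_fun_cnj[OF assms] unfolding sform_def by (auto intro!: poly_fun_sum poly_fun_mult)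

subsection \<open>Tangent polynomial fields\<close>

text \<open>Tangency at all points instead of near 0, with the differential of the defining function
  already evaluated.\<close>

definition quadric_tangent ::
  "complex^'n^'n^'k \<Rightarrow> ((complex^'n) \<times> (complex^'k) \<Rightarrow> (complex^'n) \<times> (complex^'k)) \<Rightarrow> bool" where
  "quadric_tangent H X \<longleftrightarrow> (\<forall>z w. (z, w) \<in> quadric H \<longrightarrow>
     (\<forall>l. Im (snd (X (z, w)) $ l) = 2 * Re (sform H (fst (X (z, w))) z $ l)))"

definition poly_field ::
  "((complex^'n) \<times> (complex^'k) \<Rightarrow> (complex^'n) \<times> (complex^'k)) \<Rightarrow> bool" where
  "poly_field X \<longleftrightarrow> (\<forall>i. mpoly_fun (\<lambda>p. fst (X p) $ i)) \<and> (\<forall>l. mpoly_fun (\<lambda>p. snd (X p) $ l))"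

text \<open>Only the scaling law is kept of weighted homogeneity. The factor \<open>t\<close> is
  complex, so it covers the rotations used to separate modes and the value 0.\<close>

definition weighted_field ::
  "nat \<Rightarrow> ((complex^'n) \<times> (complex^'k) \<Rightarrow> (complex^'n) \<times> (complex^'k)) \<Rightarrow> bool" where
  "weighted_field j X \<longleftrightarrow> poly_field X \<and>
     (\<forall>t z w. X (t *s z, t\<^sup>2 *s w) = (t ^ (j + 1) *s fst (X (z, w)), t ^ (j + 2) *s snd (X (z, w))))"

lemma weighted_fieldD:
  assumes "weighted_field j X"
  shows "poly_field X"
    "fst (X (t *s z, t\<^sup>2 *s w)) = t ^ (j + 1) *s fst (X (z, w))"
    "snd (X (t *s z, t\<^sup>2 *s w)) = t ^ (j + 2) *s snd (X (z, w))"
  using assms unfolding weighted_field_def by auto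

lemma poly_field_curve:
  assumes "poly_field X" "\<And>i. poly_fun (\<lambda>t. \<alpha> t $ i)" "\<And>l. poly_fun (\<lambda>t. \<beta> t $ l)"
  shows "poly_fun (\<lambda>t. fst (X (\<alpha> t, \<beta> t)) $ i)" "poly_fun (\<lambda>t. snd (X (\<alpha> t, \<beta> t)) $ l)"
  using mpoly_fun_curve[of "\<lambda>p. fst (X p) $ i" \<alpha> \<beta>] mpoly_fun_curve[of "\<lambda>p. snd (X p) $ l" \<alpha> \<beta>]
    assms unfolding poly_field_def by auto

section \<open>From germs of tangent fields to polynomial tangent fields\<close>

lemma quadric_iff: "(z, w) \<in> quadric H \<longleftrightarrow> (\<forall>l. complex_of_real (Im (w $ l)) = hform H z $ l)"
  by (simp add: quadric_def)

lemma quadric_iff_Im: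
  assumes "H \<in> hermitian_tuples"
  shows "(z, w) \<in> quadric H \<longleftrightarrow> (\<forall>l. Im (w $ l) = Re (hform H z $ l))"
  unfolding quadric_iff using hform_Im[OF assms, of z] by (simp add: complex_eq_iff)

lemma quadric_scale:
  fixes t :: real
  assumes "H \<in> hermitian_tuples" "(z, w) \<in> quadric H"
  shows "(of_real t *s z, (of_real t)\<^sup>2 *s w) \<in> quadric H"
  using assms(2) unfolding quadric_iff_Im[OF assms(1)]
  by (simp add: hform_smult power2_eq_square)

lemma bounded_linear_Im_vec: "bounded_linear (\<lambda>w::complex^'k. \<chi> l. complex_of_real (Im (w $ l)))"
  by (intro linear_conv_bounded_linear[THEN iffD1] linearI)
     (auto simp: vec_eq_iff complex_eq_iff)

lemma defining_fn_has_derivative: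
  "(defining_fn H has_derivative
     (\<lambda>d. (\<chi> l. complex_of_real (Im (snd d $ l))) - (sform H (fst p) (fst d) + sform H (fst d) (fst p)))) (at p)"
proof -
  have eq: "defining_fn H = (\<lambda>p. (\<chi> l. complex_of_real (Im (snd p $ l))) - sform H (fst p) (fst p))"
    by (auto simp: defining_fn_def hform_eq_sform fun_eq_iff)
  have 1: "((\<lambda>p. \<chi> l. complex_of_real (Im (snd p $ l))) has_derivative
        (\<lambda>d. \<chi> l. complex_of_real (Im (snd d $ l)))) (at p)"
    by (rule bounded_linear_imp_has_derivative[OF bounded_linear_compose[OF bounded_linear_Im_vec bounded_linear_snd]])
  have 2: "((\<lambda>p. sform H (fst p) (fst p)) has_derivative
        (\<lambda>d. sform H (fst p) (fst d) + sform H (fst d) (fst p))) (at p)"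
    by (rule bounded_bilinear.FDERIV[OF bounded_bilinear_sform])
       (auto intro!: bounded_linear_imp_has_derivative bounded_linear_fst)
  show ?thesis unfolding eq by (rule has_derivative_diff[OF 1 2])
qed

lemma tangent_at_iff:
  assumes "H \<in> hermitian_tuples"
  shows "(\<exists>D. (defining_fn H has_derivative D) (at p) \<and> D (X p) = 0) \<longleftrightarrow>
     (\<forall>l. Im (snd (X p) $ l) = 2 * Re (sform H (fst (X p)) (fst p) $ l))"
proof -
  define D0 where "D0 = (\<lambda>d. (\<chi> l. complex_of_real (Im (snd d $ l))) -
    (sform H (fst p) (fst d) + sform H (fst d) (fst p)))"
  have D0: "(defining_fn H has_derivative D0) (at p)"
    unfolding D0_def by (rule defining_fn_has_derivative)
  have "(\<exists>D. (defining_fn H has_derivative D) (at p) \<and> D (X p) = 0) \<longleftrightarrow> D0 (X p) = 0"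
    using D0 has_derivative_unique by blast
  also have "\<dots> \<longleftrightarrow> (\<forall>l. complex_of_real (Im (snd (X p) $ l)) =
      cnj (sform H (fst (X p)) (fst p) $ l) + sform H (fst (X p)) (fst p) $ l)"
    by (simp add: D0_def vec_eq_iff sform_cnj[OF assms])
  also have "\<dots> \<longleftrightarrow> (\<forall>l. Im (snd (X p) $ l) = 2 * Re (sform H (fst (X p)) (fst p) $ l))"
    by (simp add: complex_eq_iff)
  finally show ?thesis .
qed

lemma tangent_germ_iff:
  assumes "H \<in> hermitian_tuples"
  shows "tangent_germ H X \<longleftrightarrow> (\<forall>\<^sub>F p in nhds 0. p \<in> quadric H \<longrightarrow>
     (\<forall>l. Im (snd (X p) $ l) = 2 * Re (sform H (fst (X p)) (fst p) $ l)))"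
  unfolding tangent_germ_def tangent_at_iff[OF assms] ..

text \<open>Weighted dilations contract every point to 0, so a property of the germ is met somewhere
  on each dilation orbit.\<close>

lemma exists_scaled:
  assumes "\<forall>\<^sub>F p in nhds (0 :: (complex^'n) \<times> (complex^'k)). P p"
  shows "\<exists>t::real. t > 0 \<and> P (of_real t *s z, (of_real t)\<^sup>2 *s w)"
proof -
  have "((\<lambda>t::real. (t *\<^sub>R z, t\<^sup>2 *\<^sub>R w)) \<longlongrightarrow> (0 *\<^sub>R z, 0\<^sup>2 *\<^sub>R w)) (at_right 0)"
    by (intro tendsto_intros)
  then have "\<forall>\<^sub>F t in at_right 0. P ((t::real) *\<^sub>R z, t\<^sup>2 *\<^sub>R w)"
    using assms unfolding filterlim_def le_filter_def eventually_filtermap zero_prod_def by simp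
  moreover have "\<forall>\<^sub>F t in at_right (0::real). t > 0" by (simp add: eventually_at_right_less)
  ultimately have "\<forall>\<^sub>F t in at_right (0::real). t > 0 \<and> P (t *\<^sub>R z, t\<^sup>2 *\<^sub>R w)"
    by eventually_elim auto
  then obtain t :: real where "t > 0" "P (t *\<^sub>R z, t\<^sup>2 *\<^sub>R w)"
    using eventually_happens'[OF trivial_limit_at_right_real] by blast
  moreover have "t *\<^sub>R z = of_real t *s z" "t\<^sup>2 *\<^sub>R w = (of_real t)\<^sup>2 *s w"
    by (simp_all add: vec_eq_iff complex_eq_iff flip: of_real_power)
  ultimately show ?thesis by metis
qed

lemma weighted_monomials:
  fixes c :: "('n::finite \<Rightarrow> nat) \<times> ('k::finite \<Rightarrow> nat) \<Rightarrow> complex" and m :: nat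
  defines "F \<equiv> \<lambda>p. \<Sum>(a, b)\<in>exponents_of_weight (int m).
          c (a, b) * (\<Prod>j\<in>UNIV. fst p $ j ^ a j) * (\<Prod>l\<in>UNIV. snd p $ l ^ b l)"
  shows "mpoly_fun F" "F (t *s z, t\<^sup>2 *s w) = t ^ m * F (z, w)"
proof -
  show "mpoly_fun F"
    unfolding F_def split_def
    by (intro mpoly_fun_sum mpoly_fun.mult mpoly_fun.const mpoly_fun_prod mpoly_fun_power
          mpoly_fun.fst mpoly_fun.snd)
  have "c (a, b) * (\<Prod>j\<in>UNIV. (t * z $ j) ^ a j) * (\<Prod>l\<in>UNIV. (t\<^sup>2 * w $ l) ^ b l) =
      t ^ m * (c (a, b) * (\<Prod>j\<in>UNIV. z $ j ^ a j) * (\<Prod>l\<in>UNIV. w $ l ^ b l))"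
    if "(a, b) \<in> exponents_of_weight (int m)" for a b
  proof -
    have m: "m = sum a UNIV + 2 * sum b UNIV"
      using that unfolding exponents_of_weight_def
      by (simp only: mem_Collect_eq case_prod_conv of_nat_eq_iff)
    have "(\<Prod>j\<in>UNIV. (t * z $ j) ^ a j) = t ^ sum a UNIV * (\<Prod>j\<in>UNIV. z $ j ^ a j)"
      by (simp add: power_mult_distrib prod.distrib power_sum)
    moreover have "(\<Prod>l\<in>UNIV. (t\<^sup>2 * w $ l) ^ b l) = t ^ (2 * sum b UNIV) * (\<Prod>l\<in>UNIV. w $ l ^ b l)"
      by (simp add: power_mult_distrib prod.distrib power_sum sum_distrib_left power_mult)
    ultimately show ?thesis by (simp add: m power_add)
  qed
  then show "F (t *s z, t\<^sup>2 *s w) = t ^ m * F (z, w)"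
    unfolding F_def by (auto simp: sum_distrib_left intro!: sum.cong)
qed

text \<open>Near 0 the germ agrees with a polynomial field. Dilations preserve the quadric and
  multiply both sides of the tangency equation by \<open>t ^ (j + 2)\<close>, so tangency spreads
  from the germ to every point.\<close>

lemma aut_component_poly:
  fixes H :: "complex^'n^'n^'k"
  assumes H: "H \<in> hermitian_tuples" and X: "X \<in> aut_component H (int j)"
    and nz: "\<not> (\<forall>\<^sub>F p in nhds 0. X p = 0)"
  shows "\<exists>Y. weighted_field j Y \<and> quadric_tangent H Y \<and> (\<exists>p. Y p \<noteq> 0)"
proof -
  define F where "F = (\<lambda>m c (p :: (complex^'n) \<times> (complex^'k)). \<Sum>(a, b)\<in>exponents_of_weight (int m).
          c (a, b) * (\<Prod>j\<in>UNIV. fst p $ j ^ a j) * (\<Prod>l\<in>UNIV. snd p $ l ^ b l))"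
  have F: "mpoly_fun (F m c)" "F m c (t *s z, t\<^sup>2 *s w) = t ^ m * F m c (z, w)" for m c t z w
    unfolding F_def by (rule weighted_monomials)+
  have wh: "\<exists>c. \<forall>\<^sub>F p in nhds 0. f p = F m c p" if "weighted_homogeneous (int m) f" for m f
    using that unfolding weighted_homogeneous_def F_def by (simp only: case_prod_unfold prod.collapse fst_conv snd_conv)
  have "weighted_homogeneous (int (j + 1)) (\<lambda>p. fst (X p) $ i)"
    "weighted_homogeneous (int (j + 2)) (\<lambda>p. snd (X p) $ l)" for i l
    using X unfolding aut_component_def by (simp_all add: add.commute)
  note wh = this[THEN wh]
  define cf where "cf = (\<lambda>i. SOME c. \<forall>\<^sub>F p in nhds 0. fst (X p) $ i = F (j + 1) c p)"
  define ch where "ch = (\<lambda>i. SOME c. \<forall>\<^sub>F p in nhds 0. snd (X p) $ i = F (j + 2) c p)"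
  have cf: "\<forall>\<^sub>F p in nhds 0. fst (X p) $ i = F (j + 1) (cf i) p" for i
    unfolding cf_def by (rule someI_ex[OF wh(1)])
  have ch: "\<forall>\<^sub>F p in nhds 0. snd (X p) $ i = F (j + 2) (ch i) p" for i
    unfolding ch_def by (rule someI_ex[OF wh(2)])
  define Y where "Y = (\<lambda>p. ((\<chi> i. F (j + 1) (cf i) p), (\<chi> l. F (j + 2) (ch l) p)))"
  have Y: "weighted_field j Y"
    unfolding weighted_field_def poly_field_def
    by (simp add: Y_def F vec_eq_iff del: power_Suc)
  have XY: "\<forall>\<^sub>F p in nhds 0. X p = Y p"
  proof -
    have "\<forall>\<^sub>F p in nhds 0. \<forall>i. fst (X p) $ i = F (j + 1) (cf i) p"
      using cf by (simp add: eventually_all_finite)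
    moreover have "\<forall>\<^sub>F p in nhds 0. \<forall>i. snd (X p) $ i = F (j + 2) (ch i) p"
      using ch by (simp add: eventually_all_finite)
    ultimately show ?thesis
      by eventually_elim (simp add: Y_def prod_eq_iff vec_eq_iff)
  qed
  have "\<forall>\<^sub>F p in nhds 0. p \<in> quadric H \<longrightarrow>
     (\<forall>l. Im (snd (X p) $ l) = 2 * Re (sform H (fst (X p)) (fst p) $ l))"
    using X tangent_germ_iff[OF H] unfolding aut_component_def aut_quadric_def by blast
  with XY have ev: "\<forall>\<^sub>F p in nhds 0. p \<in> quadric H \<longrightarrow>
     (\<forall>l. Im (snd (Y p) $ l) = 2 * Re (sform H (fst (Y p)) (fst p) $ l))"
    by eventually_elim simp
  have "quadric_tangent H Y"
    unfolding quadric_tangent_def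
  proof (intro allI impI)
    fix z w l assume zw: "(z, w) \<in> quadric H"
    obtain t :: real where t: "t > 0" and "(of_real t *s z, (of_real t)\<^sup>2 *s w) \<in> quadric H \<longrightarrow>
     (\<forall>l. Im (snd (Y (of_real t *s z, (of_real t)\<^sup>2 *s w)) $ l) =
       2 * Re (sform H (fst (Y (of_real t *s z, (of_real t)\<^sup>2 *s w))) (of_real t *s z) $ l))"
      using exists_scaled[OF ev, of z w] by auto
    then have "Im ((of_real t ^ (j + 2) *s snd (Y (z, w))) $ l) =
       2 * Re (sform H (of_real t ^ (j + 1) *s fst (Y (z, w))) (of_real t *s z) $ l)"
      using quadric_scale[OF H zw] weighted_fieldD[OF Y] by metis
    then have "t ^ (j + 2) * Im (snd (Y (z, w)) $ l) = t ^ (j + 2) * (2 * Re (sform H (fst (Y (z, w))) z $ l))"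
      by (simp add: sform_smult_left sform_smult_right mult_ac flip: of_real_power)
    then show "Im (snd (Y (z, w)) $ l) = 2 * Re (sform H (fst (Y (z, w))) z $ l)"
      using t by simp
  qed
  moreover have "\<exists>p. Y p \<noteq> 0"
  proof (rule ccontr)
    assume "\<not> (\<exists>p. Y p \<noteq> 0)"
    then have "Y = (\<lambda>_. 0)" by blast
    with XY have "\<forall>\<^sub>F p in nhds 0. X p = 0" by (simp only:)
    with nz show False by simp
  qed
  ultimately show ?thesis using Y by blast
qed

text \<open>The tangency equation at \<open>(e z, u + (x + \<i>) \<langle>z, z\<rangle>)\<close> with \<open>\<bar>e\<bar> = 1\<close> is polynomial in the real
  number \<open>x\<close>, so it may be evaluated at \<open>x = - \<i>\<close>.\<close>

lemma tangent_complexified: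
  assumes H: "H \<in> hermitian_tuples" and X: "poly_field X" "quadric_tangent H X"
    and u: "\<And>l. Im (u $ l) = 0" and e: "norm e = 1"
  shows "snd (X (e *s z, u)) $ l - cnj (snd (X (e *s z, u + (2 * \<i>) *s hform H z)) $ l) =
     2 * \<i> * (cnj e * sform H (fst (X (e *s z, u))) z $ l +
       e * cnj (sform H (fst (X (e *s z, u + (2 * \<i>) *s hform H z))) z $ l))"
proof -
  define v where "v = hform H z"
  define hh where "hh = (\<lambda>y. snd (X (e *s z, u + y *s v)) $ l)"
  define ff where "ff = (\<lambda>y. sform H (fst (X (e *s z, u + y *s v))) z $ l)"
  have hh: "poly_fun hh"
    unfolding hh_def by (rule poly_field_curve[OF X(1)]) (auto intro!: poly_fun_add poly_fun_mult)
  have ff: "poly_fun ff"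
    unfolding ff_def
    by (rule poly_fun_sform_left, rule poly_field_curve[OF X(1)]) (auto intro!: poly_fun_add poly_fun_mult)
  have shift1: "poly_fun (\<lambda>x. g (x + \<i>))" if "poly_fun g" for g
    by (rule poly_fun_compose[OF that, of "\<lambda>x. x + \<i>"]) (intro poly_fun_add poly_fun_id poly_fun_const)
  have shift2: "poly_fun (\<lambda>x. cnj (g (cnj (x - \<i>))))" if "poly_fun g" for g
    by (rule poly_fun_compose[OF poly_fun_cnj[OF that], of "\<lambda>x. x - \<i>"]) (intro poly_fun_diff poly_fun_id poly_fun_const)
  have "hh (x + \<i>) - cnj (hh (cnj (x - \<i>))) =
      2 * \<i> * (cnj e * ff (x + \<i>) + e * cnj (ff (cnj (x - \<i>))))" for x
  proof (rule poly_fun_eqI_real[where t = x])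
    show "poly_fun (\<lambda>x. hh (x + \<i>) - cnj (hh (cnj (x - \<i>))))"
      by (intro poly_fun_diff shift1 shift2 hh)
    show "poly_fun (\<lambda>x. 2 * \<i> * (cnj e * ff (x + \<i>) + e * cnj (ff (cnj (x - \<i>)))))"
      by (intro poly_fun_mult poly_fun_add poly_fun_const shift1 shift2 ff)
    fix x :: real
    have "Im ((u + (of_real x + \<i>) *s v) $ l) = Re (hform H (e *s z) $ l)" for l
      using hform_Im[OF H, of z] by (simp add: u hform_smult e v_def)
    then have "(e *s z, u + (of_real x + \<i>) *s v) \<in> quadric H"
      using quadric_iff_Im[OF H] by blast
    then have *: "Im (hh (of_real x + \<i>)) = 2 * Re (cnj e * ff (of_real x + \<i>))"
      using X(2) unfolding quadric_tangent_def hh_def ff_def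
      by (simp add: sform_smult_right)
    have "cnj (of_real x - \<i>) = of_real x + \<i>" by simp
    moreover have "A - cnj A = 2 * \<i> * (B + cnj B)" if "Im A = 2 * Re B" for A B
      using that by (simp add: complex_eq_iff)
    ultimately show "hh (of_real x + \<i>) - cnj (hh (cnj (of_real x - \<i>))) =
      2 * \<i> * (cnj e * ff (of_real x + \<i>) + e * cnj (ff (cnj (of_real x - \<i>))))"
      using * by (simp only: complex_cnj_mult complex_cnj_cnj)
  qed
  from this[of "- \<i>"] show ?thesis by (simp add: hh_def ff_def v_def)
qed

text \<open>In the complexified equation at \<open>u = 0\<close>, the values at
  \<open>(e *s z, 0)\<close> are pure powers of \<open>e\<close>. Conjugating and multiplying by
  \<open>e ^ (j + 2)\<close> leaves a constant, a multiple of \<open>e\<^sup>2\<close>, and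
  \<open>e ^ (j + 1)\<close> times a polynomial. These vanish separately, and the value of the last
  polynomial at \<open>e = 0\<close> is the claim up to a factor.\<close>

lemma tangent_weighted_field_isotropic:
  assumes H: "H \<in> hermitian_tuples" and X: "weighted_field j X" "quadric_tangent H X" and j: "j \<ge> 2"
  shows "sform H z (fst (X (0, hform H z))) = 0"
proof -
  have P: "poly_field X" using X(1) weighted_fieldD by blast
  have "sform H (fst (X (0, (2 * \<i>) *s hform H z))) z $ l = 0" for l
  proof -
    define c1 where "c1 = cnj (snd (X (z, 0)) $ l)"
    define c2 where "c2 = cnj (sform H (fst (X (z, 0))) z $ l)"
    define hh where "hh = (\<lambda>e. snd (X (e *s z, (2 * \<i>) *s hform H z)) $ l)"
    define ff where "ff = (\<lambda>e. sform H (fst (X (e *s z, (2 * \<i>) *s hform H z))) z $ l)"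
    have hh: "poly_fun hh"
      unfolding hh_def by (rule poly_field_curve[OF P]) (auto intro!: poly_fun_add poly_fun_mult)
    have ff: "poly_fun ff"
      unfolding ff_def
      by (rule poly_fun_sform_left, rule poly_field_curve[OF P]) (auto intro!: poly_fun_add poly_fun_mult)
    \<comment> \<open>Here weight at least 2 is needed: \<open>e ^ (j + 1)\<close> still has a
      positive power of \<open>e\<close> left after division by \<open>e\<^sup>2\<close>, so the
      coefficient \<open>c2\<close> is isolated.\<close>
    obtain i where i: "j = i + 2" using j by (metis add.commute le_Suc_ex)
    have zero: "c1 + 2 * \<i> * c2 * e\<^sup>2 + e ^ (j + 1) * (2 * \<i> * ff e - e * hh e) = 0" for e
    proof (rule poly_fun_eqI_circle[where g = "\<lambda>_. 0" and r = 1 and t = e])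
      show "poly_fun (\<lambda>e. c1 + 2 * \<i> * c2 * e\<^sup>2 + e ^ (j + 1) * (2 * \<i> * ff e - e * hh e))"
        by (intro poly_fun_add poly_fun_mult poly_fun_diff poly_fun_power poly_fun_const poly_fun_id hh ff)
      fix e :: complex assume e: "norm e = 1"
      have ee: "e * cnj e = 1" using complex_norm_square[of e] e by simp
      have s: "X (e *s z, 0) = (e ^ (j + 1) *s fst (X (z, 0)), e ^ (j + 2) *s snd (X (z, 0)))"
        using weighted_fieldD(2,3)[OF X(1), of e z 0] by (simp add: prod_eq_iff)
      have "e ^ (j + 2) * cnj c1 - cnj (hh e) = 2 * \<i> * (cnj e * (e ^ (j + 1) * cnj c2) + e * cnj (ff e))"
        using tangent_complexified[OF H P X(2), of 0 e z l] e
        by (simp add: s sform_smult_left c1_def c2_def hh_def ff_def)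
      then have "cnj (e ^ (j + 2) * cnj c1 - cnj (hh e)) =
          cnj (2 * \<i> * (cnj e * (e ^ (j + 1) * cnj c2) + e * cnj (ff e)))" by simp
      then have 1: "cnj e ^ (j + 2) * c1 - hh e = - 2 * \<i> * (e * (cnj e ^ (j + 1) * c2) + cnj e * ff e)"
        by simp
      have pw: "e ^ m * cnj e ^ m = 1" for m by (simp add: ee flip: power_mult_distrib)
      have "e ^ (j + 2) * (cnj e ^ (j + 2) * c1 - hh e) = (e ^ (j + 2) * cnj e ^ (j + 2)) * c1 - e ^ (j + 2) * hh e"
        by (simp add: algebra_simps)
      also have "\<dots> = c1 - e ^ (j + 2) * hh e" unfolding pw by simp
      finally have "c1 - e ^ (j + 2) * hh e = e ^ (j + 2) * (cnj e ^ (j + 2) * c1 - hh e)" by (rule sym)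
      also have "\<dots> = e ^ (j + 2) * (- 2 * \<i> * (e * (cnj e ^ (j + 1) * c2) + cnj e * ff e))"
        by (simp only: 1)
      also have "\<dots> = - 2 * \<i> * (e\<^sup>2 * (e ^ (j + 1) * cnj e ^ (j + 1)) * c2 + e ^ (j + 1) * (e * cnj e) * ff e)"
        by (simp add: algebra_simps power2_eq_square)
      also have "\<dots> = - 2 * \<i> * (e\<^sup>2 * c2 + e ^ (j + 1) * ff e)" unfolding pw ee by simp
      finally have "c1 - e ^ (j + 2) * hh e = - 2 * \<i> * (e\<^sup>2 * c2 + e ^ (j + 1) * ff e)" .
      then show "c1 + 2 * \<i> * c2 * e\<^sup>2 + e ^ (j + 1) * (2 * \<i> * ff e - e * hh e) = 0"
        by (simp add: algebra_simps)
    qed auto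
    have c1: "c1 = 0" using zero[of 0] by simp
    have z2: "2 * \<i> * c2 + e ^ (i + 1) * (2 * \<i> * ff e - e * hh e) = 0" for e
    proof (rule poly_fun_power_mult_eq_0[where n = 2 and t = e])
      show "poly_fun (\<lambda>e. 2 * \<i> * c2 + e ^ (i + 1) * (2 * \<i> * ff e - e * hh e))"
        by (intro poly_fun_add poly_fun_mult poly_fun_diff poly_fun_power poly_fun_const poly_fun_id hh ff)
      show "t\<^sup>2 * (2 * \<i> * c2 + t ^ (i + 1) * (2 * \<i> * ff t - t * hh t)) = 0" for t
        using zero[of t] by (simp add: c1 i algebra_simps power2_eq_square)
    qed
    have c2: "c2 = 0" using z2[of 0] by simp
    have "2 * \<i> * ff e - e * hh e = 0" for e
    proof (rule poly_fun_power_mult_eq_0[where n = "i + 1" and t = e])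
      show "poly_fun (\<lambda>e. 2 * \<i> * ff e - e * hh e)"
        by (intro poly_fun_mult poly_fun_diff poly_fun_const poly_fun_id hh ff)
      show "t ^ (i + 1) * (2 * \<i> * ff t - t * hh t) = 0" for t
        using z2[of t] by (simp add: c2)
    qed
    from this[of 0] show ?thesis by (simp add: ff_def)
  qed
  then have 0: "sform H (fst (X (0, (2 * \<i>) *s hform H z))) z = 0" by (simp add: vec_eq_iff)
  \<comment> \<open>A weighted dilation with this factor removes 2 \<i> from the argument.\<close>
  define t where "t = csqrt (2 * \<i>)"
  have t: "t\<^sup>2 = 2 * \<i>" "t \<noteq> 0" by (auto simp: t_def)
  have "fst (X (0, (2 * \<i>) *s hform H z)) = t ^ (j + 1) *s fst (X (0, hform H z))"
    using weighted_fieldD(2)[OF X(1), of t 0 "hform H z"] by (simp add: t)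
  with 0 have "sform H (fst (X (0, hform H z))) z = 0"
    using t by (simp add: sform_smult_left vec_eq_iff)
  then show ?thesis using sform_cnj[OF H] by (simp add: vec_eq_iff) (metis complex_cnj_zero)
qed

section \<open>Commutators with fields of weight -1\<close>

lemma has_derivative_vec_components:
  fixes f :: "'a::real_normed_vector \<Rightarrow> complex^'n"
  assumes "\<And>i. ((\<lambda>x. f x $ i) has_derivative (\<lambda>d. f' d $ i)) F"
  shows "(f has_derivative f') F"
proof -
  have lin: "bounded_linear (axis i :: complex \<Rightarrow> complex^'n)" for i
    by (intro linear_conv_bounded_linear[THEN iffD1] linearI) (auto simp: axis_def vec_eq_iff)
  have sum: "(\<Sum>i\<in>UNIV. axis i (y $ i)) = y" for y :: "complex^'n"
    by (simp add: vec_eq_iff axis_def if_distrib cong: if_cong)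
  have "((\<lambda>x. \<Sum>i\<in>UNIV. axis i (f x $ i)) has_derivative (\<lambda>d. \<Sum>i\<in>UNIV. axis i (f' d $ i))) F"
    by (intro has_derivative_sum bounded_linear.has_derivative[OF lin] assms)
  then show ?thesis by (simp add: sum)
qed

lemma poly_field_derivative:
  fixes X :: "(complex^'n) \<times> (complex^'k) \<Rightarrow> (complex^'n) \<times> (complex^'k)"
  assumes "poly_field X"
  shows "\<exists>D. (\<forall>x. (X has_derivative D x) (at x)) \<and>
    (\<forall>x c z w. D x (c *s z, c *s w) = (c *s fst (D x (z, w)), c *s snd (D x (z, w)))) \<and>
    (\<forall>G. poly_field G \<longrightarrow> poly_field (\<lambda>x. D x (G x)))"
proof -
  have mp: "mpoly_fun (\<lambda>p. fst (X p) $ i)" "mpoly_fun (\<lambda>p. snd (X p) $ l)" for i l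
    using assms unfolding poly_field_def by auto
  define der where "der = (\<lambda>F (DF :: (complex^'n) \<times> (complex^'k) \<Rightarrow> (complex^'n) \<times> (complex^'k) \<Rightarrow> complex).
    (\<forall>x. (F has_derivative DF x) (at x)) \<and> (\<forall>x. clinear_map (DF x)) \<and>
    (\<forall>G. poly_field G \<longrightarrow> mpoly_fun (\<lambda>x. DF x (G x))))"
  have ex: "\<exists>DF. der F DF" if "mpoly_fun F" for F
    using mpoly_fun_derivative[OF that] unfolding der_def poly_field_def by (simp add: imp_conjL)
  define DF where "DF = (\<lambda>i. SOME DF. der (\<lambda>p. fst (X p) $ i) DF)"
  define DH where "DH = (\<lambda>i. SOME DF. der (\<lambda>p. snd (X p) $ i) DF)"
  have "der (\<lambda>p. fst (X p) $ i) (DF i)" for i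
    unfolding DF_def by (rule someI_ex[OF ex[OF mp(1)]])
  then have DF: "\<And>i x. ((\<lambda>p. fst (X p) $ i) has_derivative DF i x) (at x)"
      "\<And>i x. clinear_map (DF i x)" "\<And>i G. poly_field G \<Longrightarrow> mpoly_fun (\<lambda>x. DF i x (G x))"
    unfolding der_def by blast+
  have "der (\<lambda>p. snd (X p) $ i) (DH i)" for i
    unfolding DH_def by (rule someI_ex[OF ex[OF mp(2)]])
  then have DH: "\<And>i x. ((\<lambda>p. snd (X p) $ i) has_derivative DH i x) (at x)"
      "\<And>i x. clinear_map (DH i x)" "\<And>i G. poly_field G \<Longrightarrow> mpoly_fun (\<lambda>x. DH i x (G x))"
    unfolding der_def by blast+
  define D where "D = (\<lambda>x d. ((\<chi> i. DF i x d), (\<chi> l. DH l x d)))"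
  have "((\<lambda>p. (fst (X p), snd (X p))) has_derivative D x) (at x)" for x
    unfolding D_def
    by (intro has_derivative_Pair has_derivative_vec_components) (simp_all add: DF DH)
  moreover have "D x (c *s z, c *s w) = (c *s fst (D x (z, w)), c *s snd (D x (z, w)))" for x c z w
    using DF(2) DH(2) by (simp add: D_def vec_eq_iff clinear_map_def)
  moreover have "poly_field (\<lambda>x. D x (G x))" if "poly_field G" for G
    using DF(3)[OF that] DH(3)[OF that] by (simp add: D_def poly_field_def)
  ultimately show ?thesis by auto
qed

text \<open>The commutator with the field \<open>(p, 2 \<i> \<langle>z, p\<rangle>)\<close> of weight \<open>-1\<close>, which generates the
  affine automorphisms \<open>(z + p, w + 2 \<i> \<langle>z, p\<rangle> + \<i> \<langle>p, p\<rangle>)\<close> of the quadric.\<close>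

lemma tangent_field_commutator:
  fixes X :: "(complex^'n) \<times> (complex^'k) \<Rightarrow> (complex^'n) \<times> (complex^'k)"
  assumes H: "H \<in> hermitian_tuples" and X: "weighted_field (Suc j) X" "quadric_tangent H X"
  shows "\<exists>Y. weighted_field j Y \<and> quadric_tangent H Y \<and>
    (\<forall>w i. ((\<lambda>t. fst (X (t *s p, w)) $ i) has_field_derivative fst (Y (0, w)) $ i) (at 0))"
proof -
  have P: "poly_field X" using X(1) weighted_fieldD by blast
  obtain D where D: "\<And>x. (X has_derivative D x) (at x)"
      "\<And>x c z w. D x (c *s z, c *s w) = (c *s fst (D x (z, w)), c *s snd (D x (z, w)))"
      "\<And>G. poly_field G \<Longrightarrow> poly_field (\<lambda>x. D x (G x))"
    using poly_field_derivative[OF P] by (elim exE conjE) (rule that, blast+)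
  define G where "G = (\<lambda>x :: (complex^'n) \<times> (complex^'k). (p, (2 * \<i>) *s sform H (fst x) p))"
  have G: "poly_field G"
    by (auto simp: poly_field_def G_def sform_def
        intro!: mpoly_fun.intros mpoly_fun_sum)
  \<comment> \<open>This is the derivative of \<open>X\<close> along \<open>G\<close> minus that of
    \<open>G\<close> along \<open>X\<close>; the latter has first component 0 because
    \<open>fst (G x)\<close> is constant.\<close>
  define Y where "Y = (\<lambda>x. (fst (D x (G x)), snd (D x (G x)) - (2 * \<i>) *s sform H (fst (X x)) p))"
  have DG: "poly_field (\<lambda>x. D x (G x))" by (rule D(3)[OF G])
  have Yp: "poly_field Y"
    unfolding poly_field_def
  proof (intro conjI allI)
    show "mpoly_fun (\<lambda>x. fst (Y x) $ i)" for i
      using DG by (simp add: poly_field_def Y_def)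
    show "mpoly_fun (\<lambda>x. snd (Y x) $ l)" for l
      using DG P unfolding poly_field_def Y_def
      by (auto simp: sform_def intro!: mpoly_fun_diff mpoly_fun.mult mpoly_fun.const mpoly_fun_sum)
  qed
  have Yw: "Y (t *s z, t\<^sup>2 *s w) = (t ^ (j + 1) *s fst (Y (z, w)), t ^ (j + 2) *s snd (Y (z, w)))" for t z w
  proof -
    \<comment> \<open>Differentiating the scaling law of \<open>X\<close> gives this with an
      additional factor \<open>t\<close> on both sides. After cancelling it, the case
      \<open>t = 0\<close> is recovered by polynomial continuation.\<close>
    have nz: "Y (t *s z, t\<^sup>2 *s w) = (t ^ (j + 1) *s fst (Y (z, w)), t ^ (j + 2) *s snd (Y (z, w)))"
      if t: "t \<noteq> 0" for t
    proof -
      let ?S = "\<lambda>x::(complex^'n) \<times> (complex^'k). (t *s fst x, t\<^sup>2 *s snd x)"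
      let ?R = "\<lambda>x::(complex^'n) \<times> (complex^'k). (t ^ (Suc j + 1) *s fst x, t ^ (Suc j + 2) *s snd x)"
      have lin: "linear (\<lambda>x::complex^'m. c *s x)" for c
        by (intro linearI) (simp_all add: vec_eq_iff algebra_simps)
      have bl: "bounded_linear (\<lambda>x::complex^'m. c *s x)" for c
        using linear_conv_bounded_linear lin by blast
      have blS: "bounded_linear ?S" "bounded_linear ?R"
        by (intro bounded_linear_Pair bounded_linear_compose[OF bl] bounded_linear_fst bounded_linear_snd)+
      have eq: "X \<circ> ?S = ?R \<circ> X"
        by (simp add: fun_eq_iff prod_eq_iff weighted_fieldD(2,3)[OF X(1)] del: power_Suc)
      have "(X \<circ> ?S has_derivative (D (?S (z, w)) \<circ> ?S)) (at (z, w))"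
        by (rule diff_chain_at[OF bounded_linear_imp_has_derivative[OF blS(1)] D(1)])
      moreover have "(?R \<circ> X has_derivative (?R \<circ> D (z, w))) (at (z, w))"
        by (rule diff_chain_at[OF D(1) bounded_linear_imp_has_derivative[OF blS(2)]])
      ultimately have DS: "D (?S (z, w)) \<circ> ?S = ?R \<circ> D (z, w)"
        unfolding eq by (rule has_derivative_unique)
      have "?S (G (z, w)) = (t *s fst (G (t *s z, t\<^sup>2 *s w)), t *s snd (G (t *s z, t\<^sup>2 *s w)))"
        by (simp add: G_def sform_smult_left vec_eq_iff power2_eq_square)
      then have "D (t *s z, t\<^sup>2 *s w) (?S (G (z, w))) =
          (t *s fst (D (t *s z, t\<^sup>2 *s w) (G (t *s z, t\<^sup>2 *s w))),
           t *s snd (D (t *s z, t\<^sup>2 *s w) (G (t *s z, t\<^sup>2 *s w))))"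
        by (simp only: D(2) prod.collapse)
      moreover have "D (t *s z, t\<^sup>2 *s w) (?S (G (z, w))) = ?R (D (z, w) (G (z, w)))"
        using fun_cong[OF DS, of "G (z, w)"] by simp
      ultimately have "t *s fst (D (t *s z, t\<^sup>2 *s w) (G (t *s z, t\<^sup>2 *s w))) =
            t *s (t ^ (j + 1) *s fst (D (z, w) (G (z, w))))"
          "t *s snd (D (t *s z, t\<^sup>2 *s w) (G (t *s z, t\<^sup>2 *s w))) =
            t *s (t ^ (j + 2) *s snd (D (z, w) (G (z, w))))"
        by (simp_all add: vector_smult_assoc numeral_eq_Suc)
      then have "fst (D (t *s z, t\<^sup>2 *s w) (G (t *s z, t\<^sup>2 *s w))) = t ^ (j + 1) *s fst (D (z, w) (G (z, w)))"
          "snd (D (t *s z, t\<^sup>2 *s w) (G (t *s z, t\<^sup>2 *s w))) = t ^ (j + 2) *s snd (D (z, w) (G (z, w)))"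
        using t by (simp_all only: vector_mul_lcancel simp_thms)
      moreover have "fst (X (t *s z, t\<^sup>2 *s w)) = t ^ (j + 2) *s fst (X (z, w))"
        using weighted_fieldD(2)[OF X(1)] by simp
      then have "sform H (fst (X (t *s z, t\<^sup>2 *s w))) p = t ^ (j + 2) *s sform H (fst (X (z, w))) p"
        by (simp only: sform_smult_left)
      ultimately show ?thesis
        unfolding Y_def by (simp add: vec_eq_iff right_diff_distrib mult_ac)
    qed
    show ?thesis
    proof (cases "t = 0")
      case False then show ?thesis by (rule nz)
    next
      case True
      have "fst (Y (s *s z, s\<^sup>2 *s w)) $ i = s ^ (j + 1) * fst (Y (z, w)) $ i" for i s
      proof (rule poly_fun_eqI_real[where t = s])
        show "poly_fun (\<lambda>s. fst (Y (s *s z, s\<^sup>2 *s w)) $ i)"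
          by (rule poly_field_curve[OF Yp]) (auto intro!: poly_fun_mult poly_fun_power)
        show "poly_fun (\<lambda>s. s ^ (j + 1) * fst (Y (z, w)) $ i)"
          by (intro poly_fun_mult poly_fun_power poly_fun_id poly_fun_const)
      qed (subst nz, auto)
      moreover have "snd (Y (s *s z, s\<^sup>2 *s w)) $ i = s ^ (j + 2) * snd (Y (z, w)) $ i" for i s
      proof (rule poly_fun_eqI_real[where t = s])
        show "poly_fun (\<lambda>s. snd (Y (s *s z, s\<^sup>2 *s w)) $ i)"
          by (rule poly_field_curve[OF Yp]) (auto intro!: poly_fun_mult poly_fun_power)
        show "poly_fun (\<lambda>s. s ^ (j + 2) * snd (Y (z, w)) $ i)"
          by (intro poly_fun_mult poly_fun_power poly_fun_id poly_fun_const)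
      qed (subst nz, auto)
      ultimately show ?thesis by (simp add: prod_eq_iff vec_eq_iff)
    qed
  qed
  have "quadric_tangent H Y"
    unfolding quadric_tangent_def
  proof (intro allI impI)
    fix z w l assume zw: "(z, w) \<in> quadric H"
    \<comment> \<open>The orbit of \<open>(z, w)\<close> under the affine automorphisms: it stays in
      the quadric, so the tangency equation of \<open>X\<close> may be differentiated along it,
      which gives that of \<open>Y\<close>.\<close>
    define \<gamma> where "\<gamma> = (\<lambda>\<epsilon>::real. (z + \<epsilon> *\<^sub>R p, w + \<epsilon> *\<^sub>R ((2 * \<i>) *s sform H z p) + \<epsilon>\<^sup>2 *\<^sub>R (\<i> *s hform H p)))"
    have \<gamma>Q: "\<gamma> \<epsilon> \<in> quadric H" for \<epsilon>
    proof -
      have "Re (sform H p z $ l) = Re (sform H z p $ l)" for l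
        by (subst sform_cnj[OF H, symmetric]) simp
      then show ?thesis
        using zw hform_Im[OF H, of p] unfolding \<gamma>_def quadric_iff_Im[OF H]
        by (simp add: hform_eq_sform sform_add_left sform_add_right sform_scaleR_left sform_scaleR_right
            power2_eq_square algebra_simps)
    qed
    have \<gamma>d: "(\<gamma> has_derivative (\<lambda>\<epsilon>. \<epsilon> *\<^sub>R G (z, w))) (at 0)"
    proof -
      have "(\<gamma> has_derivative (\<lambda>\<epsilon>. (0 + \<epsilon> *\<^sub>R p, 0 + \<epsilon> *\<^sub>R ((2 * \<i>) *s sform H z p) +
            (of_nat 2 * (\<epsilon> * 0 ^ (2 - 1))) *\<^sub>R (\<i> *s hform H p)))) (at 0)"
        unfolding \<gamma>_def by (auto intro!: derivative_eq_intros)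
      then show ?thesis by (simp add: G_def)
    qed
    have lin: "D (z, w) (\<epsilon> *\<^sub>R d) = \<epsilon> *\<^sub>R D (z, w) d" for \<epsilon> d
      using has_derivative_linear[OF D(1)] linear_cmul by blast
    have \<gamma>0: "\<gamma> 0 = (z, w)" by (simp add: \<gamma>_def)
    have Xd: "((\<lambda>\<epsilon>. X (\<gamma> \<epsilon>)) has_derivative (\<lambda>\<epsilon>. \<epsilon> *\<^sub>R D (z, w) (G (z, w)))) (at 0)"
      using diff_chain_at[OF \<gamma>d, of X "D (z, w)"] D(1)[of "(z, w)"] by (simp add: \<gamma>0 o_def lin)
    note fd = has_derivative_fst[OF Xd] and hd = has_derivative_snd[OF Xd]
    have zd: "((\<lambda>\<epsilon>::real. z + \<epsilon> *\<^sub>R p) has_derivative (\<lambda>\<epsilon>. \<epsilon> *\<^sub>R p)) (at 0)"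
      by (auto intro!: derivative_eq_intros)
    have L: "((\<lambda>\<epsilon>. Im (snd (X (\<gamma> \<epsilon>)) $ l)) has_derivative
        (\<lambda>\<epsilon>. Im (snd (\<epsilon> *\<^sub>R D (z, w) (G (z, w))) $ l))) (at 0)"
      by (intro bounded_linear.has_derivative[OF bounded_linear_Im]
          bounded_linear.has_derivative[OF bounded_linear_vec_nth] hd)
    have R: "((\<lambda>\<epsilon>. 2 * Re (sform H (fst (X (\<gamma> \<epsilon>))) (z + \<epsilon> *\<^sub>R p) $ l)) has_derivative
        (\<lambda>\<epsilon>. 2 * Re ((sform H (fst (X (\<gamma> 0))) (\<epsilon> *\<^sub>R p) +
           sform H (fst (\<epsilon> *\<^sub>R D (z, w) (G (z, w)))) (z + 0 *\<^sub>R p)) $ l))) (at 0)"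
      by (intro has_derivative_mult_right bounded_linear.has_derivative[OF bounded_linear_Re]
          bounded_linear.has_derivative[OF bounded_linear_vec_nth]
          bounded_bilinear.FDERIV[OF bounded_bilinear_sform] fd zd)
    have eq: "(\<lambda>\<epsilon>. Im (snd (X (\<gamma> \<epsilon>)) $ l)) = (\<lambda>\<epsilon>. 2 * Re (sform H (fst (X (\<gamma> \<epsilon>))) (z + \<epsilon> *\<^sub>R p) $ l))"
      using X(2) \<gamma>Q unfolding quadric_tangent_def \<gamma>_def by blast
    have "Im (snd (1 *\<^sub>R D (z, w) (G (z, w))) $ l) =
       2 * Re ((sform H (fst (X (\<gamma> 0))) (1 *\<^sub>R p) +
           sform H (fst (1 *\<^sub>R D (z, w) (G (z, w)))) (z + 0 *\<^sub>R p)) $ l)"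
      using has_derivative_unique[OF L R[folded eq]] by (rule fun_cong)
    then show "Im (snd (Y (z, w)) $ l) = 2 * Re (sform H (fst (Y (z, w))) z $ l)"
      by (simp add: Y_def \<gamma>0)
  qed
  moreover have "((\<lambda>t. fst (X (t *s p, w)) $ i) has_field_derivative fst (Y (0, w)) $ i) (at 0)" for w i
  proof -
    have "bounded_linear (\<lambda>t::complex. (t *s p, 0 :: complex^'k))"
      by (intro linear_conv_bounded_linear[THEN iffD1] linearI)
         (simp_all add: vec_eq_iff algebra_simps)
    then have "((\<lambda>t::complex. (0, w) + (t *s p, 0)) has_derivative (\<lambda>t. 0 + (t *s p, 0))) (at 0)"
      by (intro has_derivative_add has_derivative_const bounded_linear_imp_has_derivative)
    then have "((\<lambda>t. (t *s p, w)) has_derivative (\<lambda>t. (t *s p, 0))) (at (0::complex))" by simp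
    from diff_chain_at[OF this, of X "D (0, w)"]
    have "((\<lambda>t. X (t *s p, w)) has_derivative (\<lambda>t. D (0, w) (t *s p, t *s 0))) (at 0)"
      using D(1)[of "(0, w)"] by (simp add: o_def)
    then have "((\<lambda>t. X (t *s p, w)) has_derivative
       (\<lambda>t. (t *s fst (D (0, w) (p, 0)), t *s snd (D (0, w) (p, 0))))) (at 0)"
      by (simp only: D(2))
    from bounded_linear.has_derivative[OF bounded_linear_vec_nth has_derivative_fst[OF this]]
    have "((\<lambda>t. fst (X (t *s p, w)) $ i) has_derivative (\<lambda>t. t * fst (D (0, w) (p, 0)) $ i)) (at 0)"
      by simp
    then show ?thesis
      by (simp add: has_field_derivative_def Y_def G_def mult.commute[of _ "_ $ _"])
  qed
  ultimately show ?thesis using Yp Yw unfolding weighted_field_def by blast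
qed

section \<open>Tangent fields without terms of order 0 and 1 in z\<close>

lemma poly_fun_double_zero:
  assumes "poly_fun g" "g 0 = 0" "(g has_field_derivative 0) (at 0)"
  shows "\<exists>h. poly_fun h \<and> (\<forall>t. g t = t\<^sup>2 * h t)"
proof -
  obtain p where p: "\<And>t. g t = poly p t" using assms(1) unfolding poly_fun_def by blast
  obtain a q where q: "p = pCons a q" by (cases p)
  have a: "a = 0" using assms(2) by (simp add: p q)
  have "g = poly p" using p by auto
  with assms(3) have "(poly p has_field_derivative 0) (at 0)" by simp
  with poly_DERIV[of p 0] have "poly (pderiv p) 0 = 0" using DERIV_unique by blast
  then have "poly q 0 = 0" by (simp add: q pderiv_pCons a)
  then obtain b r where r: "q = pCons 0 r" by (cases q) auto
  show ?thesis
    by (rule exI[of _ "poly r"]) (auto simp: poly_fun_def p q a r power2_eq_square)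
qed

text \<open>On the circle the right-hand side is a polynomial in 1/e and the left-hand side one in
  e, so only the constant terms survive. Multiplication by e^d, with d the degree of the former,
  turns this into a comparison of degrees.\<close>

lemma poly_fun_antiholomorphic_const:
  assumes "poly_fun P" "poly_fun Q" "\<And>e. norm e = 1 \<Longrightarrow> P e = cnj (Q e)"
  shows "P t = cnj (Q 0)"
proof -
  obtain p where p: "\<And>t. P t = poly p t" using assms(1) unfolding poly_fun_def by blast
  obtain q where q: "\<And>t. cnj (Q (cnj t)) = poly q t"
    using poly_fun_cnj[OF assms(2)] unfolding poly_fun_def by blast
  define d where "d = degree q"
  have "poly (monom 1 d * p) e = poly (reflect_poly q) e" for e
  proof (rule poly_fun_eqI_circle[of "poly (monom 1 d * p)" "poly (reflect_poly q)" 1])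
    show "poly_fun (poly (monom 1 d * p))" "poly_fun (poly (reflect_poly q))"
      unfolding poly_fun_def by blast+
    fix e :: complex assume e: "norm e = 1"
    then have "e \<noteq> 0" by auto
    have "e * cnj e = 1" using complex_norm_square[of e] e by simp
    then have "inverse e = cnj e" by (rule inverse_unique)
    then have "poly q (inverse e) = cnj (Q e)" using q[of "cnj e"] by simp
    then show "poly (monom 1 d * p) e = poly (reflect_poly q) e"
      using assms(3)[OF e] \<open>e \<noteq> 0\<close> by (simp add: poly_monom p poly_reflect_poly_nz d_def)
  qed simp
  then have eq: "monom 1 d * p = reflect_poly q" using poly_eq_poly_eq_iff by blast
  have "degree p = 0"
  proof (cases "p = 0")
    case False
    then have "degree (monom 1 d * p) = d + degree p"
      by (subst degree_mult_eq) (auto simp: degree_monom_eq)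
    then show ?thesis using degree_reflect_poly_le[of q] eq by (simp add: d_def)
  qed simp
  then obtain c where "p = [:c:]" by (metis degree_eq_zeroE)
  then have c: "P t = c" for t by (simp add: p)
  have "cnj (Q (cnj t)) = c" for t
  proof (rule poly_fun_eqI_circle[of "\<lambda>t. cnj (Q (cnj t))" "\<lambda>_. c" 1])
    show "poly_fun (\<lambda>t. cnj (Q (cnj t)))" by (rule poly_fun_cnj[OF assms(2)])
  qed (use assms(3) c in \<open>auto simp flip: assms(3)\<close>)
  from this[of 0] show ?thesis using c by simp
qed

lemma sform_polarization:
  assumes "\<And>z. (\<Sum>l\<in>UNIV. complex_of_real (c $ l) * sform H z z $ l) = 0"
  shows "(\<Sum>l\<in>UNIV. complex_of_real (c $ l) * sform H x y $ l) = 0"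
proof -
  define s where "s = (\<lambda>x y. \<Sum>l\<in>UNIV. complex_of_real (c $ l) * sform H x y $ l)"
  have add: "s (x + x') (y + y') = s x y + s x y' + s x' y + s x' y'" for x x' y y'
    by (simp add: s_def sform_add_left sform_add_right algebra_simps sum.distrib)
  have sc: "s (a *s x) (b *s y) = a * cnj b * s x y" for a b x y
    by (simp add: s_def sform_smult_left sform_smult_right sum_distrib_left mult_ac)
  have z: "s z z = 0" for z using assms by (simp add: s_def)
  have "s x y + s y x = 0" using add[of x y x y] by (simp add: z)
  moreover have "- \<i> * s x y + \<i> * s y x = 0"
    using add[of x "\<i> *s y" x "\<i> *s y"] sc[of 1 x \<i> y] sc[of \<i> y 1 x] by (simp add: z)
  then have "\<i> * (s y x - s x y) = 0" by (simp add: algebra_simps)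
  then have "s y x = s x y" by simp
  ultimately show ?thesis by (simp add: s_def)
qed

text \<open>Linear independence of the matrices in geometric form: the vectors \<langle>z,
  z\<rangle> lie in no hyperplane of R^k.\<close>

lemma nondegenerate_hform_independent:
  assumes H: "H \<in> hermitian_tuples" "nondegenerate H"
    and c: "\<And>z. (\<Sum>l\<in>UNIV. c $ l * Re (hform H z $ l)) = 0"
  shows "c = 0"
proof -
  have "(\<Sum>l\<in>UNIV. complex_of_real (c $ l) * sform H z z $ l) = 0" for z
  proof -
    have "(\<Sum>l\<in>UNIV. complex_of_real (c $ l) * sform H z z $ l) =
        (\<Sum>l\<in>UNIV. complex_of_real (c $ l * Re (hform H z $ l)))"
      by (intro sum.cong refl) (simp add: hform_real[OF H(1)] flip: hform_eq_sform)
    also have "\<dots> = 0" using c[of z] by (simp only: of_real_sum[symmetric] of_real_0)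
    finally show ?thesis .
  qed
  note pol = sform_polarization[OF this]
  have "(\<Sum>l\<in>UNIV. c $ l *\<^sub>R H $ l) $ p $ q = 0" for p q
  proof -
    show ?thesis using pol[of "axis q 1" "axis p 1"]
      by (simp only: sform_axis sum_component vector_scaleR_component scaleR_conv_of_real[where 'a = complex])
  qed
  then have "(\<Sum>l\<in>UNIV. c $ l *\<^sub>R H $ l) = 0" by (simp add: vec_eq_iff)
  then show ?thesis using H(2) unfolding nondegenerate_def by blast
qed

lemma nondegenerate_sform_eq_0:
  assumes "nondegenerate H" "\<And>y. sform H x y = 0"
  shows "x = 0"
proof -
  have "H $ l *v x = 0" for l
    using assms(2) by (simp add: vec_eq_iff flip: sform_axis_right)
  then show ?thesis using assms(1) unfolding nondegenerate_def by blast
qed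

text \<open>As f has order at least two in z, tangency at (e z, u) equates a polynomial in e with
  the conjugate of another one on the circle, so both are constant. This first forces \<langle>f,
  z\<rangle> = 0 at real u and then f = 0; the remaining h depends on w alone and is invariant under
  translation by the values \<langle>z, z\<rangle>. Since these span R^k and h has positive weight,
  h = 0.\<close>

lemma tangent_field_eq_0:
  fixes X :: "(complex^'n) \<times> (complex^'k) \<Rightarrow> (complex^'n) \<times> (complex^'k)"
  assumes H: "H \<in> hermitian_tuples" "nondegenerate H"
    and X: "weighted_field j X" "quadric_tangent H X"
    and f0: "\<And>w. fst (X (0, w)) = 0"
    and f1: "\<And>p w i. ((\<lambda>t. fst (X (t *s p, w)) $ i) has_field_derivative 0) (at 0)"
  shows "X q = 0"
proof -
  have P: "poly_field X" using X(1) weighted_fieldD by blast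
  define re where "re = (\<lambda>u::complex^'k. \<forall>l. Im (u $ l) = 0)"
  have S: "snd (X (z, u)) $ l - 2 * \<i> * sform H (fst (X (z, u))) z $ l = snd (X (0, u)) $ l \<and>
      (\<forall>t. cnj (snd (X (0, u + (t * \<i>) *s hform H z)) $ l) = snd (X (0, u)) $ l)"
    if u: "re u" for z u l
  proof -
    have *: "snd (X (z, u)) $ l - 2 * \<i> * sform H (fst (X (z, u))) z $ l =
       cnj (snd (X (0, u + (2 * \<i>) *s hform H z)) $ l) \<and>
       snd (X (0, u)) $ l = cnj (snd (X (0, u + (2 * \<i>) *s hform H z)) $ l)" for z
    proof -
      define \<beta> where "\<beta> = u + (2 * \<i>) *s hform H z"
      have ph: "poly_fun (\<lambda>e. snd (X (e *s z, w)) $ l)" for w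
        by (rule poly_field_curve[OF P]) auto
      have "\<exists>h. poly_fun h \<and> (\<forall>e. sform H (fst (X (e *s z, w))) z $ l = e\<^sup>2 * h e)" for w
      proof (rule poly_fun_double_zero)
        have "((\<lambda>e. \<Sum>p\<in>UNIV. \<Sum>q\<in>UNIV. H $ l $ p $ q * fst (X (e *s z, w)) $ q * cnj (z $ p))
           has_field_derivative (\<Sum>p\<in>UNIV. \<Sum>q\<in>UNIV. H $ l $ p $ q * 0 * cnj (z $ p))) (at 0)"
          by (intro DERIV_sum DERIV_cmult_right DERIV_cmult f1)
        then show "((\<lambda>e. sform H (fst (X (e *s z, w))) z $ l) has_field_derivative 0) (at 0)"
          by (simp add: sform_def)
        show "poly_fun (\<lambda>e. sform H (fst (X (e *s z, w))) z $ l)"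
          by (rule poly_fun_sform_left, rule poly_field_curve[OF P]) auto
      qed (simp add: f0)
      note dz = this
      obtain \<phi> where \<phi>: "poly_fun \<phi>" "\<And>e. sform H (fst (X (e *s z, u))) z $ l = e\<^sup>2 * \<phi> e"
        using dz[of u] by blast
      obtain \<psi> where \<psi>: "poly_fun \<psi>" "\<And>e. sform H (fst (X (e *s z, \<beta>))) z $ l = e\<^sup>2 * \<psi> e"
        using dz[of \<beta>] by blast
      \<comment> \<open>The double zero of the form absorbs the factor \<open>cnj e\<close> of the
        tangency equation, since \<open>cnj e * e = 1\<close>, and leaves the polynomial
        \<open>e * \<phi> e\<close>.\<close>
      define A where "A = (\<lambda>e. snd (X (e *s z, u)) $ l - 2 * \<i> * (e * \<phi> e))"
      define B where "B = (\<lambda>e. snd (X (e *s z, \<beta>)) $ l - 2 * \<i> * (e * \<psi> e))"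
      have "A e = cnj (B e)" if e: "norm e = 1" for e
      proof -
        have ee: "cnj e * e = 1" using complex_norm_square[of e] e by (simp add: mult.commute)
        have "snd (X (e *s z, u)) $ l - cnj (snd (X (e *s z, \<beta>)) $ l) =
           2 * \<i> * (cnj e * (e\<^sup>2 * \<phi> e) + e * cnj (e\<^sup>2 * \<psi> e))"
          unfolding \<phi>(2)[symmetric] \<psi>(2)[symmetric] \<beta>_def
          by (rule tangent_complexified[OF H(1) P X(2) _ e]) (use u re_def in auto)
        also have "\<dots> = 2 * \<i> * ((cnj e * e) * (e * \<phi> e) + (cnj e * e) * cnj (e * \<psi> e))"
          by (simp add: power2_eq_square algebra_simps)
        finally show ?thesis unfolding ee by (simp add: A_def B_def algebra_simps)
      qed
      moreover have "poly_fun A" "poly_fun B"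
        unfolding A_def B_def by (intro poly_fun_diff poly_fun_mult ph \<phi>(1) \<psi>(1) poly_fun_const poly_fun_id)+
      ultimately have "A t = cnj (B 0)" for t
        using poly_fun_antiholomorphic_const[of A B t] by blast
      from this[of 1] this[of 0] show ?thesis
        using \<phi>(2)[of 1] by (simp add: A_def B_def \<beta>_def)
    qed
    \<comment> \<open>Scaling \<open>z\<close> by \<open>sqrt (s / 2)\<close> turns the factor 2
      \<i> into \<i> s. Continuation in \<open>s\<close> admits every complex multiple, in
      particular those that make the shift real.\<close>
    have "cnj (snd (X (0, u + cnj (- \<i> * s) *s hform H z)) $ l) = snd (X (0, u)) $ l" for s
    proof (rule poly_fun_eqI_real[where t = s])
      have "poly_fun (\<lambda>y. snd (X (0, u + (\<i> * y) *s hform H z)) $ l)"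
        by (rule poly_field_curve[OF P]) (auto intro!: poly_fun_add poly_fun_mult)
      from poly_fun_cnj[OF this]
      show "poly_fun (\<lambda>s. cnj (snd (X (0, u + cnj (- \<i> * s) *s hform H z)) $ l))"
        by simp
      fix s :: real assume "s > 0"
      then have "(complex_of_real (sqrt (s / 2)))\<^sup>2 = of_real (s / 2)"
        by (simp flip: of_real_power)
      then have "(2 * \<i>) *s hform H (complex_of_real (sqrt (s / 2)) *s z) = cnj (- \<i> * of_real s) *s hform H z"
        using \<open>s > 0\<close> by (simp add: hform_smult vec_eq_iff)
      then show "cnj (snd (X (0, u + cnj (- \<i> * of_real s) *s hform H z)) $ l) = snd (X (0, u)) $ l"
        using *[of "complex_of_real (sqrt (s / 2)) *s z"] by simp
    qed auto
    then have "cnj (snd (X (0, u + (t * \<i>) *s hform H z)) $ l) = snd (X (0, u)) $ l" for t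
      using *[of z] by (metis (no_types, lifting) complex_cnj_cnj complex_cnj_i complex_cnj_minus complex_cnj_mult mult.commute)
    then show ?thesis using *[of z] by simp
  qed
  have 1: "sform H (fst (X (z, u))) z $ l = 0 \<and> snd (X (z, u)) $ l = snd (X (0, u)) $ l" if u: "re u" for z u l
  proof -
    define y where "y = (1 / 2) *s z"
    have zy: "z = 2 *s y" by (simp add: y_def vec_eq_iff)
    \<comment> \<open>For real \<open>e\<close> the conjugation of \<open>e\<close> is invisible,
      and both sides continue to all \<open>e\<close>. Comparison with the original equation, which
      contains \<open>cnj e\<close>, kills the form at every nonreal \<open>e\<close>.\<close>
    have "snd (X (e *s y, u)) $ l - snd (X (0, u)) $ l = 2 * \<i> * (e * sform H (fst (X (e *s y, u))) y $ l)" for e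
    proof (rule poly_fun_eqI_real[where t = e])
      show "poly_fun (\<lambda>e. snd (X (e *s y, u)) $ l - snd (X (0, u)) $ l)"
        by (intro poly_fun_diff poly_field_curve[OF P]) auto
      show "poly_fun (\<lambda>e. 2 * \<i> * (e * sform H (fst (X (e *s y, u))) y $ l))"
        by (intro poly_fun_mult poly_fun_const poly_fun_id poly_fun_sform_left poly_field_curve[OF P]) auto
      fix e :: real
      show "snd (X (of_real e *s y, u)) $ l - snd (X (0, u)) $ l =
          2 * \<i> * (of_real e * sform H (fst (X (of_real e *s y, u))) y $ l)"
        using S[OF u, of "of_real e *s y" l] by (simp add: sform_smult_right algebra_simps)
    qed
    note A = this
    have B: "sform H (fst (X (e *s y, u))) y $ l = 0 \<and> snd (X (e *s y, u)) $ l = snd (X (0, u)) $ l"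
      if e: "e \<noteq> cnj e" for e
    proof -
      have "snd (X (e *s y, u)) $ l - snd (X (0, u)) $ l = 2 * \<i> * (cnj e * sform H (fst (X (e *s y, u))) y $ l)"
        using S[OF u, of "e *s y" l] by (simp add: sform_smult_right algebra_simps)
      then have "2 * \<i> * (e * sform H (fst (X (e *s y, u))) y $ l) =
          2 * \<i> * (cnj e * sform H (fst (X (e *s y, u))) y $ l)"
        by (simp only: A[of e])
      then have "sform H (fst (X (e *s y, u))) y $ l = 0" using e by auto
      with A[of e] show ?thesis by simp
    qed
    have inf: "infinite {e::complex. e \<noteq> cnj e}"
    proof -
      have "range (\<lambda>x. Complex x 1) \<subseteq> {e. e \<noteq> cnj e}" by (auto simp: complex_eq_iff)
      moreover have "infinite (range (\<lambda>x. Complex x 1))"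
        by (simp add: finite_image_iff inj_on_def infinite_UNIV_char_0)
      ultimately show ?thesis using finite_subset by blast
    qed
    have "sform H (fst (X (2 *s y, u))) y $ l = 0"
      by (rule poly_fun_eqI[OF _ poly_fun_const inf, where t = 2])
         (use B in \<open>auto intro!: poly_fun_sform_left poly_field_curve[OF P] poly_fun_mult\<close>)
    moreover have "snd (X (2 *s y, u)) $ l = snd (X (0, u)) $ l"
      by (rule poly_fun_eqI[OF _ poly_fun_const inf, where t = 2])
         (use B in \<open>auto intro!: poly_field_curve[OF P] poly_fun_mult\<close>)
    ultimately show ?thesis by (simp add: zy sform_smult_right)
  qed
  have f: "fst (X (z, u)) = 0" if u: "re u" for z u
  proof (rule nondegenerate_sform_eq_0[OF H(2)])
    fix p
    have "sform H (fst (X (z, u))) p $ l = 0" for l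
    proof -
      \<comment> \<open>The relation \<langle>f, z\<rangle> = 0 at \<open>z + t *s p\<close> with
        |t| = 1, multiplied by \<open>t\<close> to remove \<open>cnj t\<close>; the value at
        \<open>t = 0\<close> is the pairing with \<open>p\<close>.\<close>
      have "t * sform H (fst (X (z + t *s p, u))) z $ l + sform H (fst (X (z + t *s p, u))) p $ l = 0" for t
      proof (rule poly_fun_eqI_circle[where t = t and r = 1 and g = "\<lambda>_. 0"])
        have "poly_fun (\<lambda>t. fst (X (z + t *s p, u)) $ i)" for i
          by (rule poly_field_curve[OF P]) (auto intro!: poly_fun_add poly_fun_mult)
        then show "poly_fun (\<lambda>t. t * sform H (fst (X (z + t *s p, u))) z $ l + sform H (fst (X (z + t *s p, u))) p $ l)"
          by (intro poly_fun_add poly_fun_mult poly_fun_id poly_fun_sform_left)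
        fix t :: complex assume "norm t = 1"
        then have tt: "t * cnj t = 1" using complex_norm_square[of t] by simp
        have "sform H (fst (X (z + t *s p, u))) (z + t *s p) $ l = 0" using 1[OF u] by blast
        then have "sform H (fst (X (z + t *s p, u))) z $ l + cnj t * sform H (fst (X (z + t *s p, u))) p $ l = 0"
          by (simp add: sform_add_right sform_smult_right)
        then have "t * (sform H (fst (X (z + t *s p, u))) z $ l + cnj t * sform H (fst (X (z + t *s p, u))) p $ l) = 0"
          by simp
        then have "t * sform H (fst (X (z + t *s p, u))) z $ l + (t * cnj t) * sform H (fst (X (z + t *s p, u))) p $ l = 0"
          by (simp only: distrib_left mult.assoc)
        then show "t * sform H (fst (X (z + t *s p, u))) z $ l + sform H (fst (X (z + t *s p, u))) p $ l = 0"
          by (simp only: tt mult_1)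
      qed auto
      from this[of 0] show ?thesis by simp
    qed
    then show "sform H (fst (X (z, u))) p = 0" by (simp add: vec_eq_iff)
  qed
  define b where "b = (\<lambda>u. snd (X (0, u)))"
  define cv where "cv = (\<lambda>d::real^'k. (\<chi> l. complex_of_real (d $ l)) :: complex^'k)"
  have re_cv: "re (cv d)" for d by (simp add: re_def cv_def)
  have cv_add: "cv (x + y) = cv x + cv y" for x y by (simp add: cv_def vec_eq_iff)
  have cv_scale: "cv (r *\<^sub>R x) = of_real r *s cv x" for r x by (simp add: cv_def vec_eq_iff)
  define rv where "rv = (\<lambda>z. (\<chi> l. Re (hform H z $ l)) :: real^'k)"
  have cv_rv: "cv (rv z) = hform H z" for z
    by (simp add: cv_def rv_def vec_eq_iff hform_real[OF H(1)])
  \<comment> \<open>The periods of \<open>b\<close> on real points. They contain every real multiple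
    of every \<langle>z, z\<rangle> and form an additive group, hence are all of R^k.\<close>
  define T where "T = {d. \<forall>x. b (cv (x + d)) = b (cv x)}"
  have T: "r *\<^sub>R rv z \<in> T" for z r
  proof -
    have "b (cv (x + r *\<^sub>R rv z)) $ l = b (cv x) $ l" for x l
    proof -
      have "cv (x + r *\<^sub>R rv z) = cv x + (- \<i> * of_real r * \<i>) *s hform H z"
        by (simp add: cv_add cv_scale cv_rv vec_eq_iff complex_eq_iff)
      then have "cnj (b (cv (x + r *\<^sub>R rv z)) $ l) = b (cv x) $ l"
        using S[OF re_cv[of x], of z l] unfolding b_def by metis
      moreover have "cnj (b (cv x) $ l) = b (cv x) $ l"
        using S[OF re_cv[of x], of 0 l] by (simp add: b_def hform_eq_sform)
      ultimately show ?thesis by (metis complex_cnj_cnj)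
    qed
    then show ?thesis by (simp add: T_def vec_eq_iff)
  qed
  have subT: "d + d' \<in> T" if "d \<in> T" "d' \<in> T" for d d'
    using that unfolding T_def by (simp flip: add.assoc)
  have "0 \<in> T" by (simp add: T_def)
  have "span (range rv) \<subseteq> T"
  proof
    fix d assume "d \<in> span (range rv)"
    then show "d \<in> T"
      by (induction rule: span_induct_alt) (use T subT \<open>0 \<in> T\<close> in auto)
  qed
  moreover have "span (range rv) = UNIV"
  proof (rule ccontr)
    assume "span (range rv) \<noteq> UNIV"
    then obtain c where c: "c \<noteq> 0" "\<forall>x\<in>span (range rv). c \<bullet> x = 0"
      using span_not_UNIV_orthogonal by blast
    then have "c \<bullet> rv z = 0" for z by (simp add: span_base)
    then have "(\<Sum>l\<in>UNIV. c $ l * Re (hform H z $ l)) = 0" for z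
      by (simp add: inner_vec_def rv_def)
    with nondegenerate_hform_independent[OF H] c(1) show False by blast
  qed
  ultimately have T: "d \<in> T" for d by blast
  have "X (0, 0) = 0"
    using weighted_fieldD(2,3)[OF X(1), of 0 0 0] by (simp add: prod_eq_iff)
  then have "b (cv 0) = 0" by (simp add: b_def cv_def zero_vec_def)
  then have b0: "b (cv d) = 0" for d
    using T[of d] unfolding T_def mem_Collect_eq by (metis add_0)
  have cv_surj: "re u \<Longrightarrow> \<exists>d. u = cv d" for u
    by (rule exI[of _ "\<chi> l. Re (u $ l)"]) (simp add: cv_def re_def vec_eq_iff complex_eq_iff)
  have X0: "X (z, u) = 0" if "re u" for z u
  proof -
    have "snd (X (z, u)) = b u" using 1[OF that, of z] by (simp add: b_def vec_eq_iff)
    also have "b u = 0" using cv_surj[OF that] b0 by blast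
    finally show ?thesis using f[OF that] by (simp add: prod_eq_iff)
  qed
  obtain z w where q: "q = (z, w)" by (cases q)
  define u1 where "u1 = (\<chi> l. complex_of_real (Re (w $ l)))"
  define u2 where "u2 = (\<chi> l. complex_of_real (Im (w $ l)))"
  have w: "w = u1 + \<i> *s u2"
    by (simp add: u1_def u2_def vec_eq_iff complex_eq_iff)
  \<comment> \<open>The field vanishes at real second argument; continuation in \<open>t\<close>
    reaches the value \<i>, where the argument is \<open>w\<close>.\<close>
  have "fst (X (z, u1 + t *s u2)) $ i = 0" for t i
  proof (rule poly_fun_eqI_real[where t = t and g = "\<lambda>_. 0"])
    show "poly_fun (\<lambda>t. fst (X (z, u1 + t *s u2)) $ i)"
      by (rule poly_field_curve[OF P]) (auto intro!: poly_fun_add poly_fun_mult)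
  qed (auto simp: X0 re_def u1_def u2_def)
  moreover have "snd (X (z, u1 + t *s u2)) $ i = 0" for t i
  proof (rule poly_fun_eqI_real[where t = t and g = "\<lambda>_. 0"])
    show "poly_fun (\<lambda>t. snd (X (z, u1 + t *s u2)) $ i)"
      by (rule poly_field_curve[OF P]) (auto intro!: poly_fun_add poly_fun_mult)
  qed (auto simp: X0 re_def u1_def u2_def)
  ultimately show ?thesis by (simp add: q w prod_eq_iff vec_eq_iff)
qed

lemma exceptional_isotropic_map:
  fixes H :: "complex^'n^'n^'k"
  assumes "exceptional_tuple H"
  shows "\<exists>j X. weighted_field j X \<and> (\<forall>z. sform H z (fst (X (0, hform H z))) = 0) \<and> (\<exists>w. fst (X (0, w)) \<noteq> 0)"
proof -
  have H: "H \<in> hermitian_tuples" "nondegenerate H" using assms unfolding exceptional_tuple_def by auto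
  obtain j X where j: "j \<ge> 3" and X: "X \<in> aut_component H j" "\<not> (\<forall>\<^sub>F p in nhds 0. X p = 0)"
    using assms unfolding exceptional_tuple_def by blast
  \<comment> \<open>The weight that remains after one commutator; it is at least 2, as the isotropy
    lemma requires.\<close>
  define m where "m = nat j - 1"
  have m: "j = int (Suc m)" "m \<ge> 2" using j by (auto simp: m_def)
  obtain Y where Y: "weighted_field (Suc m) Y" "quadric_tangent H Y" and nz: "\<exists>p. Y p \<noteq> 0"
    using aut_component_poly[OF H(1) X(1)[unfolded m(1)] X(2)] by blast
  show ?thesis
  proof (cases "\<exists>w. fst (Y (0, w)) \<noteq> 0")
    case True
    then show ?thesis
      using tangent_weighted_field_isotropic[OF H(1) Y] m(2) Y(1) by (metis le_SucI)
  next
    case False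
    have "\<exists>p w i. \<not> ((\<lambda>t. fst (Y (t *s p, w)) $ i) has_field_derivative 0) (at 0)"
      using tangent_field_eq_0[OF H Y] False nz by blast
    then obtain p w i where *: "\<not> ((\<lambda>t. fst (Y (t *s p, w)) $ i) has_field_derivative 0) (at 0)" by blast
    obtain Z where Z: "weighted_field m Z" "quadric_tangent H Z"
      and D: "\<forall>w i. ((\<lambda>t. fst (Y (t *s p, w)) $ i) has_field_derivative fst (Z (0, w)) $ i) (at 0)"
      using tangent_field_commutator[OF H(1) Y, of p] by blast
    have "fst (Z (0, w)) $ i \<noteq> 0" using D[rule_format, of w i] * by auto
    then have "fst (Z (0, w)) \<noteq> 0" by (metis zero_index)
    then show ?thesis using tangent_weighted_field_isotropic[OF H(1) Z m(2)] Z(1) by blast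
  qed
qed

subsection \<open>Isotropic maps\<close>

lemma complex_linear_Re_eq_0:
  assumes "\<And>x. Re (f x) = 0" "\<And>x. f (\<i> *s x) = \<i> * f x"
  shows "f (x :: complex^'n) = 0"
  using assms(1)[of x] assms(1)[of "\<i> *s x"] by (simp add: assms(2) complex_eq_iff)

lemma hform_line:
  "hform H (x + (complex_of_real t) *s d) =
     hform H x + (of_real t *s (sform H x d + sform H d x) + (of_real t)\<^sup>2 *s hform H d)"
  by (simp add: hform_eq_sform sform_add_left sform_add_right sform_smult_left sform_smult_right
      vec_eq_iff power2_eq_square algebra_simps)

text \<open>Functions such as \<langle>z, z\<rangle> are not holomorphic in z, but on a real line
  they are polynomials in the real parameter. This suffices for choosing generic points: two such
  functions, each nonzero somewhere, have a common nonzero on the line joining the two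
  points.\<close>

definition poly_on_lines :: "(complex^'n \<Rightarrow> complex) \<Rightarrow> bool" where
  "poly_on_lines g \<longleftrightarrow> (\<forall>x d. \<exists>p. poly_fun p \<and> (\<forall>t::real. g (x + of_real t *s d) = p (of_real t)))"

lemma poly_on_lines_mult:
  assumes "poly_on_lines g" "poly_on_lines h" shows "poly_on_lines (\<lambda>x. g x * h x)"
  unfolding poly_on_lines_def
proof (intro allI)
  fix x d
  obtain p where "poly_fun p" "\<forall>t::real. g (x + of_real t *s d) = p (of_real t)"
    using assms(1)[unfolded poly_on_lines_def, rule_format, of x d] by blast
  moreover obtain q where "poly_fun q" "\<forall>t::real. h (x + of_real t *s d) = q (of_real t)"
    using assms(2)[unfolded poly_on_lines_def, rule_format, of x d] by blast
  ultimately show "\<exists>p. poly_fun p \<and> (\<forall>t::real. g (x + of_real t *s d) * h (x + of_real t *s d) = p (of_real t))"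
    by (intro exI[of _ "\<lambda>t. p t * q t"]) auto
qed

lemma poly_on_lines_common_nonzero:
  assumes "poly_on_lines g" "poly_on_lines h" "g x \<noteq> 0" "h y \<noteq> 0"
  shows "\<exists>z. g z \<noteq> 0 \<and> h z \<noteq> 0"
proof -
  obtain p q where p: "poly_fun p" "\<And>t::real. g (x + of_real t *s (y - x)) = p (of_real t)"
      and q: "poly_fun q" "\<And>t::real. h (x + of_real t *s (y - x)) = q (of_real t)"
    using assms(1,2) unfolding poly_on_lines_def by meson
  have "p 0 \<noteq> 0" using p(2)[of 0] assms(3) by simp
  moreover have "q 1 \<noteq> 0" using q(2)[of 1] assms(4) by simp
  ultimately have "finite ({t. p t = 0} \<union> {t. q t = 0})"
    using poly_fun_finite_zeros[OF p(1)] poly_fun_finite_zeros[OF q(1)] by blast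
  moreover have "infinite (range complex_of_real)"
    by (simp add: finite_image_iff inj_on_def infinite_UNIV_char_0)
  ultimately obtain t where "complex_of_real t \<notin> {t. p t = 0} \<union> {t. q t = 0}"
    by (metis UNIV_I finite_subset image_subsetI)
  then have "p (of_real t) \<noteq> 0 \<and> q (of_real t) \<noteq> 0" by simp
  then show ?thesis unfolding p(2)[symmetric] q(2)[symmetric] by blast
qed

lemma poly_on_lines_sform: "poly_on_lines (\<lambda>z. sform H z y $ l)"
  unfolding poly_on_lines_def
  by (intro allI, rule_tac x = "\<lambda>t. sform H x y $ l + t * sform H d y $ l" in exI)
     (auto simp: sform_add_left sform_smult_left intro!: poly_fun_add poly_fun_mult)

lemma poly_on_lines_hform: "poly_on_lines (\<lambda>z. \<Sum>l\<in>UNIV. c l * hform H z $ l)"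
  unfolding poly_on_lines_def
proof (intro allI)
  fix x d
  show "\<exists>p. poly_fun p \<and> (\<forall>t::real. (\<Sum>l\<in>UNIV. c l * hform H (x + of_real t *s d) $ l) = p (of_real t))"
    by (rule exI[of _ "\<lambda>t. \<Sum>l\<in>UNIV. c l * (hform H x $ l + (t * (sform H x d + sform H d x) $ l + t\<^sup>2 * hform H d $ l))"])
       (auto simp: hform_line distrib_left intro!: poly_fun_sum poly_fun_mult poly_fun_add poly_fun_power)
qed

lemma Re_sform_inner:
  assumes "H \<in> hermitian_tuples"
  shows "Re (c * sform H \<delta> y $ l) = \<delta> \<bullet> (cnj c *s (H $ l *v y))"
proof -
  have "sform H \<delta> y $ l = (\<Sum>p\<in>UNIV. cnj ((H $ l *v y) $ p) * \<delta> $ p)"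
    by (subst sform_cnj[OF assms, symmetric]) (simp add: sform_nth)
  then have "c * sform H \<delta> y $ l = (\<Sum>p\<in>UNIV. cnj ((cnj c *s (H $ l *v y)) $ p) * \<delta> $ p)"
    by (simp add: sum_distrib_left mult_ac)
  then show ?thesis by (simp add: inner_vec_def inner_complex_def algebra_simps)
qed

text \<open>A real functional vanishing on the common kernel of finitely many others lies in their
  span. The functionals are represented by the vectors \<open>H $ l *v z\<close> for the real inner
  product, where the part orthogonal to their span has to be zero.\<close>

lemma Re_sform_combination:
  assumes H: "H \<in> hermitian_tuples"
    and K: "\<And>\<delta>. (\<And>l. Re (sform H \<delta> z $ l) = 0) \<Longrightarrow> Re (c * sform H \<delta> y $ m) = 0"
  shows "\<exists>s::real^'k. \<forall>\<delta>. Re (c * sform (H :: complex^'n^'n^'k) \<delta> y $ m) = (\<Sum>l\<in>UNIV. s $ l * Re (sform H \<delta> z $ l))"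
proof -
  define \<alpha> where "\<alpha> = cnj c *s (H $ m *v y)"
  define T where "T = range (\<lambda>l. H $ l *v z)"
  obtain x b where xb: "x \<in> span T" "\<And>w. w \<in> span T \<Longrightarrow> orthogonal b w" "\<alpha> = x + b"
    using orthogonal_subspace_decomp_exists[of T \<alpha>] by metis
  have "Re (sform H b z $ l) = 0" for l
    using Re_sform_inner[OF H, of 1 b z l] xb(2)[of "H $ l *v z"]
    by (simp add: T_def span_base orthogonal_def)
  then have "b \<bullet> \<alpha> = 0" using K[of b] Re_sform_inner[OF H, of c b y m] by (simp add: \<alpha>_def)
  moreover have "b \<bullet> x = 0" using xb(1,2) by (auto simp: orthogonal_def)
  ultimately have "b = 0" by (simp add: xb(3) inner_add_right)
  with xb have "\<alpha> \<in> span T" by simp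
  have "\<exists>s'. \<alpha> = (\<Sum>l\<in>UNIV. s' l *\<^sub>R (H $ l *v z))"
  proof -
    have "\<alpha> \<in> span ((\<lambda>l. H $ l *v z) ` UNIV)" using \<open>\<alpha> \<in> span T\<close> by (simp add: T_def)
    then show ?thesis
    proof (induction rule: span_induct_alt)
      case base
      show ?case by (rule exI[of _ "\<lambda>_. 0"]) simp
    next
      case (step r x y)
      then obtain l s' where "x = H $ l *v z" "y = (\<Sum>l\<in>UNIV. s' l *\<^sub>R (H $ l *v z))" by auto
      then have "r *\<^sub>R x + y = (\<Sum>k\<in>UNIV. ((if k = l then r else 0) + s' k) *\<^sub>R (H $ k *v z))"
        by (simp add: scaleR_left_distrib sum.distrib if_distrib[of "\<lambda>r. r *\<^sub>R _"] cong: if_cong)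
      then show ?case by (intro exI[of _ "\<lambda>k. (if k = l then r else 0) + s' k"])
    qed
  qed
  then obtain s' where s': "\<alpha> = (\<Sum>l\<in>UNIV. s' l *\<^sub>R (H $ l *v z))" by blast
  show ?thesis
  proof (intro exI[of _ "\<chi> l. s' l"] allI)
    fix \<delta>
    have "Re (c * sform H \<delta> y $ m) = \<delta> \<bullet> \<alpha>" unfolding \<alpha>_def by (rule Re_sform_inner[OF H])
    also have "\<dots> = (\<Sum>l\<in>UNIV. s' l * (\<delta> \<bullet> (H $ l *v z)))" by (simp add: s' inner_sum_right)
    also have "\<dots> = (\<Sum>l\<in>UNIV. (\<chi> l. s' l) $ l * Re (sform H \<delta> z $ l))"
      using Re_sform_inner[OF H, of 1 \<delta> z] by simp
    finally show "Re (c * sform H \<delta> y $ m) = (\<Sum>l\<in>UNIV. (\<chi> l. s' l) $ l * Re (sform H \<delta> z $ l))" .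
  qed
qed

text \<open>What is retained of an exceptional field. The law \<open>a_scale\<close> is the weighted
  dilation at z = 0; as \<open>t\<close> is complex, it covers every factor, including the negative
  real ones that occur in \<open>in_orbit_H_tilde\<close>.\<close>

locale isotropic_map =
  fixes H :: "complex^4^4^4" and a :: "complex^4 \<Rightarrow> complex^4" and m :: nat and z0 :: "complex^4"
  assumes herm: "H \<in> hermitian_tuples" and nondeg: "nondegenerate H" and det4: "det (H $ 4) \<noteq> 0"
    and a_poly: "\<And>\<gamma> i. (\<And>l. poly_fun (\<lambda>t. \<gamma> t $ l)) \<Longrightarrow> poly_fun (\<lambda>t. a (\<gamma> t) $ i)"
    and a_scale: "\<And>t w. a (t\<^sup>2 *s w) = t ^ m *s a w" and m_pos: "m > 0"
    and iso: "\<And>z. sform H z (a (hform H z)) = 0"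
    and z0: "a (hform H z0) \<noteq> 0"
begin

abbreviation y where "y z \<equiv> a (hform H z)"

section \<open>Values of the isotropic map as common eigenvectors\<close>

lemma a_0: "a 0 = 0"
proof -
  have "a 0 = a (0\<^sup>2 *s 0)" by simp
  also have "\<dots> = 0" unfolding a_scale using m_pos by (simp add: zero_power)
  finally show ?thesis .
qed

lemma sform_4_eq_0:
  assumes "\<And>\<delta>. sform H \<delta> x $ 4 = 0" shows "x = 0"
proof -
  have "H $ 4 *v x = 0" using assms matrix_mult_eq_0_iff_sform[OF herm] by blast
  moreover have "invertible (H $ 4)" using det4 by (simp add: invertible_det_nz)
  ultimately show ?thesis
    by (metis invertible_def matrix_vector_mul_assoc matrix_vector_mul_lid matrix_vector_mult_0_right)
qed

lemma a_line: "poly_fun (\<lambda>t. sform H \<delta> (a (v0 + (cnj t *s v1 + (cnj t)\<^sup>2 *s v2))) $ l)"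
proof (rule poly_fun_sform_right)
  show "poly_fun (\<lambda>t. a (v0 + (t *s v1 + t\<^sup>2 *s v2)) $ i)" for i
    by (rule a_poly) (auto intro!: poly_fun_add poly_fun_mult poly_fun_power)
qed

text \<open>For such \<delta> the value \<langle>z + t \<delta>, z + t \<delta>\<rangle> is even in
  t, so a has the same value at the parameters t and -t. Subtracting the two isotropy relations and
  dividing by 2 t gives orthogonality to \<delta>, which continues to t = 0.\<close>

lemma sform_y_eq_0:
  assumes "\<And>l. Re (sform H \<delta> z $ l) = 0"
  shows "sform H \<delta> (y z) = 0"
proof -
  have sym: "sform H z \<delta> + sform H \<delta> z = 0"
    using assms sform_cnj[OF herm, of \<delta> z] by (simp add: vec_eq_iff complex_eq_iff)
      (metis cnj.sel(1) cnj.sel(2) assms add.left_inverse add_0 )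
  have hf: "hform H (z + of_real t *s \<delta>) = hform H z + (of_real t)\<^sup>2 *s hform H \<delta>" for t :: real
    by (simp add: hform_line sym)
  have "sform H \<delta> (a (hform H z + (cnj t *s 0 + (cnj t)\<^sup>2 *s hform H \<delta>))) $ l = 0" for l t
  proof (rule poly_fun_eqI_real[where t = t and g = "\<lambda>_. 0"])
    show "poly_fun (\<lambda>t. sform H \<delta> (a (hform H z + (cnj t *s 0 + (cnj t)\<^sup>2 *s hform H \<delta>))) $ l)"
      by (rule a_line)
    fix t :: real assume t: "t > 0"
    define b where "b = a (hform H z + (of_real t)\<^sup>2 *s hform H \<delta>)"
    have "sform H (z + of_real t *s \<delta>) b = 0" "sform H (z + of_real (- t) *s \<delta>) b = 0"
      using iso[of "z + of_real t *s \<delta>"] iso[of "z + of_real (- t) *s \<delta>"] unfolding hf b_def by simp_all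
    then have "sform H (z + of_real t *s \<delta>) b $ l - sform H (z + of_real (- t) *s \<delta>) b $ l = 0" by simp
    then have "2 * of_real t * sform H \<delta> b $ l = 0"
      by (simp add: sform_add_left sform_diff_left sform_smult_left del: mult_eq_0_iff)
    then show "sform H \<delta> (a (hform H z + (cnj (of_real t) *s 0 + (cnj (of_real t))\<^sup>2 *s hform H \<delta>))) $ l = 0"
      using t by (simp add: b_def)
  qed auto
  from this[of 0] show ?thesis by (simp add: vec_eq_iff)
qed

text \<open>The real and imaginary parts of \<open>\<langle>\<delta>, y z\<rangle>\<^sub>l\<close> and \<open>\<langle>\<delta>, y z\<rangle>\<^sub>4\<close> are combinations of the four
  functionals \<open>Re \<langle>\<delta>, z\<rangle>\<^sub>i\<close>. If they were independent, they would span these, and since they vanish at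
  \<open>\<delta> = z\<close>, so would \<open>\<langle>z, z\<rangle>\<close>.\<close>

lemma y_pencil_eigenvector: "\<exists>\<nu>. \<forall>\<delta>. sform H \<delta> (y z) $ l = \<nu> * sform H \<delta> (y z) $ 4"
proof (cases "y z = 0")
  case False
  \<comment> \<open>Four pairs of a coefficient and a component, listing the real functionals Re and
    Re after multiplication by \<i>, for component \<open>l\<close> and for component 4.\<close>
  define f where "f = (\<lambda>i::4. if i = 1 then (1, l) else if i = 2 then (\<i>, l) else if i = 3 then (1, 4) else (\<i>, 4::4))"
  have "\<exists>s::real^4. \<forall>\<delta>. Re (fst (f i) * sform H \<delta> (y z) $ snd (f i)) = (\<Sum>l\<in>UNIV. s $ l * Re (sform H \<delta> z $ l))" for i
  proof (rule Re_sform_combination[OF herm])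
    fix \<delta> assume "\<And>l. Re (sform H \<delta> z $ l) = 0"
    then have "sform H \<delta> (y z) = 0" by (rule sform_y_eq_0)
    then show "Re (fst (f i) * sform H \<delta> (y z) $ snd (f i)) = 0" by simp
  qed
  note ex = this
  define s where "s = (\<lambda>i. SOME s::real^4. \<forall>\<delta>. Re (fst (f i) * sform H \<delta> (y z) $ snd (f i)) =
      (\<Sum>l\<in>UNIV. s $ l * Re (sform H \<delta> z $ l)))"
  have s: "Re (fst (f i) * sform H \<delta> (y z) $ snd (f i)) = (\<Sum>l\<in>UNIV. s i $ l * Re (sform H \<delta> z $ l))" for i \<delta>
    using someI_ex[OF ex[of i]] unfolding s_def by blast
  define A :: "real^4^4" where "A = (\<chi> i. s i)"
  define v :: "real^4" where "v = (\<chi> l. Re (hform H z $ l))"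
  have "A *v v = 0"
    using s[of _ z] iso[of z] by (simp add: A_def v_def vec_eq_iff matrix_vector_mult_def hform_eq_sform)
  moreover have "v \<noteq> 0"
  proof
    assume "v = 0"
    then have "Re (hform H z $ l) = 0" for l by (simp add: v_def vec_eq_iff)
    then have "hform H z = 0" using hform_Im[OF herm, of z] by (simp add: vec_eq_iff complex_eq_iff)
    with False a_0 show False by simp
  qed
  ultimately have "\<not> invertible A" by (metis invertible_def matrix_vector_mul_assoc matrix_vector_mul_lid matrix_vector_mult_0_right)
  then have "\<not> invertible (transpose A)" by (simp add: invertible_det_nz det_transpose)
  then obtain c where c: "c \<noteq> 0" "transpose A *v c = 0"
    by (metis invertible_left_inverse matrix_left_invertible_ker)
  have "(\<Sum>i\<in>UNIV. c $ i * s i $ l) = 0" for l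
    using c(2) by (simp add: vec_eq_iff matrix_vector_mult_def A_def transpose_def mult.commute)
  then have "(\<Sum>l\<in>UNIV. (\<Sum>i\<in>UNIV. c $ i * s i $ l) * Re (sform H \<delta> z $ l)) = 0" for \<delta> by simp
  also have "(\<Sum>l\<in>UNIV. (\<Sum>i\<in>UNIV. c $ i * s i $ l) * Re (sform H \<delta> z $ l)) =
      (\<Sum>i\<in>UNIV. c $ i * (\<Sum>l\<in>UNIV. s i $ l * Re (sform H \<delta> z $ l)))" for \<delta>
    by (simp add: sum_distrib_left sum_distrib_right mult_ac) (rule sum.swap)
  finally have 0: "(\<Sum>i\<in>UNIV. c $ i * Re (fst (f i) * sform H \<delta> (y z) $ snd (f i))) = 0" for \<delta>
    by (simp only: s)
  \<comment> \<open>The real relation among the four functionals is the real part of a complex one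
    with these coefficients.\<close>
  define p q where "p = Complex (c $ 1) (c $ 2)" and "q = Complex (c $ 3) (c $ 4)"
  have "Re (p * sform H \<delta> (y z) $ l + q * sform H \<delta> (y z) $ 4) = 0" for \<delta>
    using 0[of \<delta>] by (simp add: sum_4 f_def p_def q_def)
  then have pq: "p * sform H \<delta> (y z) $ l + q * sform H \<delta> (y z) $ 4 = 0" for \<delta>
    by (rule complex_linear_Re_eq_0) (simp add: sform_smult_left algebra_simps)
  have "p \<noteq> 0"
  proof
    assume p: "p = 0"
    with pq have "q * sform H \<delta> (y z) $ 4 = 0" for \<delta> by simp
    moreover have "q \<noteq> 0" using p c(1) by (auto simp: p_def q_def complex_eq_iff vec_eq_iff forall_4)
    ultimately show False using sform_4_eq_0[of "y z"] False by simp
  qed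
  then have "sform H \<delta> (y z) $ l = - (q / p) * sform H \<delta> (y z) $ 4" for \<delta>
    using pq[of \<delta>] by (simp add: field_simps add_eq_0_iff)
  then show ?thesis by blast
qed simp

text \<open>The parameter \<open>t\<close> is the inverse of the conjugated eigenvalue: at
  \<open>t = 0\<close> the determinant is that of \<open>- H $ 4\<close>, so the polynomial is
  visibly nonzero. The eigenvalue 0 is added by hand, and the conjugation comes from the second
  slot.\<close>

lemma finite_pencil_spectrum:
  "finite {\<nu>. \<exists>x. x \<noteq> 0 \<and> (\<forall>\<delta>. sform H \<delta> x $ l = \<nu> * sform H \<delta> x $ 4)}"
proof -
  define M where "M = (\<lambda>t::complex. (\<chi> i j. t * H $ l $ i $ j - H $ 4 $ i $ j) :: complex^4^4)"
  define r where "r = (\<lambda>t. det (M t))"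
  have Mv: "M t *v x = t *s (H $ l *v x) - H $ 4 *v x" for t x
    by (simp add: M_def vec_eq_iff matrix_vector_mult_def sum_distrib_left sum_subtractf algebra_simps)
  have "poly_fun r"
    unfolding r_def det_def M_def
    by (auto intro!: poly_fun_sum poly_fun_mult poly_fun_prod poly_fun_diff)
  moreover have "r 0 \<noteq> 0"
  proof
    assume "r 0 = 0"
    then have "\<not> invertible (M 0)" by (simp add: r_def invertible_det_nz)
    then obtain x where "x \<noteq> 0" "M 0 *v x = 0"
      by (metis invertible_left_inverse matrix_left_invertible_ker)
    then show False using sform_4_eq_0[of x] matrix_mult_eq_0_iff_sform[OF herm] by (simp add: Mv)
  qed
  ultimately have "finite {t. r t = 0}" by (rule poly_fun_finite_zeros)
  moreover have "{\<nu>. \<exists>x. x \<noteq> 0 \<and> (\<forall>\<delta>. sform H \<delta> x $ l = \<nu> * sform H \<delta> x $ 4)} \<subseteq>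
      insert 0 ((\<lambda>t. cnj (1 / t)) ` {t. r t = 0})"
  proof
    fix \<nu> assume "\<nu> \<in> {\<nu>. \<exists>x. x \<noteq> 0 \<and> (\<forall>\<delta>. sform H \<delta> x $ l = \<nu> * sform H \<delta> x $ 4)}"
    then obtain x where x: "x \<noteq> 0" "\<And>\<delta>. sform H \<delta> x $ l = \<nu> * sform H \<delta> x $ 4" by blast
    have "(H $ l *v x) $ p = cnj \<nu> * (H $ 4 *v x) $ p" for p
    proof -
      have "cnj (sform H (axis p 1) x $ l) = cnj (\<nu> * sform H (axis p 1) x $ 4)" using x(2) by simp
      then show ?thesis by (simp add: sform_cnj[OF herm] sform_axis_right)
    qed
    then have Hx: "H $ l *v x = cnj \<nu> *s (H $ 4 *v x)" by (simp add: vec_eq_iff)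
    show "\<nu> \<in> insert 0 ((\<lambda>t. cnj (1 / t)) ` {t. r t = 0})"
    proof (cases "\<nu> = 0")
      case False
      then have "M (1 / cnj \<nu>) *v x = 0" by (simp add: Mv Hx vector_smult_assoc)
      with x(1) have "\<not> invertible (M (1 / cnj \<nu>))"
        by (metis invertible_left_inverse matrix_left_invertible_ker)
      then have "r (1 / cnj \<nu>) = 0" by (simp add: r_def invertible_det_nz)
      moreover have "\<nu> = cnj (1 / (1 / cnj \<nu>))" by simp
      ultimately show ?thesis by blast
    qed simp
  qed
  ultimately show ?thesis using finite_subset by blast
qed

text \<open>On a real line through \<open>z0\<close> some eigenvalue is attained infinitely often, because the pencil
  has finitely many of them; being a polynomial identity it then holds on the whole line, in
  particular at \<open>z0\<close>.\<close>

lemma pencil_eigenvalues: "\<exists>\<nu>. \<forall>l z \<delta>. sform H \<delta> (y z) $ l = \<nu> l * sform H \<delta> (y z) $ 4"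
proof -
  obtain \<nu> where \<nu>: "\<And>l \<delta>. sform H \<delta> (y z0) $ l = \<nu> l * sform H \<delta> (y z0) $ 4"
    using y_pencil_eigenvector by metis
  have "sform H \<delta> (y z) $ l = \<nu> l * sform H \<delta> (y z) $ 4" for l z \<delta>
  proof -
    define d where "d = z - z0"
    define N where "N = {\<nu>. \<exists>x. x \<noteq> 0 \<and> (\<forall>\<delta>. sform H \<delta> x $ l = \<nu> * sform H \<delta> x $ 4)}"
    have "\<exists>\<kappa>\<in>N. \<forall>\<delta>. sform H \<delta> (y (z0 + of_real t *s d)) $ l = \<kappa> * sform H \<delta> (y (z0 + of_real t *s d)) $ 4" for t :: real
    proof (cases "y (z0 + of_real t *s d) = 0")
      case True
      \<comment> \<open>Where the eigenvector vanishes any number would do; the eigenvalue at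
        \<open>z0\<close> is taken so that the choice stays in the finite set
        \<open>N\<close>.\<close>
      then show ?thesis using z0 \<nu> by (intro bexI[of _ "\<nu> l"]) (auto simp: N_def)
    next
      case False
      then show ?thesis using y_pencil_eigenvector[of "z0 + of_real t *s d" l] by (auto simp: N_def)
    qed
    then obtain \<kappa> where \<kappa>: "\<And>t::real. \<kappa> t \<in> N"
      "\<And>t \<delta>. sform H \<delta> (y (z0 + of_real t *s d)) $ l = \<kappa> t * sform H \<delta> (y (z0 + of_real t *s d)) $ 4"
      by metis
    have "finite (range \<kappa>)"
      using finite_pencil_spectrum[of l] \<kappa>(1) unfolding N_def[symmetric] by (meson finite_subset image_subsetI)
    then obtain t0 where inf: "infinite {t. \<kappa> t = \<kappa> t0}"
      using pigeonhole_infinite[of UNIV \<kappa>] infinite_UNIV_char_0 by auto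
    define c1 where "c1 = sform H z0 d + sform H d z0"
    define Q where "Q = (\<lambda>t \<delta> l. sform H \<delta> (a (hform H z0 + (cnj t *s c1 + (cnj t)\<^sup>2 *s hform H d))) $ l)"
    have Qr: "Q (of_real t) \<delta> l = sform H \<delta> (y (z0 + of_real t *s d)) $ l" for t :: real and \<delta> l
      by (simp add: Q_def hform_line c1_def)
    have all: "Q t \<delta> l = \<kappa> t0 * Q t \<delta> 4" for t \<delta>
    proof (rule poly_fun_eqI[where f = "\<lambda>t. Q t \<delta> l" and g = "\<lambda>t. \<kappa> t0 * Q t \<delta> 4" and t = t
          and S = "of_real ` {t. \<kappa> t = \<kappa> t0}"])
      show "poly_fun (\<lambda>t. Q t \<delta> l)" "poly_fun (\<lambda>t. \<kappa> t0 * Q t \<delta> 4)"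
        unfolding Q_def by (intro poly_fun_mult poly_fun_const a_line)+
      show "infinite (complex_of_real ` {t. \<kappa> t = \<kappa> t0})"
        using inf by (simp add: finite_image_iff inj_on_def)
    qed (use \<kappa>(2) Qr in auto)
    have "\<kappa> t0 = \<nu> l"
    proof (rule ccontr)
      assume ne: "\<kappa> t0 \<noteq> \<nu> l"
      have "sform H \<delta> (y z0) $ 4 = 0" for \<delta>
        using all[of 0 \<delta>] \<nu>[of \<delta> l] ne Qr[of 0 \<delta>] by simp
      with sform_4_eq_0 z0 show False by blast
    qed
    then show ?thesis using all[of 1 \<delta>] Qr[of 1 \<delta>] by (simp add: d_def)
  qed
  then show ?thesis by blast
qed

text \<open>If all values were multiples of \<open>y z0\<close>, then moving z0 along a direction d
  not orthogonal to \<open>y z0\<close> would, by isotropy, force the multiplier to be 0 for t > 0.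
  By continuation to t = 0 the value at \<open>z0\<close> itself would be 0.\<close>

lemma y_not_parallel: "\<exists>z1. \<forall>c. y z1 \<noteq> c *s y z0"
proof (rule ccontr)
  assume "\<not> ?thesis"
  then have par: "\<exists>c. y z = c *s y z0" for z by blast
  have "sform H d (y z0) $ 4 = 0" for d
  proof (rule ccontr)
    assume ne: "sform H d (y z0) $ 4 \<noteq> 0"
    define c1 where "c1 = sform H z0 d + sform H d z0"
    have "sform H \<delta> (a (hform H z0 + (cnj t *s c1 + (cnj t)\<^sup>2 *s hform H d))) $ 4 = 0" for t \<delta>
    proof (rule poly_fun_eqI_real[where t = t and g = "\<lambda>_. 0"])
      show "poly_fun (\<lambda>t. sform H \<delta> (a (hform H z0 + (cnj t *s c1 + (cnj t)\<^sup>2 *s hform H d))) $ 4)"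
        by (rule a_line)
      fix t :: real assume t: "t > 0"
      obtain c where c: "y (z0 + of_real t *s d) = c *s y z0" using par by blast
      have "sform H (z0 + of_real t *s d) (c *s y z0) $ 4 = 0"
        using iso[of "z0 + of_real t *s d"] c by simp
      then have "c = 0" using ne t iso[of z0] by (simp add: sform_add_left sform_smult_left sform_smult_right)
      with c show "sform H \<delta> (a (hform H z0 + (cnj (of_real t) *s c1 + (cnj (of_real t))\<^sup>2 *s hform H d))) $ 4 = 0"
        by (simp add: hform_line c1_def)
    qed auto
    from this[of _ 0] have "sform H \<delta> (y z0) $ 4 = 0" for \<delta> by simp
    then show False using sform_4_eq_0 z0 by blast
  qed
  then show False using sform_4_eq_0 z0 by blast
qed

lemma poly_on_lines_y: "poly_on_lines (\<lambda>z. sform H \<delta> (y z) $ l)"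
  unfolding poly_on_lines_def
proof (intro allI)
  fix x d
  show "\<exists>p. poly_fun p \<and> (\<forall>t::real. sform H \<delta> (y (x + of_real t *s d)) $ l = p (of_real t))"
    by (intro exI[of _ "\<lambda>t. sform H \<delta> (a (hform H x + (cnj t *s (sform H x d + sform H d x) + (cnj t)\<^sup>2 *s hform H d))) $ l"] conjI a_line)
       (simp add: hform_line)
qed

context
  fixes \<nu> :: "4 \<Rightarrow> complex"
  assumes \<nu>: "\<And>l z \<delta>. sform H \<delta> (y z) $ l = \<nu> l * sform H \<delta> (y z) $ 4"
begin

section \<open>Isotropy of the values and reality of the eigenvalues\<close>

lemma sform_y_left: "sform H (y z) \<delta> $ l = cnj (\<nu> l) * sform H (y z) \<delta> $ 4"
  using arg_cong[OF \<nu>[of \<delta> z l], of cnj] by (simp add: sform_cnj[OF herm])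

lemma \<nu>_4: "\<nu> 4 = 1"
proof (rule ccontr)
  assume "\<nu> 4 \<noteq> 1"
  then have "sform H \<delta> (y z0) $ 4 = 0" for \<delta> using \<nu>[of \<delta> z0 4] by simp
  then show False using sform_4_eq_0 z0 by blast
qed

text \<open>If all eigenvalues are real, a suitable phase c makes all Re \<langle>c y z', z\<rangle>
  zero, so c y z' is orthogonal to y z by \<open>sform_y_eq_0\<close>. If some
  \<open>\<nu> l\<close> is not real, then \<langle>x, x\<rangle> has real components
  \<open>l\<close> and 4 with nonreal ratio for every combination x of y z and y z', so they vanish,
  and polarization finishes.\<close>

lemma y_isotropic: "sform H (y z') (y z) $ 4 = 0"
proof (cases "\<forall>l. Im (\<nu> l) = 0")
  case True
  define \<xi> where "\<xi> = sform H (y z') z $ 4"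
  define c where "c = (if \<xi> = 0 then 1 else \<i> * cnj \<xi>)"
  have "c \<noteq> 0" by (simp add: c_def)
  have "Re (c * \<xi>) = 0" by (auto simp: c_def)
  have "Re (sform H (c *s y z') z $ l) = 0" for l
  proof -
    have "sform H (c *s y z') z $ l = cnj (\<nu> l) * (c * \<xi>)"
      using sform_y_left[of z' z l] by (simp add: sform_smult_left \<xi>_def mult_ac)
    then show ?thesis using True \<open>Re (c * \<xi>) = 0\<close> by simp
  qed
  then have "sform H (c *s y z') (y z) = 0" by (rule sform_y_eq_0)
  then have "c * sform H (y z') (y z) $ 4 = 0" by (metis sform_smult_left vector_smult_component zero_index)
  then show ?thesis using \<open>c \<noteq> 0\<close> by simp
next
  case False
  then obtain l where l: "Im (\<nu> l) \<noteq> 0" by blast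
  have 0: "sform H x x $ 4 = 0" if x: "x = y z + c *s y z'" for c x
  proof -
    have "sform H x x $ l = \<nu> l * sform H x x $ 4"
      using \<nu>[of x z l] \<nu>[of x z' l] by (subst (1 3) x) (simp add: sform_add_right sform_smult_right algebra_simps)
    moreover have "Im (sform H x x $ l) = 0" "Im (sform H x x $ 4) = 0"
      using hform_Im[OF herm, of x] by (simp_all add: hform_eq_sform)
    ultimately show ?thesis using l by (simp add: complex_eq_iff)
  qed
  have "sform H (y z) (y z') $ 4 = cnj (sform H (y z') (y z) $ 4)" by (simp add: sform_cnj[OF herm])
  moreover have "sform H (y z') (y z') $ 4 = 0"
  proof -
    have "sform H (y z') (y z') $ l = \<nu> l * sform H (y z') (y z') $ 4" using \<nu> by blast
    moreover have "Im (sform H (y z') (y z') $ l) = 0" "Im (sform H (y z') (y z') $ 4) = 0"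
      using hform_Im[OF herm, of "y z'"] by (simp_all add: hform_eq_sform)
    ultimately show ?thesis using l by (simp add: complex_eq_iff)
  qed
  ultimately have "c * sform H (y z') (y z) $ 4 + cnj (c * sform H (y z') (y z) $ 4) = 0" for c
    using 0[OF refl, of c] 0[OF refl, of 0]
    by (simp add: sform_add_left sform_add_right sform_smult_left sform_smult_right)
  from this[of 1] this[of \<i>] show ?thesis by (simp add: complex_eq_iff)
qed

text \<open>The coefficients are tested on multiples of y z' and on z. On both the left-hand side
  vanishes by isotropy, while the functionals take the values Re (\<kappa> cnj \<nu>) and
  \<langle>z, z\<rangle>.\<close>

lemma combination_orthogonal:
  assumes \<xi>: "sform H (y z') z $ 4 \<noteq> 0"
    and s: "\<And>\<delta>. Re (c * sform H \<delta> (y z) $ 4) = (\<Sum>l\<in>UNIV. s $ l * Re (sform H \<delta> z $ l))"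
  shows "(\<Sum>l\<in>UNIV. s $ l * Re (\<nu> l)) = 0" "(\<Sum>l\<in>UNIV. s $ l * Im (\<nu> l)) = 0"
    "(\<Sum>l\<in>UNIV. s $ l * Re (hform H z $ l)) = 0"
proof -
  have *: "(\<Sum>l\<in>UNIV. s $ l * Re (\<kappa> * cnj (\<nu> l))) = 0" for \<kappa>
  proof -
    define \<delta> where "\<delta> = (\<kappa> / sform H (y z') z $ 4) *s y z'"
    have "sform H \<delta> z $ l = \<kappa> * cnj (\<nu> l)" for l
      using \<xi> by (simp add: \<delta>_def sform_smult_left sform_y_left[of z' z l])
    moreover have "sform H \<delta> (y z) $ 4 = 0"
      by (simp add: \<delta>_def sform_smult_left y_isotropic)
    ultimately show ?thesis using s[of \<delta>] by simp
  qed
  show "(\<Sum>l\<in>UNIV. s $ l * Re (\<nu> l)) = 0" using *[of 1] by simp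
  show "(\<Sum>l\<in>UNIV. s $ l * Im (\<nu> l)) = 0" using *[of \<i>] by simp
  show "(\<Sum>l\<in>UNIV. s $ l * Re (hform H z $ l)) = 0"
    using s[of z] iso[of z] by (simp add: hform_eq_sform)
qed

lemma exists_combination:
  "\<exists>s::real^4. \<forall>\<delta>. Re (c * sform H \<delta> (y z) $ 4) = (\<Sum>l\<in>UNIV. s $ l * Re (sform H \<delta> z $ l))"
proof (rule Re_sform_combination[OF herm])
  fix \<delta> assume "\<And>l. Re (sform H \<delta> z $ l) = 0"
  then have "sform H \<delta> (y z) = 0" by (rule sform_y_eq_0)
  then show "Re (c * sform H \<delta> (y z) $ 4) = 0" by simp
qed

text \<open>Otherwise Re \<nu> and Im \<nu> are independent, because \<nu> has last entry 1, and
  their orthogonal complement S in R^4 is a plane. At a generic point the coefficient vectors for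
  the factors 1 and \<i> are independent and span S, so all of S is orthogonal to \<langle>z,
  z\<rangle>. But a fixed nonzero vector of S, obtained at another point, is not orthogonal to
  \<langle>z, z\<rangle> for generic z.\<close>

lemma real_eigenvalues: "Im (\<nu> l) = 0"
proof (rule ccontr)
  assume l: "Im (\<nu> l) \<noteq> 0"
  define nr ni :: "real^4" where "nr = (\<chi> l. Re (\<nu> l))" and "ni = (\<chi> l. Im (\<nu> l))"
  obtain \<delta>0 where \<delta>0: "sform H \<delta>0 (y z0) $ 4 \<noteq> 0" using sform_4_eq_0 z0 by blast
  obtain z1 where z1: "sform H \<delta>0 (y z1) $ 4 \<noteq> 0" "sform H z1 (y z0) $ 4 \<noteq> 0"
    using poly_on_lines_common_nonzero[OF poly_on_lines_y poly_on_lines_sform \<delta>0 \<delta>0] by blast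
  obtain c where c: "\<And>\<delta>. Re (1 * sform H \<delta> (y z1) $ 4) = (\<Sum>l\<in>UNIV. c $ l * Re (sform H \<delta> z1 $ l))"
    using exists_combination[of 1 z1] by blast
  have left_nz: "sform H (y z0) z $ 4 \<noteq> 0" if "sform H z (y z0) $ 4 \<noteq> 0" for z
    using that sform_cnj[OF herm, of z "y z0" 4] by auto
  note c_orth = combination_orthogonal[OF left_nz[OF z1(2)] c]
  have "c \<noteq> 0"
  proof
    assume "c = 0"
    then have "Re (sform H \<delta> (y z1) $ 4) = 0" for \<delta> using c[of \<delta>] by simp
    then have "sform H \<delta> (y z1) $ 4 = 0" for \<delta>
      by (rule complex_linear_Re_eq_0) (simp add: sform_smult_left)
    with z1(1) show False by blast
  qed
  then obtain z2 where z2: "(\<Sum>l\<in>UNIV. c $ l * Re (hform H z2 $ l)) \<noteq> 0"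
    using nondegenerate_hform_independent[OF herm nondeg, of c] by blast
  have c_re: "(\<Sum>l\<in>UNIV. complex_of_real (c $ l) * hform H z $ l) = complex_of_real (\<Sum>l\<in>UNIV. c $ l * Re (hform H z $ l))" for z
    by (simp add: hform_real[OF herm])
  have "(\<Sum>l\<in>UNIV. complex_of_real (c $ l) * hform H z2 $ l) \<noteq> 0"
    unfolding c_re using z2 by (simp del: of_real_sum)
  from poly_on_lines_common_nonzero[OF
      poly_on_lines_mult[OF poly_on_lines_y[of \<delta>0 4] poly_on_lines_sform[of H "y z0" 4]] poly_on_lines_hform _ this, of z1]
  obtain z3 where z3: "sform H \<delta>0 (y z3) $ 4 \<noteq> 0" "sform H z3 (y z0) $ 4 \<noteq> 0"
      "(\<Sum>l\<in>UNIV. complex_of_real (c $ l) * hform H z3 $ l) \<noteq> 0"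
    using z1 by auto
  have cv: "(\<Sum>l\<in>UNIV. c $ l * Re (hform H z3 $ l)) \<noteq> 0"
    using z3(3) unfolding c_re by (simp del: of_real_sum)
  obtain s where s: "\<And>\<delta>. Re (1 * sform H \<delta> (y z3) $ 4) = (\<Sum>l\<in>UNIV. s $ l * Re (sform H \<delta> z3 $ l))"
    using exists_combination[of 1 z3] by blast
  obtain s' where s': "\<And>\<delta>. Re (\<i> * sform H \<delta> (y z3) $ 4) = (\<Sum>l\<in>UNIV. s' $ l * Re (sform H \<delta> z3 $ l))"
    using exists_combination[of \<i> z3] by blast
  note s_orth = combination_orthogonal[OF left_nz[OF z3(2)] s]
  note s'_orth = combination_orthogonal[OF left_nz[OF z3(2)] s']
  define S where "S = {x. \<forall>w\<in>span {nr, ni}. orthogonal w x}"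
  have S_iff: "x \<in> S \<longleftrightarrow> (\<Sum>l\<in>UNIV. x $ l * Re (\<nu> l)) = 0 \<and> (\<Sum>l\<in>UNIV. x $ l * Im (\<nu> l)) = 0" for x
  proof -
    have "x \<in> S \<longleftrightarrow> orthogonal x nr \<and> orthogonal x ni"
    proof
      assume "x \<in> S"
      then show "orthogonal x nr \<and> orthogonal x ni"
        by (auto simp: S_def orthogonal_commute intro: span_base)
    next
      assume "orthogonal x nr \<and> orthogonal x ni"
      then have "orthogonal x w" if "w \<in> span {nr, ni}" for w
        using orthogonal_to_span[OF that] by blast
      then show "x \<in> S" by (simp add: S_def orthogonal_commute)
    qed
    then show ?thesis by (simp add: orthogonal_def inner_vec_def nr_def ni_def)
  qed
  have ind1: "independent {nr, ni}" "nr \<noteq> ni"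
  proof -
    have ni0: "ni \<noteq> 0" using l by (auto simp: ni_def vec_eq_iff)
    have 4: "nr $ 4 = 1" "ni $ 4 = 0" by (simp_all add: nr_def ni_def \<nu>_4)
    have "nr \<notin> span {ni}"
    proof
      assume "nr \<in> span {ni}"
      then obtain k where "nr = k *\<^sub>R ni" by (auto simp: span_singleton)
      then show False using 4 by simp
    qed
    then show "independent {nr, ni}" using ni0 by (simp add: independent_insert)
    show "nr \<noteq> ni" using 4 by auto
  qed
  have "dim S + dim (span {nr, ni}) = dim (UNIV :: (real^4) set)"
    unfolding S_def using dim_subspace_orthogonal_to_vectors[of "span {nr, ni}" UNIV] by simp
  moreover have "dim (span {nr, ni}) = 2" using ind1 by (simp add: dim_eq_card_independent)
  ultimately have dimS: "dim S = 2" by simp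
  have ss': "p = 0 \<and> q = 0" if "p *\<^sub>R s + q *\<^sub>R s' = 0" for p q
  proof -
    have "Re ((of_real p + of_real q * \<i>) * sform H \<delta> (y z3) $ 4) = 0" for \<delta>
    proof -
      have "Re ((of_real p + of_real q * \<i>) * sform H \<delta> (y z3) $ 4) =
          p * Re (1 * sform H \<delta> (y z3) $ 4) + q * Re (\<i> * sform H \<delta> (y z3) $ 4)"
        by simp
      also have "\<dots> = (\<Sum>l\<in>UNIV. (p *\<^sub>R s + q *\<^sub>R s') $ l * Re (sform H \<delta> z3 $ l))"
        unfolding s s' by (simp add: sum_distrib_left sum.distrib algebra_simps)
      finally show ?thesis using that by simp
    qed
    then have "(of_real p + of_real q * \<i>) * sform H \<delta>0 (y z3) $ 4 = 0"
      by (rule complex_linear_Re_eq_0) (simp add: sform_smult_left)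
    with z3(1) have "of_real p + of_real q * \<i> = 0" by (simp only: mult_eq_0_iff) blast
    then show ?thesis by (simp add: complex_eq_iff)
  qed
  have "s' \<noteq> 0" using ss'[of 0 1] by auto
  moreover have "s \<notin> span {s'}"
  proof
    assume "s \<in> span {s'}"
    then obtain k where "s = k *\<^sub>R s'" by (auto simp: span_singleton)
    then show False using ss'[of 1 "- k"] by simp
  qed
  ultimately have ind2: "independent {s, s'}" by (simp add: independent_insert)
  have "s \<noteq> s'" using ss'[of 1 "-1"] by auto
  have "{s, s'} \<subseteq> S" using s_orth s'_orth S_iff by auto
  then have "S \<subseteq> span {s, s'}"
    using card_ge_dim_independent[of "{s, s'}" S] ind2 dimS \<open>s \<noteq> s'\<close> by simp
  moreover have "c \<in> S" using c_orth S_iff by blast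
  ultimately obtain p q where "c = p *\<^sub>R s + q *\<^sub>R s'"
    by (auto simp: span_insert span_singleton eq_diff_eq algebra_simps)
  then have "(\<Sum>l\<in>UNIV. c $ l * Re (hform H z3 $ l)) =
     p * (\<Sum>l\<in>UNIV. s $ l * Re (hform H z3 $ l)) + q * (\<Sum>l\<in>UNIV. s' $ l * Re (hform H z3 $ l))"
    by (simp add: sum_distrib_left sum.distrib algebra_simps)
  with s_orth(3) s'_orth(3) cv show False by simp
qed

end

end

subsection \<open>Normal form\<close>

definition cmat :: "(4 \<Rightarrow> complex^4) \<Rightarrow> complex^4^4" where
  "cmat b = (\<chi> i j. b j $ i)"

lemma cmat_mult: "cmat b *v x = x $ 1 *s b 1 + x $ 2 *s b 2 + x $ 3 *s b 3 + x $ 4 *s b 4"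
  by (simp add: cmat_def vec_eq_iff matrix_vector_mult_def sum_4 mult.commute)

lemma H_tilde_sform:
  "sform H_tilde x y $ 1 = x $ 2 * cnj (y $ 1) + x $ 1 * cnj (y $ 2)"
  "sform H_tilde x y $ 2 = \<i> * (x $ 1 * cnj (y $ 2) - x $ 2 * cnj (y $ 1))"
  "sform H_tilde x y $ 3 = x $ 2 * cnj (y $ 2)"
  "sform H_tilde x y $ 4 = x $ 4 * cnj (y $ 1) + x $ 1 * cnj (y $ 4) + x $ 3 * cnj (y $ 2) + x $ 2 * cnj (y $ 3)"
  by (simp_all add: sform_def H_tilde_nth E_mat_def sum_4 algebra_simps)

lemma tuple_eqI:
  assumes "\<And>x y. sform H x y = sform K x y"
  shows "H = K"
  using assms sform_axis[of H] sform_axis[of K] by (simp add: vec_eq_iff)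

lemma sform_tuple_act:
  fixes H :: "complex^'a^'a^'b"
  shows
  "sform (tuple_act C \<rho> H) x y $ l =
     (\<Sum>m\<in>UNIV. of_real (matrix_inv \<rho> $ l $ m) * sform H (C *v x) (C *v y) $ m)"
proof -
  have "tuple_act C \<rho> H $ l *v x =
     (\<Sum>m\<in>UNIV. matrix_inv \<rho> $ l $ m *\<^sub>R (map_matrix cnj (transpose C) *v (H $ m *v (C *v x))))"
  proof -
    have sum: "(\<Sum>m\<in>UNIV. r m *\<^sub>R A m) *v x = (\<Sum>m\<in>UNIV. r m *\<^sub>R (A m *v x))"
      for r and A :: "'b \<Rightarrow> complex^'a^'a"
      by (simp add: vec_eq_iff matrix_vector_mult_def sum_distrib_right scaleR_sum_right)
         (intro allI sum.swap)
    show ?thesis unfolding tuple_act_def by (simp add: sum matrix_vector_mul_assoc matrix_mul_assoc)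
  qed
  then have "sform (tuple_act C \<rho> H) x y $ l =
     (\<Sum>m\<in>UNIV. of_real (matrix_inv \<rho> $ l $ m) *
        (\<Sum>p\<in>UNIV. (map_matrix cnj (transpose C) *v (H $ m *v (C *v x))) $ p * cnj (y $ p)))"
    by (simp add: sform_nth sum_distrib_right sum_distrib_left scaleR_conv_of_real[where 'a = complex] mult.assoc)
       (rule sum.swap)
  also have "\<dots> = (\<Sum>m\<in>UNIV. of_real (matrix_inv \<rho> $ l $ m) * sform H (C *v x) (C *v y) $ m)"
    by (simp only: adjoint_mult_cnj sform_nth)
  finally show ?thesis .
qed

lemma hermitian_tuple_act:
  assumes "H \<in> hermitian_tuples"
  shows "tuple_act C \<rho> H \<in> hermitian_tuples"
proof -
  have *: "cnj (sform (tuple_act C \<rho> H) x y $ l) = sform (tuple_act C \<rho> H) y x $ l" for x y l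
    by (simp add: sform_tuple_act sform_cnj[OF assms])
  have "tuple_act C \<rho> H $ l $ p $ q = cnj (tuple_act C \<rho> H $ l $ q $ p)" for l p q
    unfolding sform_axis[symmetric] * ..
  then show ?thesis unfolding hermitian_tuples_def hermitian_mat_def by blast
qed

lemma H_tilde_hermitian: "H_tilde \<in> hermitian_tuples"
  unfolding hermitian_tuples_def hermitian_mat_def
  by (simp add: forall_4 H_tilde_nth E_mat_def)

text \<open>The normalization \<open>det C = 1\<close> multiplies the form by a positive factor, which \<open>\<rho>\<close> absorbs.\<close>

lemma in_orbit_H_tildeI:
  fixes H :: "complex^4^4^4" and R :: "real^4^4"
  assumes H: "H \<in> hermitian_tuples" "nondegenerate H" and E: "invertible E"
    and R: "\<And>x y l. sform H (E *v x) (E *v y) $ l = (\<Sum>m\<in>UNIV. of_real (R $ l $ m) * sform H_tilde x y $ m)"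
  shows "H \<in> tuple_orbit H_tilde"
proof -
  obtain F where F: "E ** F = mat 1" "F ** E = mat 1" using E unfolding invertible_def by blast
  have EF: "E *v (F *v x) = x" for x by (simp add: matrix_vector_mul_assoc F)
  have dF: "det F \<noteq> 0"
    using F by (metis invertible_def invertible_det_nz)
  have invR: "invertible R"
  proof (rule ccontr)
    assume "\<not> invertible R"
    then have "\<not> invertible (transpose R)" by (simp add: invertible_det_nz det_transpose)
    then obtain c where c: "c \<noteq> 0" "transpose R *v c = 0"
      by (metis invertible_left_inverse matrix_left_invertible_ker)
    have c0: "(\<Sum>l\<in>UNIV. c $ l * R $ l $ m) = 0" for m
      using c(2) by (simp add: vec_eq_iff matrix_vector_mult_def transpose_def mult.commute)
    have "(\<Sum>l\<in>UNIV. c $ l * Re (hform H z $ l)) = 0" for z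
    proof -
      have "hform H z $ l = (\<Sum>m\<in>UNIV. of_real (R $ l $ m) * hform H_tilde (F *v z) $ m)" for l
        using R[of "F *v z" "F *v z" l] by (simp add: hform_eq_sform EF)
      then have "(\<Sum>l\<in>UNIV. c $ l * Re (hform H z $ l)) =
          (\<Sum>l\<in>UNIV. \<Sum>m\<in>UNIV. c $ l * R $ l $ m * Re (hform H_tilde (F *v z) $ m))"
        by (simp add: sum_distrib_left mult.assoc)
      also have "\<dots> = (\<Sum>m\<in>UNIV. (\<Sum>l\<in>UNIV. c $ l * R $ l $ m) * Re (hform H_tilde (F *v z) $ m))"
        by (subst sum.swap) (simp add: sum_distrib_right)
      finally show ?thesis by (simp add: c0)
    qed
    then show False using nondegenerate_hform_independent[OF H] c(1) by blast
  qed
  define k where "k = csqrt (csqrt (1 / det F))"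
  have k4: "k ^ 4 = 1 / det F"
  proof -
    have "k ^ 4 = (k\<^sup>2)\<^sup>2" by (simp add: power2_eq_square numeral_eq_Suc)
    then show ?thesis by (simp add: k_def)
  qed
  then have k: "k \<noteq> 0" using dF by auto
  define C where "C = (\<chi> i. k *s F $ i)"
  define R' where "R' = (\<chi> l. (1 / (cmod k)\<^sup>2) *s R $ l)"
  have Cv: "C *v x = k *s (F *v x)" for x
    by (simp add: C_def vec_eq_iff matrix_vector_mult_def sum_distrib_left mult.assoc)
  have "det C = k ^ 4 * det F"
    unfolding C_def using det_rows_mul[of "\<lambda>_. k" "\<lambda>i. F $ i"] by simp
  then have detC: "det C = 1" using k4 dF by simp
  have "det R' = (1 / (cmod k)\<^sup>2) ^ 4 * det R"
    unfolding R'_def using det_rows_mul[of "\<lambda>_. 1 / (cmod k)\<^sup>2" "\<lambda>i. R $ i"] by simp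
  then have "invertible R'" using invR k by (simp add: invertible_det_nz)
  then obtain \<rho> where \<rho>: "R' ** \<rho> = mat 1" "\<rho> ** R' = mat 1" unfolding invertible_def by blast
  then have inv\<rho>: "invertible \<rho>" unfolding invertible_def by blast
  have mi: "matrix_inv \<rho> = R'"
  proof -
    have "matrix_inv \<rho> = R' ** (\<rho> ** matrix_inv \<rho>)" using \<rho> by (simp add: matrix_mul_assoc)
    moreover have "\<rho> ** matrix_inv \<rho> = mat 1"
      using someI_ex[OF inv\<rho>[unfolded invertible_def]] unfolding matrix_inv_def by blast
    ultimately show ?thesis by simp
  qed
  have "tuple_act C \<rho> H_tilde = H"
  proof (rule tuple_eqI)
    fix x y
    have "sform (tuple_act C \<rho> H_tilde) x y $ l = sform H x y $ l" for l
    proof -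
      have kk: "k * cnj k = complex_of_real ((cmod k)\<^sup>2)" by (rule complex_norm_square[symmetric])
      have "sform (tuple_act C \<rho> H_tilde) x y $ l =
          (\<Sum>m\<in>UNIV. of_real (R $ l $ m / (cmod k)\<^sup>2) * ((k * cnj k) * sform H_tilde (F *v x) (F *v y) $ m))"
        by (simp add: sform_tuple_act mi R'_def Cv sform_smult_left sform_smult_right mult_ac)
      also have "\<dots> = (\<Sum>m\<in>UNIV. of_real (R $ l $ m) * sform H_tilde (F *v x) (F *v y) $ m)"
        unfolding kk using k by (intro sum.cong) auto
      also have "\<dots> = sform H x y $ l" using R[of "F *v x" "F *v y" l] by (simp add: EF)
      finally show ?thesis .
    qed
    then show "sform (tuple_act C \<rho> H_tilde) x y = sform H x y" by (simp add: vec_eq_iff)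
  qed
  then show ?thesis unfolding tuple_orbit_def using detC inv\<rho> by blast
qed

text \<open>Witt's construction of an isotropic complement to the isotropic plane spanned by u and
  w. Vectors dual to w and u exist by nondegeneracy; adding multiples of w and u then makes them
  isotropic and mutually orthogonal without disturbing the duality.\<close>

lemma hyperbolic_basis:
  fixes F :: "complex^'n \<Rightarrow> complex^'n \<Rightarrow> complex"
  assumes add: "\<And>x x' y. F (x + x') y = F x y + F x' y" and scl: "\<And>c x y. F (c *s x) y = c * F x y"
    and cnj: "\<And>x y. cnj (F x y) = F y x" and nd: "\<And>x. (\<And>\<delta>. F \<delta> x = 0) \<Longrightarrow> x = 0"
    and u: "u \<noteq> 0" and w: "\<And>c. w \<noteq> c *s u"
    and iso: "F u u = 0" "F u w = 0" "F w u = 0" "F w w = 0"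
  shows "\<exists>b1 b2. F b1 w = 1 \<and> F b1 u = 0 \<and> F b2 w = 0 \<and> F b2 u = 1 \<and>
    F b1 b1 = 0 \<and> F b1 b2 = 0 \<and> F b2 b1 = 0 \<and> F b2 b2 = 0"
proof -
  have addr: "F x (y + y') = F x y + F x y'" for x y y'
    by (metis add cnj complex_cnj_add)
  have sclr: "F x (c *s y) = cnj c * F x y" for x c y
    by (metis scl cnj complex_cnj_mult)
  have diff: "F (x - x') y = F x y - F x' y" for x x' y
    using add[of "x - x'" x' y] by simp
  have diffr: "F x (y - y') = F x y - F x y'" for x y y'
    using addr[of x "y - y'" y'] by simp
  obtain x where x: "F x u \<noteq> 0" using nd u by blast
  have "\<exists>x. F x u = 0 \<and> F x w \<noteq> 0"
  proof (rule ccontr)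
    assume "\<not> ?thesis"
    then have ker: "F x' u = 0 \<Longrightarrow> F x' w = 0" for x' by blast
    define k where "k = cnj (F x w / F x u)"
    have "F \<delta> (w + (- k) *s u) = 0" for \<delta>
    proof -
      have "F (\<delta> + (- (F \<delta> u / F x u)) *s x) w = 0"
        by (rule ker) (use x in \<open>simp add: add diff scl\<close>)
      then show ?thesis by (simp add: add diff diffr scl addr sclr k_def)
    qed
    then have "w + (- k) *s u = 0" by (rule nd)
    then have "w = k *s u" by (simp add: vec_eq_iff)
    with w show False by blast
  qed
  then obtain x1 where x1: "F x1 u = 0" "F x1 w \<noteq> 0" by blast
  define b where "b = (1 / F x1 w) *s x1"
  have b: "F b w = 1" "F b u = 0" using x1 by (simp_all add: b_def scl)
  define d where "d = (1 / F x u) *s (x + (- F x w) *s b)"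
  have d: "F d w = 0" "F d u = 1" using x b by (simp_all add: d_def scl add diff)
  have flip: "F w b = 1" "F u b = 0" "F w d = 0" "F u d = 1"
    using b d cnj by (metis complex_cnj_one complex_cnj_zero)+
  define b1 where "b1 = b + (- F b b / 2) *s w"
  have Fr: "cnj (F z z) = F z z" for z by (rule cnj)
  have b1: "F b1 w = 1" "F b1 u = 0" "F w b1 = 1" "F u b1 = 0" "F b1 b1 = 0"
    using b flip iso by (simp_all add: b1_def scl sclr add addr diff diffr Fr)
  define d1 where "d1 = d + (- F d b1) *s w"
  have d1: "F d1 w = 0" "F d1 u = 1" "F w d1 = 0" "F u d1 = 1" "F d1 b1 = 0"
    using d flip iso b1 by (simp_all add: d1_def scl sclr add addr diff diffr)
  define b2 where "b2 = d1 + (- F d1 d1 / 2) *s u"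
  have b2: "F b2 w = 0" "F b2 u = 1" "F b2 b1 = 0" "F b2 b2 = 0"
    using d1 flip iso b1 by (simp_all add: b2_def scl sclr add addr diff diffr Fr)
  have "F b1 b2 = 0" using b2(3) cnj by (metis complex_cnj_zero)
  with b1 b2 show ?thesis by blast
qed

text \<open>With \<open>S = (\<alpha>, cnj \<sigma>; \<sigma>, \<gamma>)\<close>, \<open>r = adj(S) q\<close> and \<open>q' = (- cnj r2, cnj r1)\<close> this is the pairing of the identity
  \<open>(q\<^sup>* r) S = det(S) q q\<^sup>* + q' q'\<^sup>*\<close> with a Hermitian matrix.\<close>

lemma adjugate_identity:
  fixes q1 q2 \<sigma> \<beta> :: complex and \<alpha> \<gamma> b11 b22 :: real
  defines "q1' \<equiv> cnj \<sigma> * cnj q1 - \<alpha> * cnj q2" and "q2' \<equiv> \<gamma> * cnj q1 - \<sigma> * cnj q2"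
  shows "b11 * (cmod q1')\<^sup>2 + b22 * (cmod q2')\<^sup>2 + 2 * Re (\<beta> * q2' * cnj q1') =
      (\<gamma> * (cmod q1)\<^sup>2 + \<alpha> * (cmod q2)\<^sup>2 - 2 * Re (cnj \<sigma> * q2 * cnj q1)) * (\<alpha> * b11 + \<gamma> * b22 + 2 * Re (\<beta> * \<sigma>)) -
      (\<alpha> * \<gamma> - (cmod \<sigma>)\<^sup>2) * (b11 * (cmod q1)\<^sup>2 + b22 * (cmod q2)\<^sup>2 + 2 * Re (\<beta> * q2 * cnj q1))"
    "q1 * q2' - q2 * q1' = complex_of_real (\<gamma> * (cmod q1)\<^sup>2 + \<alpha> * (cmod q2)\<^sup>2 - 2 * Re (cnj \<sigma> * q2 * cnj q1))"
  unfolding q1'_def q2'_def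
   apply (simp add: cmod_power2)
   apply algebra
  apply (simp add: complex_eq_iff cmod_power2)
  apply algebra
  done

text \<open>Hermitian 2 x 2 matrices with entries \<alpha>, \<gamma>, \<sigma> form a real space of
  dimension four, and three equations leave a nonzero solution. By the hypothesis it has determinant
  0, so up to a real factor it is g g^*, and orthogonality to it means that the forms vanish on
  g.\<close>

lemma net_isotropic_vector:
  fixes b11 b22 :: "4 \<Rightarrow> real" and b12 :: "4 \<Rightarrow> complex"
  assumes np: "\<And>\<alpha> \<gamma> \<sigma>. \<alpha> * \<gamma> \<noteq> (cmod \<sigma>)\<^sup>2 \<Longrightarrow>
      \<not> (\<forall>l. l \<noteq> 4 \<longrightarrow> \<alpha> * b11 l + \<gamma> * b22 l + 2 * Re (b12 l * \<sigma>) = 0)"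
  shows "\<exists>g1 g2. (cmod g1)\<^sup>2 + (cmod g2)\<^sup>2 = 1 \<and>
      (\<forall>l. l \<noteq> 4 \<longrightarrow> b11 l * (cmod g1)\<^sup>2 + b22 l * (cmod g2)\<^sup>2 + 2 * Re (b12 l * g2 * cnj g1) = 0)"
proof -
  \<comment> \<open>The coefficients of the three equations, with a zero row in place of the index 4
    to make the matrix square and singular.\<close>
  define M :: "real^4^4" where "M = (\<chi> l. if l = 4 then 0 else
    (\<chi> i. if i = 1 then b11 l else if i = 2 then b22 l else if i = 3 then 2 * Re (b12 l) else - 2 * Im (b12 l)))"
  have "row 4 M = 0" by (simp add: row_def M_def vec_eq_iff)
  then have "det M = 0" by (rule det_zero_row)
  then have "\<not> invertible M" by (simp add: invertible_det_nz)
  then obtain s where s: "s \<noteq> 0" "M *v s = 0"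
    by (metis invertible_left_inverse matrix_left_invertible_ker)
  define \<alpha> \<gamma> \<sigma> where "\<alpha> = s $ 1" and "\<gamma> = s $ 2" and "\<sigma> = Complex (s $ 3) (s $ 4)"
  have orth: "\<alpha> * b11 l + \<gamma> * b22 l + 2 * Re (b12 l * \<sigma>) = 0" if "l \<noteq> 4" for l
  proof -
    have "(M *v s) $ l = 0" using s(2) by simp
    then show ?thesis using that
      by (simp add: matrix_vector_mult_def M_def sum_4 \<alpha>_def \<gamma>_def \<sigma>_def algebra_simps)
  qed
  have d: "\<alpha> * \<gamma> = (cmod \<sigma>)\<^sup>2" using np orth by blast
  have "\<exists>g1 g2. (cmod g1)\<^sup>2 + (cmod g2)\<^sup>2 > 0 \<and>
      (\<forall>l. l \<noteq> 4 \<longrightarrow> b11 l * (cmod g1)\<^sup>2 + b22 l * (cmod g2)\<^sup>2 + 2 * Re (b12 l * g2 * cnj g1) = 0)"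
  \<comment> \<open>For \<alpha> nonzero the first column (\<alpha>, \<sigma>) serves as g, since g
    g^* is \<alpha> times the matrix; otherwise \<sigma> = 0 too, and g is the second unit
    vector.\<close>
  proof (cases "\<alpha> = 0")
    case False
    have "b11 l * (cmod (of_real \<alpha>))\<^sup>2 + b22 l * (cmod \<sigma>)\<^sup>2 + 2 * Re (b12 l * \<sigma> * cnj (of_real \<alpha>)) = 0"
      if "l \<noteq> 4" for l
    proof -
      have "b11 l * (cmod (of_real \<alpha>))\<^sup>2 + b22 l * (cmod \<sigma>)\<^sup>2 + 2 * Re (b12 l * \<sigma> * cnj (of_real \<alpha>)) =
          \<alpha> * (\<alpha> * b11 l + \<gamma> * b22 l + 2 * Re (b12 l * \<sigma>))"
        unfolding d[symmetric] by (simp add: power2_eq_square algebra_simps)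
      then show ?thesis using orth[OF that] by simp
    qed
    moreover have "(cmod (complex_of_real \<alpha>))\<^sup>2 + (cmod \<sigma>)\<^sup>2 > 0" using False by (simp add: add_pos_nonneg)
    ultimately show ?thesis by blast
  next
    case True
    then have "\<sigma> = 0" using d by simp
    then have "\<gamma> \<noteq> 0" using s(1) True by (auto simp: \<alpha>_def \<gamma>_def \<sigma>_def vec_eq_iff forall_4 complex_eq_iff)
    then have "b22 l = 0" if "l \<noteq> 4" for l using orth[OF that] True \<open>\<sigma> = 0\<close> by simp
    then show ?thesis by (intro exI[of _ 0] exI[of _ 1]) simp
  qed
  then obtain g1 g2 where g: "(cmod g1)\<^sup>2 + (cmod g2)\<^sup>2 > 0"
      "\<And>l. l \<noteq> 4 \<Longrightarrow> b11 l * (cmod g1)\<^sup>2 + b22 l * (cmod g2)\<^sup>2 + 2 * Re (b12 l * g2 * cnj g1) = 0" by blast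
  define n where "n = 1 / sqrt ((cmod g1)\<^sup>2 + (cmod g2)\<^sup>2)"
  have n2: "n\<^sup>2 = 1 / ((cmod g1)\<^sup>2 + (cmod g2)\<^sup>2)" using g(1) by (simp add: n_def power_divide)
  have sc: "(cmod (of_real n * g))\<^sup>2 = n\<^sup>2 * (cmod g)\<^sup>2" for g
    by (simp add: norm_mult power_mult_distrib)
  have "b11 l * (cmod (of_real n * g1))\<^sup>2 + b22 l * (cmod (of_real n * g2))\<^sup>2 +
      2 * Re (b12 l * (of_real n * g2) * cnj (of_real n * g1)) = 0" if "l \<noteq> 4" for l
  proof -
    have "Re (b12 l * (of_real n * g2) * cnj (of_real n * g1)) = Re (of_real (n\<^sup>2) * (b12 l * g2 * cnj g1))"
      by (simp only: complex_cnj_mult complex_cnj_complex_of_real power2_eq_square of_real_mult mult_ac)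
    also have "\<dots> = n\<^sup>2 * Re (b12 l * g2 * cnj g1)" by simp
    finally show ?thesis
      using arg_cong[OF g(2)[OF that], of "\<lambda>x. n\<^sup>2 * x"] by (simp only: sc) (simp add: algebra_simps)
  qed
  moreover have "(cmod (of_real n * g1))\<^sup>2 + (cmod (of_real n * g2))\<^sup>2 = 1"
    unfolding sc n2 using g(1) by (auto simp: add_divide_distrib[symmetric])
  ultimately show ?thesis by blast
qed

text \<open>The Hermitian form of \<open>H_tilde $ 4\<close>, of signature (2, 2), which pairs the
  first basis vector with the fourth and the second with the third.\<close>

definition hyp :: "complex^4 \<Rightarrow> complex^4 \<Rightarrow> complex" where
  "hyp x y = x $ 4 * cnj (y $ 1) + x $ 1 * cnj (y $ 4) + x $ 3 * cnj (y $ 2) + x $ 2 * cnj (y $ 3)"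

lemma hyp_nondegenerate:
  assumes "\<And>y. hyp x y = 0" shows "x = 0"
  using assms[of "axis 1 1"] assms[of "axis 2 1"] assms[of "axis 3 1"] assms[of "axis 4 1"]
  by (simp add: hyp_def axis_def vec_eq_iff forall_4)

lemma invertible_if_hyp:
  fixes E :: "complex^4^4"
  assumes "\<And>x y. F (E *v x) (E *v y) = hyp x y" "\<And>y. F 0 y = 0"
  shows "invertible E"
proof -
  have "x = 0" if "E *v x = 0" for x
    using assms(1)[of x] assms(2) that by (intro hyp_nondegenerate) auto
  then show ?thesis
    unfolding invertible_left_inverse matrix_left_invertible_ker by blast
qed

lemma poly_on_lines_const: "poly_on_lines (\<lambda>_. c)"
  unfolding poly_on_lines_def by (intro allI exI[of _ "\<lambda>_. c"]) auto

lemma poly_on_lines_add: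
  assumes "poly_on_lines g" "poly_on_lines h" shows "poly_on_lines (\<lambda>x. g x + h x)"
  unfolding poly_on_lines_def
proof (intro allI)
  fix x d
  obtain p where "poly_fun p" "\<forall>t::real. g (x + of_real t *s d) = p (of_real t)"
    using assms(1)[unfolded poly_on_lines_def, rule_format, of x d] by blast
  moreover obtain q where "poly_fun q" "\<forall>t::real. h (x + of_real t *s d) = q (of_real t)"
    using assms(2)[unfolded poly_on_lines_def, rule_format, of x d] by blast
  ultimately show "\<exists>p. poly_fun p \<and> (\<forall>t::real. g (x + of_real t *s d) + h (x + of_real t *s d) = p (of_real t))"
    by (intro exI[of _ "\<lambda>t. p t + q t"]) auto
qed

lemma poly_on_lines_cnj:
  assumes "poly_on_lines g" shows "poly_on_lines (\<lambda>x. cnj (g x))"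
  unfolding poly_on_lines_def
proof (intro allI)
  fix x d
  obtain p where "poly_fun p" "\<forall>t::real. g (x + of_real t *s d) = p (of_real t)"
    using assms(1)[unfolded poly_on_lines_def, rule_format, of x d] by blast
  then show "\<exists>p. poly_fun p \<and> (\<forall>t::real. cnj (g (x + of_real t *s d)) = p (of_real t))"
    by (intro exI[of _ "\<lambda>t. cnj (p (cnj t))"]) (simp add: poly_fun_cnj)
qed

context isotropic_map
begin

lemma in_orbit_H_tilde: "H \<in> tuple_orbit H_tilde"
proof -
  obtain \<nu> where \<nu>: "\<And>l z \<delta>. sform H \<delta> (y z) $ l = \<nu> l * sform H \<delta> (y z) $ 4"
    using pencil_eigenvalues by blast
  obtain z1 where z1: "\<And>c. y z1 \<noteq> c *s y z0" using y_not_parallel by blast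
  define r where "r = (\<lambda>l. Re (\<nu> l))"
  have \<nu>r: "\<nu> l = of_real (r l)" for l
    using real_eigenvalues[of \<nu> l, OF \<nu>] by (simp add: r_def complex_eq_iff)
  have r4: "r 4 = 1" using \<nu>_4[of \<nu>, OF \<nu>] by (simp add: r_def)
  define F where "F = (\<lambda>x y. sform H x y $ 4)"
  define G where "G = (\<lambda>l x y. sform H x y $ l - of_real (r l) * sform H x y $ 4)"
  define u w where "u = y z0" and "w = y z1"
  have Fa: "F (x + x') z = F x z + F x' z" and Fs: "F (c *s x) z = c * F x z"
    and Far: "F z (x + x') = F z x + F z x'" and Fsr: "F z (c *s x) = cnj c * F z x" for x x' z c
    by (simp_all add: F_def sform_add_left sform_add_right sform_smult_left sform_smult_right)
  have Fc: "cnj (F x z) = F z x" for x z by (simp add: F_def sform_cnj[OF herm])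
  have Fnd: "x = 0" if "\<And>\<delta>. F \<delta> x = 0" for x using that sform_4_eq_0 by (simp add: F_def)
  have F0: "F 0 x = 0" for x by (simp add: F_def)
  have Fy: "F (y z') (y z) = 0" for z z' using y_isotropic[of \<nu>, OF \<nu>] by (simp add: F_def)
  have Ga: "G l (x + x') z = G l x z + G l x' z" and Gs: "G l (c *s x) z = c * G l x z"
    and Gar: "G l z (x + x') = G l z x + G l z x'" and Gsr: "G l z (c *s x) = cnj c * G l z x" for l x x' z c
    by (simp_all add: G_def sform_add_left sform_add_right sform_smult_left sform_smult_right algebra_simps)
  have Gc: "cnj (G l x z) = G l z x" for l x z by (simp add: G_def sform_cnj[OF herm])
  have Gy: "G l x (y z) = 0" for l x z using \<nu>[of x z l] by (simp add: G_def \<nu>r)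
  then have Gy': "G l (y z) x = 0" for l x z using Gc by (metis complex_cnj_zero)
  have G4: "G 4 x z = 0" for x z by (simp add: G_def r4)
  note Guw = Gy[of _ _ z0, folded u_def] Gy[of _ _ z1, folded w_def]
    Gy'[of _ z0, folded u_def] Gy'[of _ z1, folded w_def]
  obtain b1 b2 where b: "F b1 w = 1" "F b1 u = 0" "F b2 w = 0" "F b2 u = 1"
      "F b1 b1 = 0" "F b1 b2 = 0" "F b2 b1 = 0" "F b2 b2 = 0"
    using hyperbolic_basis[of F u w, OF Fa Fs Fc Fnd] z0 z1 Fy unfolding u_def w_def by blast
  have b': "F w b1 = 1" "F u b1 = 0" "F w b2 = 0" "F u b2 = 1"
    using b Fc by (metis complex_cnj_one complex_cnj_zero)+
  have iso4: "F u u = 0" "F u w = 0" "F w u = 0" "F w w = 0" by (simp_all add: u_def w_def Fy)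
  note Ftab = b b' iso4 Fa Fs Far Fsr
  \<comment> \<open>The order makes \<open>F\<close> equal to \<open>hyp\<close>: \<open>b1\<close>
    is dual to \<open>w\<close> and \<open>b2\<close> to \<open>u\<close>. The forms
    \<open>G l\<close> then depend on the first two coordinates only.\<close>
  define C where "C = cmat (\<lambda>j. if j = 1 then b1 else if j = 2 then b2 else if j = 3 then u else w)"
  have C: "C *v x = x $ 1 *s b1 + x $ 2 *s b2 + x $ 3 *s u + x $ 4 *s w" for x
    by (simp add: C_def cmat_mult)
  have FC: "F (C *v x) (C *v z) = hyp x z" for x z
    by (simp add: C Ftab hyp_def algebra_simps)
  have "invertible C" using invertible_if_hyp[of F C, OF FC F0] .
  then obtain C' where "C ** C' = mat 1" unfolding invertible_def by blast
  then have surj: "\<exists>x. z = C *v x" for z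
    by (metis matrix_vector_mul_assoc matrix_vector_mul_lid)
  define b11 b22 b12 where "b11 = (\<lambda>l. Re (G l b1 b1))" and "b22 = (\<lambda>l. Re (G l b2 b2))"
    and "b12 = (\<lambda>l. G l b2 b1)"
  have Gr: "G l x x = of_real (Re (G l x x))" for l x using Gc[of l x x] by (simp add: complex_eq_iff)
  have GC: "G l (p *s b1 + q *s b2) (p *s b1 + q *s b2) =
      of_real (b11 l * (cmod p)\<^sup>2 + b22 l * (cmod q)\<^sup>2 + 2 * Re (b12 l * q * cnj p))" for l p q
  proof -
    have "G l (p *s b1 + q *s b2) (p *s b1 + q *s b2) =
        of_real (b11 l) * (p * cnj p) + of_real (b22 l) * (q * cnj q) + (b12 l * q * cnj p + cnj (b12 l * q * cnj p))"
      using Gr[of l b1] Gr[of l b2] Gc[of l b2 b1]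
      by (simp add: Ga Gs Gar Gsr b11_def b22_def b12_def algebra_simps)
    also have "b12 l * q * cnj p + cnj (b12 l * q * cnj p) = of_real (2 * Re (b12 l * q * cnj p))"
      by (rule complex_add_cnj)
    finally show ?thesis by (simp only: of_real_add of_real_mult complex_norm_square)
  qed
  have GCx: "G l (C *v x) (C *v x) =
      of_real (b11 l * (cmod (x $ 1))\<^sup>2 + b22 l * (cmod (x $ 2))\<^sup>2 + 2 * Re (b12 l * x $ 2 * cnj (x $ 1)))" for l x
    unfolding GC[symmetric] by (simp add: C Ga Gs Gar Gsr Guw)
  have hform_G: "hform H z $ l = G l z z + of_real (r l) * F z z" for l z
    by (simp add: G_def F_def hform_eq_sform)

  \<comment> \<open>Proportional values of the form give parallel values of a, through a complex
    square root of \<open>t\<close>. Maximality of the isotropic plane puts this common direction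
    \<eta> into the span of \<open>u\<close> and \<open>w\<close>, and orthogonality to \<eta>
    determines the first two coordinates up to a factor.\<close>
  have parallel: "x $ 1 * x' $ 2 = x $ 2 * x' $ 1"
    if nz: "y (C *v x) \<noteq> 0" and t: "t \<noteq> 0" and eq: "hform H (C *v x') = of_real t *s hform H (C *v x)"
    for x x' and t :: real
  proof -
    obtain \<eta> where \<eta>: "y (C *v x) = C *v \<eta>" using surj by blast
    have "C *v axis 3 1 = u" "C *v axis 4 1 = w" by (simp_all add: C axis_def)
    then have "hyp \<eta> (axis 3 1) = 0" "hyp \<eta> (axis 4 1) = 0"
      unfolding FC[symmetric] \<eta>[symmetric] by (simp_all add: u_def w_def Fy)
    then have \<eta>12: "\<eta> $ 2 = 0" "\<eta> $ 1 = 0" by (simp_all add: hyp_def axis_def)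
    have "hyp x \<eta> = 0" unfolding FC[symmetric] \<eta>[symmetric] using iso by (simp add: F_def)
    then have e1: "x $ 1 * cnj (\<eta> $ 4) + x $ 2 * cnj (\<eta> $ 3) = 0" by (simp add: hyp_def \<eta>12)
    define s where "s = csqrt (of_real t)"
    have s: "s\<^sup>2 = of_real t" "s \<noteq> 0" using t by (simp_all add: s_def)
    have "y (C *v x') = s ^ m *s y (C *v x)" unfolding eq s(1)[symmetric] by (rule a_scale)
    then have "sform H (C *v x') (s ^ m *s y (C *v x)) $ 4 = 0" using iso[of "C *v x'"] by simp
    then have "F (C *v x') (y (C *v x)) = 0" using s(2) by (simp add: F_def sform_smult_right)
    then have "hyp x' \<eta> = 0" unfolding FC[symmetric] \<eta>[symmetric] .
    then have e2: "x' $ 1 * cnj (\<eta> $ 4) + x' $ 2 * cnj (\<eta> $ 3) = 0" by (simp add: hyp_def \<eta>12)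
    have "(x $ 1 * x' $ 2 - x $ 2 * x' $ 1) * cnj (\<eta> $ 4) = 0" "(x $ 1 * x' $ 2 - x $ 2 * x' $ 1) * cnj (\<eta> $ 3) = 0"
      using e1 e2 by algebra+
    moreover have "\<eta> $ 4 \<noteq> 0 \<or> \<eta> $ 3 \<noteq> 0"
    proof (rule ccontr)
      assume "\<not> ?thesis"
      with \<eta>12 have "\<eta> = 0" by (simp add: vec_eq_iff forall_4)
      with nz \<eta> show False by simp
    qed
    ultimately show ?thesis by auto
  qed

  \<comment> \<open>From a matrix S of nonzero determinant the adjugate identity produces a vector
    q' on which all \<open>G l\<close> are those at q times - det S. If q and q' are not parallel,
    this contradicts \<open>parallel\<close>.\<close>
  have np: "\<not> (\<forall>l. l \<noteq> 4 \<longrightarrow> \<alpha> * b11 l + \<gamma> * b22 l + 2 * Re (b12 l * \<sigma>) = 0)"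
    if d: "\<alpha> * \<gamma> \<noteq> (cmod \<sigma>)\<^sup>2" for \<alpha> \<gamma> \<sigma>
  proof
    assume orth: "\<forall>l. l \<noteq> 4 \<longrightarrow> \<alpha> * b11 l + \<gamma> * b22 l + 2 * Re (b12 l * \<sigma>) = 0"
    have b4: "b11 4 = 0" "b22 4 = 0" "b12 4 = 0" by (simp_all add: b11_def b22_def b12_def G4)
    have orth: "\<alpha> * b11 l + \<gamma> * b22 l + 2 * Re (b12 l * \<sigma>) = 0" for l
      using orth b4 by (cases "l = 4") auto
    \<comment> \<open>The value q^* adj(S) q, which is also the determinant of the pair q, q'. It is
      not identically zero, so a generic point has it nonzero together with a nonzero value of
      a.\<close>
    define s0 where "s0 = (\<lambda>q1 q2. \<gamma> * (cmod q1)\<^sup>2 + \<alpha> * (cmod q2)\<^sup>2 - 2 * Re (cnj \<sigma> * q2 * cnj q1))"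
    have "\<exists>q1 q2. s0 q1 q2 \<noteq> 0"
    proof (cases "\<gamma> = 0 \<and> \<alpha> = 0")
      case True
      then have "\<sigma> \<noteq> 0" using d by auto
      moreover have "s0 1 \<sigma> = - 2 * (cmod \<sigma>)\<^sup>2"
        unfolding cmod_power2 using True by (simp add: s0_def power2_eq_square)
      ultimately have "s0 1 \<sigma> \<noteq> 0" by simp
      then show ?thesis by blast
    next
      case False
      then have "s0 1 0 \<noteq> 0 \<or> s0 0 1 \<noteq> 0" by (auto simp: s0_def)
      then show ?thesis by blast
    qed
    then obtain p1 p2 where p: "s0 p1 p2 \<noteq> 0" by blast
    have s0F: "complex_of_real (s0 (F z w) (F z u)) =
        of_real \<gamma> * (F z w * cnj (F z w)) + of_real \<alpha> * (F z u * cnj (F z u)) +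
        ((- cnj \<sigma>) * (F z u * cnj (F z w)) + (- \<sigma>) * (cnj (F z u) * F z w))" for z
    proof -
      have "complex_of_real (s0 (F z w) (F z u)) = of_real \<gamma> * of_real ((cmod (F z w))\<^sup>2) +
          of_real \<alpha> * of_real ((cmod (F z u))\<^sup>2) - of_real (2 * Re (cnj \<sigma> * F z u * cnj (F z w)))"
        unfolding s0_def by (simp only: of_real_diff of_real_add of_real_mult)
      then show ?thesis
        unfolding complex_norm_square complex_add_cnj[symmetric] by (simp add: algebra_simps)
    qed
    have lin: "poly_on_lines (\<lambda>z. F z x)" for x unfolding F_def by (rule poly_on_lines_sform)
    have "poly_on_lines (\<lambda>z. complex_of_real (s0 (F z w) (F z u)))"
      unfolding s0F by (intro poly_on_lines_add poly_on_lines_mult poly_on_lines_const poly_on_lines_cnj lin)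
    moreover have "complex_of_real (s0 (F (p1 *s b1 + p2 *s b2) w) (F (p1 *s b1 + p2 *s b2) u)) \<noteq> 0"
      using p by (simp add: Ftab)
    moreover obtain \<delta>0 where "sform H \<delta>0 (y z0) $ 4 \<noteq> 0" using sform_4_eq_0 z0 by blast
    ultimately obtain z where z: "complex_of_real (s0 (F z w) (F z u)) \<noteq> 0" "sform H \<delta>0 (y z) $ 4 \<noteq> 0"
      using poly_on_lines_common_nonzero[OF _ poly_on_lines_y] by blast
    obtain x where x: "z = C *v x" using surj by blast
    have "F z w = x $ 1" "F z u = x $ 2" by (simp_all add: x C Ftab)
    with z(1) have s0: "s0 (x $ 1) (x $ 2) \<noteq> 0" by simp
    have nz: "y (C *v x) \<noteq> 0" using z(2) x by auto
    define q1' where "q1' = cnj \<sigma> * cnj (x $ 1) - \<alpha> * cnj (x $ 2)"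
    define q2' where "q2' = \<gamma> * cnj (x $ 1) - \<sigma> * cnj (x $ 2)"
    define D where "D = \<alpha> * \<gamma> - (cmod \<sigma>)\<^sup>2"
    have adj: "b11 l * (cmod q1')\<^sup>2 + b22 l * (cmod q2')\<^sup>2 + 2 * Re (b12 l * q2' * cnj q1') =
      - D * (b11 l * (cmod (x $ 1))\<^sup>2 + b22 l * (cmod (x $ 2))\<^sup>2 + 2 * Re (b12 l * x $ 2 * cnj (x $ 1)))" for l
      unfolding q1'_def q2'_def D_def
      by (simp only: adjugate_identity(1) orth mult_zero_right diff_0 mult_minus_left)
    have det: "x $ 1 * q2' - x $ 2 * q1' = of_real (s0 (x $ 1) (x $ 2))"
      unfolding q1'_def q2'_def s0_def by (rule adjugate_identity(2))
    define N where "N = (cmod q1')\<^sup>2 + (cmod q2')\<^sup>2"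
    have "N \<noteq> 0"
    proof
      assume "N = 0"
      then have "q1' = 0" "q2' = 0" unfolding N_def by (simp_all add: sum_power2_eq_zero_iff)
      with det s0 show False by simp
    qed
    \<comment> \<open>The last two coordinates of \<open>x'\<close> do not affect the forms
      \<open>G l\<close>; this factor adjusts them so that \<open>F\<close> too is multiplied by
      \<open>- D\<close>.\<close>
    define c where "c = - D * Re (F (C *v x) (C *v x)) / (2 * N)"
    define x' :: "complex^4" where "x' = (\<chi> i. if i = 1 then q1' else if i = 2 then q2' else
        if i = 3 then of_real c * q2' else of_real c * q1')"
    have x'q: "x' $ 1 = q1'" "x' $ 2 = q2'" by (simp_all add: x'_def)
    have "F (C *v x') (C *v x') = of_real (2 * c) * (q1' * cnj q1' + q2' * cnj q2')"
      by (simp add: FC hyp_def x'_def algebra_simps)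
    also have "\<dots> = of_real (2 * c * N)" by (simp add: N_def complex_norm_square[symmetric])
    also have "2 * c * N = - D * Re (F (C *v x) (C *v x))" using \<open>N \<noteq> 0\<close> by (simp add: c_def)
    also have "complex_of_real (- D * Re (F (C *v x) (C *v x))) = of_real (- D) * F (C *v x) (C *v x)"
      using Fc[of "C *v x" "C *v x"] by (simp add: complex_eq_iff)
    finally have FF: "F (C *v x') (C *v x') = of_real (- D) * F (C *v x) (C *v x)" .
    have GG: "G l (C *v x') (C *v x') = of_real (- D) * G l (C *v x) (C *v x)" for l
      unfolding GCx x'q adj by simp
    have "hform H (C *v x') = of_real (- D) *s hform H (C *v x)"
      by (simp add: vec_eq_iff hform_G FF GG algebra_simps)
    from parallel[OF nz _ this] have "x $ 1 * q2' = x $ 2 * q1'" using d by (simp add: x'q D_def)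
    with det s0 show False by simp
  qed

  obtain g1 g2 where g: "(cmod g1)\<^sup>2 + (cmod g2)\<^sup>2 = 1"
      "\<And>l. l \<noteq> 4 \<Longrightarrow> b11 l * (cmod g1)\<^sup>2 + b22 l * (cmod g2)\<^sup>2 + 2 * Re (b12 l * g2 * cnj g1) = 0"
    using net_isotropic_vector[of b11 b22 b12, OF np] by blast
  have gg: "g1 * cnj g1 + g2 * cnj g2 = 1"
    using arg_cong[OF g(1), of complex_of_real] by (simp only: of_real_add of_real_1 complex_norm_square)
  \<comment> \<open>A unitary change of \<open>b1\<close>, \<open>b2\<close> that takes g as first
    vector, with the matching change of \<open>u\<close>, \<open>w\<close> that preserves the
    hyperbolic pairing.\<close>
  define c1 c2 c3 c4 where "c1 = g1 *s b1 + g2 *s b2" and "c2 = (- cnj g2) *s b1 + cnj g1 *s b2"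
    and "c3 = cnj g1 *s u + (- cnj g2) *s w" and "c4 = g2 *s u + g1 *s w"
  define E where "E = cmat (\<lambda>j. if j = 1 then c1 else if j = 2 then c2 else if j = 3 then c3 else c4)"
  have E: "E *v x = x $ 1 *s c1 + x $ 2 *s c2 + x $ 3 *s c3 + x $ 4 *s c4" for x
    by (simp add: E_def cmat_mult)
  have Fn: "F (- x) z = - F x z" "F z (- x) = - F z x" for x z
    using Fs[of "-1" x z] Fsr[of z "-1" x] by simp_all
  have gg': "cnj g1 * g1 + cnj g2 * g2 = 1" using gg by (simp add: mult.commute)
  have Fc_tab: "F c1 c1 = 0" "F c1 c2 = 0" "F c2 c1 = 0" "F c2 c2 = 0"
      "F c3 c3 = 0" "F c3 c4 = 0" "F c4 c3 = 0" "F c4 c4 = 0"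
    unfolding c1_def c2_def c3_def c4_def by (simp_all only: Ftab) simp_all
  have Fc_tab2: "F c1 c3 = 0" "F c1 c4 = 1" "F c2 c3 = 1" "F c2 c4 = 0"
    unfolding c1_def c2_def c3_def c4_def using gg gg' by (simp_all only: Ftab) (simp_all add: algebra_simps)
  have Fc_tab3: "F c3 c1 = 0" "F c4 c1 = 1" "F c3 c2 = 1" "F c4 c2 = 0"
    using Fc_tab2 Fc by (metis complex_cnj_one complex_cnj_zero)+
  have FE: "F (E *v x) (E *v z) = hyp x z" for x z
    unfolding E by (simp only: Fa Fs Far Fsr Fc_tab Fc_tab2 Fc_tab3) (simp add: hyp_def algebra_simps)
  have G11: "G l c1 c1 = 0" for l
    using g(2)[of l] G4 unfolding c1_def GC by (cases "l = 4") (auto simp: b11_def b22_def b12_def)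
  have Gk: "G l x c3 = 0" "G l x c4 = 0" "G l c3 x = 0" "G l c4 x = 0" for l x
    by (simp_all only: c3_def c4_def Ga Gs Gar Gsr Guw mult_zero_right add_0)
  have GE: "G l (E *v x) (E *v z) = G l c2 c1 * (x $ 2 * cnj (z $ 1)) + cnj (G l c2 c1) * (x $ 1 * cnj (z $ 2)) +
      of_real (Re (G l c2 c2)) * (x $ 2 * cnj (z $ 2))" for l x z
    unfolding E by (simp only: Ga Gs Gar Gsr Gk G11 Gc Gr[of l c2, symmetric]) (simp add: algebra_simps)
  \<comment> \<open>As \<open>c1\<close> is isotropic, each \<open>G l\<close> retains one complex
    off-diagonal and one real diagonal coefficient. These are its three coordinates in the first
    components of \<open>H_tilde\<close>; the fourth coordinate is the eigenvalue.\<close>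
  define R :: "real^4^4" where "R = (\<chi> l m. if m = 1 then Re (G l c2 c1) else if m = 2 then - Im (G l c2 c1)
      else if m = 3 then Re (G l c2 c2) else r l)"
  show ?thesis
  proof (rule in_orbit_H_tildeI[OF herm nondeg, of E R])
    show "invertible E" using invertible_if_hyp[of F E, OF FE F0] .
    fix x z l
    have "sform H (E *v x) (E *v z) $ l = G l (E *v x) (E *v z) + of_real (r l) * F (E *v x) (E *v z)"
      by (simp add: G_def F_def)
    also have "\<dots> = G l c2 c1 * (x $ 2 * cnj (z $ 1)) + cnj (G l c2 c1) * (x $ 1 * cnj (z $ 2)) +
      of_real (Re (G l c2 c2)) * (x $ 2 * cnj (z $ 2)) + of_real (r l) * hyp x z"
      by (simp only: GE FE)
    also have "G l c2 c1 * (x $ 2 * cnj (z $ 1)) + cnj (G l c2 c1) * (x $ 1 * cnj (z $ 2)) =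
        of_real (Re (G l c2 c1)) * (x $ 2 * cnj (z $ 1) + x $ 1 * cnj (z $ 2)) +
        of_real (- Im (G l c2 c1)) * (\<i> * (x $ 1 * cnj (z $ 2) - x $ 2 * cnj (z $ 1)))"
    proof -
      have "\<beta> * A + cnj \<beta> * B = of_real (Re \<beta>) * (A + B) + of_real (- Im \<beta>) * (\<i> * (B - A))" for \<beta> A B :: complex
        by (simp add: complex_eq_iff algebra_simps)
      then show ?thesis .
    qed
    finally show "sform H (E *v x) (E *v z) $ l = (\<Sum>m\<in>UNIV. of_real (R $ l $ m) * sform H_tilde x z $ m)"
      by (simp add: sum_4 R_def H_tilde_sform hyp_def)
  qed
qed

end

subsection \<open>The exceptional field of the model\<close>

text \<open>A global counterpart of \<open>weighted_homogeneous\<close> that is closed under sums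
  and products, so that the weight of an explicit field follows from the way it is composed instead
  of from its expanded coefficients.\<close>

definition wpoly :: "nat \<Rightarrow> ((complex^'n) \<times> (complex^'k) \<Rightarrow> complex) \<Rightarrow> bool" where
  "wpoly m F \<longleftrightarrow> (\<exists>c. F = (\<lambda>p. \<Sum>(a, b)\<in>exponents_of_weight (int m).
          c (a, b) * (\<Prod>j\<in>UNIV. fst p $ j ^ a j) * (\<Prod>l\<in>UNIV. snd p $ l ^ b l)))"

lemma wpoly_mpoly_fun: "wpoly m F \<Longrightarrow> mpoly_fun F"
  unfolding wpoly_def using weighted_monomials(1) by blast

lemma wpoly_weighted_homogeneous: "wpoly m F \<Longrightarrow> weighted_homogeneous (int m) F"
  unfolding wpoly_def weighted_homogeneous_def
proof (elim exE)
  fix c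
  assume "F = (\<lambda>p. \<Sum>(a, b)\<in>exponents_of_weight (int m).
          c (a, b) * (\<Prod>j\<in>UNIV. fst p $ j ^ a j) * (\<Prod>l\<in>UNIV. snd p $ l ^ b l))"
  then show "\<exists>c. \<forall>\<^sub>F (z, w) in nhds 0. F (z, w) = (\<Sum>(a, b)\<in>exponents_of_weight (int m).
          c (a, b) * (\<Prod>j\<in>UNIV. z $ j ^ a j) * (\<Prod>l\<in>UNIV. w $ l ^ b l))"
    by (intro exI[of _ c] always_eventually) auto
qed

lemma wpoly_add: "wpoly m F \<Longrightarrow> wpoly m G \<Longrightarrow> wpoly m (\<lambda>p. F p + G p)"
  unfolding wpoly_def
proof (elim exE)
  fix c d
  assume F: "F = (\<lambda>p. \<Sum>(a, b)\<in>exponents_of_weight (int m).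
          c (a, b) * (\<Prod>j\<in>UNIV. fst p $ j ^ a j) * (\<Prod>l\<in>UNIV. snd p $ l ^ b l))"
    and G: "G = (\<lambda>p. \<Sum>(a, b)\<in>exponents_of_weight (int m).
          d (a, b) * (\<Prod>j\<in>UNIV. fst p $ j ^ a j) * (\<Prod>l\<in>UNIV. snd p $ l ^ b l))"
  show "\<exists>c. (\<lambda>p. F p + G p) = (\<lambda>p. \<Sum>(a, b)\<in>exponents_of_weight (int m).
          c (a, b) * (\<Prod>j\<in>UNIV. fst p $ j ^ a j) * (\<Prod>l\<in>UNIV. snd p $ l ^ b l))"
    by (rule exI[of _ "\<lambda>x. c x + d x"]) (simp add: F G split_def distrib_right sum.distrib)
qed

lemma wpoly_mult:
  fixes F G :: "(complex^'n) \<times> (complex^'k) \<Rightarrow> complex"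
  assumes "wpoly m F" "wpoly n G"
  shows "wpoly (m + n) (\<lambda>p. F p * G p)"
proof -
  define M where "M = (\<lambda>(p :: (complex^'n) \<times> (complex^'k)) x. (\<Prod>j\<in>UNIV. fst p $ j ^ fst x j) * (\<Prod>l\<in>UNIV. snd p $ l ^ snd x l))"
  define A where "A = (\<lambda>m. exponents_of_weight (int m) :: (('n \<Rightarrow> nat) \<times> ('k \<Rightarrow> nat)) set)"
  define ad where "ad = (\<lambda>(x, y). (\<lambda>j. fst x j + fst y j, \<lambda>l. snd x l + snd y l) :: ('n \<Rightarrow> nat) \<times> ('k \<Rightarrow> nat))"
  have fin: "finite (A m)" for m unfolding A_def by (rule finite_exponents_of_weight)
  have wp: "wpoly m F \<longleftrightarrow> (\<exists>c. F = (\<lambda>p. \<Sum>x\<in>A m. c x * M p x))" for m F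
    unfolding wpoly_def M_def A_def by (simp add: split_def mult.assoc)
  obtain c where c: "F = (\<lambda>p. \<Sum>x\<in>A m. c x * M p x)" using assms(1) wp by blast
  obtain d where d: "G = (\<lambda>p. \<Sum>x\<in>A n. d x * M p x)" using assms(2) wp by blast
  have M: "M p (ad (x, y)) = M p x * M p y" for p x y
    by (simp add: M_def ad_def power_add prod.distrib)
  have sub: "ad ` (A m \<times> A n) \<subseteq> A (m + n)"
    by (auto simp: A_def ad_def exponents_of_weight_def sum.distrib)
  have "F p * G p = (\<Sum>z\<in>A (m + n). (\<Sum>xy\<in>{xy \<in> A m \<times> A n. ad xy = z}. c (fst xy) * d (snd xy)) * M p z)" for p
  proof -
    have "F p * G p = (\<Sum>xy\<in>A m \<times> A n. (c (fst xy) * d (snd xy)) * M p (ad xy))"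
      unfolding c d sum_product sum.cartesian_product
      using M[of p "fst x" "snd x" for x] by (simp add: split_def mult_ac)
    also have "\<dots> = (\<Sum>z\<in>A (m + n). \<Sum>xy\<in>{xy \<in> A m \<times> A n. ad xy = z}. (c (fst xy) * d (snd xy)) * M p (ad xy))"
      by (rule sum.group[symmetric]) (use fin sub in auto)
    also have "\<dots> = (\<Sum>z\<in>A (m + n). (\<Sum>xy\<in>{xy \<in> A m \<times> A n. ad xy = z}. c (fst xy) * d (snd xy)) * M p z)"
      by (intro sum.cong refl) (simp add: sum_distrib_right)
    finally show ?thesis .
  qed
  then show ?thesis unfolding wp by (intro exI) (rule ext)
qed

lemma wpoly_const: "wpoly 0 (\<lambda>_ :: (complex^'n) \<times> (complex^'k). c)"
proof -
  have "exponents_of_weight 0 = {(\<lambda>_. 0, \<lambda>_. 0) :: ('n::finite \<Rightarrow> nat) \<times> ('k::finite \<Rightarrow> nat)}"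
    unfolding exponents_of_weight_def of_nat_eq_0_iff by (auto simp: fun_eq_iff)
  then show ?thesis unfolding wpoly_def by (intro exI[of _ "\<lambda>_. c"]) simp
qed

lemma wpoly_0: "wpoly m (\<lambda>_. 0)"
  unfolding wpoly_def by (intro exI[of _ "\<lambda>_. 0"]) (simp add: split_def)

lemma wpoly_monomial:
  fixes a :: "'n::finite \<Rightarrow> nat" and b :: "'k::finite \<Rightarrow> nat"
  assumes "sum a UNIV + 2 * sum b UNIV = m"
  shows "wpoly m (\<lambda>p :: (complex^'n) \<times> (complex^'k). (\<Prod>j\<in>UNIV. fst p $ j ^ a j) * (\<Prod>l\<in>UNIV. snd p $ l ^ b l))"
  unfolding wpoly_def
proof (intro exI[of _ "\<lambda>x. if x = (a, b) then 1 else 0"] ext)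
  fix p :: "(complex^'n) \<times> (complex^'k)"
  have "(a, b) \<in> exponents_of_weight (int m)" using assms by (auto simp: exponents_of_weight_def)
  then show "(\<Prod>j\<in>UNIV. fst p $ j ^ a j) * (\<Prod>l\<in>UNIV. snd p $ l ^ b l) =
    (\<Sum>(a', b')\<in>exponents_of_weight (int m). (if (a', b') = (a, b) then 1 else 0) *
       (\<Prod>j\<in>UNIV. fst p $ j ^ a' j) * (\<Prod>l\<in>UNIV. snd p $ l ^ b' l))"
    using finite_exponents_of_weight[of "int m"]
    by (subst sum.remove[of _ "(a, b)"]) (auto simp: split_def intro!: sum.neutral split: if_splits)
qed

lemma wpoly_fst: "wpoly 1 (\<lambda>p :: (complex^'n) \<times> (complex^'k). fst p $ i)"
proof -
  have "(\<Prod>j\<in>UNIV. fst p $ j ^ (if j = i then 1 else 0)) = fst p $ i" for p :: "(complex^'n) \<times> (complex^'k)"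
    by (subst prod.remove[of _ i]) auto
  then show ?thesis using wpoly_monomial[of "\<lambda>j. if j = i then 1 else 0" "\<lambda>_::'k. 0" 1] by simp
qed

lemma wpoly_snd: "wpoly 2 (\<lambda>p :: (complex^'n) \<times> (complex^'k). snd p $ i)"
proof -
  have "(\<Prod>j\<in>UNIV. snd p $ j ^ (if j = i then 1 else 0)) = snd p $ i" for p :: "(complex^'n) \<times> (complex^'k)"
    by (subst prod.remove[of _ i]) auto
  then show ?thesis using wpoly_monomial[of "\<lambda>_::'n. 0" "\<lambda>j. if j = i then 1 else 0" 2] by simp
qed

lemma wpoly_cmult: "wpoly m F \<Longrightarrow> wpoly m (\<lambda>p. c * F p)"
  using wpoly_mult[OF wpoly_const[of c]] by simp

lemma wpoly_diff: "wpoly m F \<Longrightarrow> wpoly m G \<Longrightarrow> wpoly m (\<lambda>p. F p - G p)"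
  using wpoly_add[OF _ wpoly_cmult[of m G "-1"]] by simp

lemma wpoly_sum: "(\<And>i. i \<in> I \<Longrightarrow> wpoly m (F i)) \<Longrightarrow> wpoly m (\<lambda>p. \<Sum>i\<in>I. F i p)"
  by (induction I rule: infinite_finite_induct) (auto intro: wpoly_0 wpoly_add)

lemma wpoly_aut_component:
  fixes X :: "(complex^'n) \<times> (complex^'k) \<Rightarrow> (complex^'n) \<times> (complex^'k)"
  assumes H: "H \<in> hermitian_tuples" and X: "quadric_tangent H X"
    and f: "\<And>i. wpoly (j + 1) (\<lambda>p. fst (X p) $ i)" and h: "\<And>l. wpoly (j + 2) (\<lambda>p. snd (X p) $ l)"
  shows "X \<in> aut_component H (int j)"
proof -
  have P: "poly_field X" using f h wpoly_mpoly_fun unfolding poly_field_def by blast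
  obtain D where D: "\<And>x. (X has_derivative D x) (at x)"
      "\<And>x c z w. D x (c *s z, c *s w) = (c *s fst (D x (z, w)), c *s snd (D x (z, w)))"
    using poly_field_derivative[OF P] by (elim exE conjE) (rule that, blast+)
  then have "holomorphic_germ X"
    unfolding holomorphic_germ_def by (intro always_eventually allI) blast
  moreover have "tangent_germ H X"
    unfolding tangent_germ_iff[OF H] using X
    by (intro always_eventually) (auto simp: quadric_tangent_def)
  ultimately show ?thesis
    using wpoly_weighted_homogeneous[OF f] wpoly_weighted_homogeneous[OF h]
    unfolding aut_component_def aut_quadric_def by (simp add: add.commute)
qed

text \<open>Here \<open>a(w) = (0, 0, - (w\<^sub>1 + \<i> w\<^sub>2) w\<^sub>3, 2 w\<^sub>3\<^sup>2)\<close>, chosen so that the isotropy condition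
  \<open>z\<^sub>1 cnj a\<^sub>4 + z\<^sub>2 cnj a\<^sub>3 = 0\<close> holds at \<open>w\<^sub>1 - \<i> w\<^sub>2 = 2 z\<^sub>1 cnj z\<^sub>2\<close>, \<open>w\<^sub>3 = \<bar>z\<^sub>2\<bar>\<^sup>2\<close>; the tangency equation
  determines the other terms.\<close>

definition model_field :: "(complex^4) \<times> (complex^4) \<Rightarrow> (complex^4) \<times> (complex^4)" where
  "model_field = (\<lambda>(z, w).
     let v = 2 * (z $ 1 * w $ 3) - z $ 2 * (w $ 1 - \<i> * w $ 2) in
     ((\<chi> i. if i = 3 then 2 * \<i> * (z $ 2 * v) - (w $ 1 + \<i> * w $ 2) * w $ 3
            else if i = 4 then 2 * (w $ 3 * w $ 3) else 0),
      (\<chi> l. if l = 4 then 2 * \<i> * (v * w $ 3) else 0)))"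

text \<open>The z-part has entries only in positions 3 and 4, which the first three forms do not
  see. So only l = 4 requires an identity, obtained by inserting the imaginary parts of the first
  three coordinates of w.\<close>

lemma model_field_tangent: "quadric_tangent H_tilde model_field"
  unfolding quadric_tangent_def
proof (intro allI impI)
  fix z w :: "complex^4" and l
  assume "(z, w) \<in> quadric H_tilde"
  then have q: "Im (w $ l) = Re (sform H_tilde z z $ l)" for l
    by (simp add: quadric_iff_Im[OF H_tilde_hermitian] hform_eq_sform)
  note q123 = q[of 1] q[of 2] q[of 3]
  have "Im (snd (model_field (z, w)) $ 4) = 2 * Re (sform H_tilde (fst (model_field (z, w))) z $ 4)"
    using q123 unfolding H_tilde_sform
    by (simp add: model_field_def Let_def) (simp add: algebra_simps)
  moreover have "Im (snd (model_field (z, w)) $ l) = 2 * Re (sform H_tilde (fst (model_field (z, w))) z $ l)" if "l \<noteq> 4"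
    using that exhaust_4[of l] by (auto simp: model_field_def Let_def H_tilde_sform)
  ultimately show "Im (snd (model_field (z, w)) $ l) = 2 * Re (sform H_tilde (fst (model_field (z, w))) z $ l)"
    by blast
qed

text \<open>The linear map \<open>P\<close> built from C and \<rho> carries the quadric of
  \<open>T\<close> to the model, and the model field is pulled back along it. Acting separately on z
  and w, it preserves weights, so the pulled-back field has weight 3.\<close>

lemma orbit_exceptional:
  assumes "T \<in> tuple_orbit H_tilde"
  shows "exceptional_tuple T"
proof -
  obtain C \<rho> where T: "T = tuple_act C \<rho> H_tilde" and C: "det C = 1" and \<rho>: "invertible \<rho>"
    using assms unfolding tuple_orbit_def by blast
  have "invertible C" using C by (simp add: invertible_det_nz)
  then obtain C' where CC: "C ** C' = mat 1" "C' ** C = mat 1" unfolding invertible_def by blast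
  have CC': "C *v (C' *v x) = x" "C' *v (C *v x) = x" for x by (simp_all add: matrix_vector_mul_assoc CC)
  define \<rho>' where "\<rho>' = matrix_inv \<rho>"
  have \<rho>\<rho>: "\<rho> ** \<rho>' = mat 1" "\<rho>' ** \<rho> = mat 1"
    using someI_ex[OF \<rho>[unfolded invertible_def]] unfolding \<rho>'_def matrix_inv_def by blast+
  have \<rho>1: "(\<Sum>m\<in>UNIV. \<rho> $ k $ m * \<rho>' $ m $ l) = (if k = l then 1 else 0)"
       "(\<Sum>m\<in>UNIV. \<rho>' $ k $ m * \<rho> $ m $ l) = (if k = l then 1 else 0)" for k l
    using \<rho>\<rho> by (simp_all add: matrix_matrix_mult_def mat_def vec_eq_iff)
  have sT: "sform T x y $ l = (\<Sum>m\<in>UNIV. of_real (\<rho>' $ l $ m) * sform H_tilde (C *v x) (C *v y) $ m)" for x y l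
    unfolding T \<rho>'_def by (rule sform_tuple_act)
  have sH: "sform H_tilde (C *v x) (C *v y) $ k = (\<Sum>l\<in>UNIV. of_real (\<rho> $ k $ l) * sform T x y $ l)" for x y k
  proof -
    have "(\<Sum>l\<in>UNIV. of_real (\<rho> $ k $ l) * sform T x y $ l) =
        (\<Sum>m\<in>UNIV. of_real (\<Sum>l\<in>UNIV. \<rho> $ k $ l * \<rho>' $ l $ m) * sform H_tilde (C *v x) (C *v y) $ m)"
      unfolding sT by (simp add: sum_distrib_left sum_distrib_right mult.assoc) (rule sum.swap)
    also have "\<dots> = sform H_tilde (C *v x) (C *v y) $ k"
      unfolding \<rho>1 by (subst sum.remove[of _ k]) (auto intro!: sum.neutral)
    finally show ?thesis ..
  qed
  have H: "T \<in> hermitian_tuples" unfolding T by (rule hermitian_tuple_act[OF H_tilde_hermitian])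
  have nd: "nondegenerate T"
    unfolding nondegenerate_def
  proof (intro conjI allI impI)
    fix c :: "real^4" assume c0: "(\<Sum>l\<in>UNIV. c $ l *\<^sub>R T $ l) = 0"
    \<comment> \<open>A relation among the matrices of \<open>T\<close>, rewritten as one among
      those of \<open>H_tilde\<close>; testing on basis vectors shows that it is trivial.\<close>
    define d where "d = (\<lambda>m. \<Sum>l\<in>UNIV. c $ l * \<rho>' $ l $ m)"
    have "(\<Sum>m\<in>UNIV. of_real (d m) * sform H_tilde x y $ m) = 0" for x y
    proof -
      have "(\<Sum>l\<in>UNIV. of_real (c $ l) * sform T x y $ l) = 0" for x y
      proof -
        have "(\<Sum>l\<in>UNIV. of_real (c $ l) * T $ l $ p $ q) = 0" for p q
        proof -
          have "(\<Sum>l\<in>UNIV. c $ l *\<^sub>R T $ l) $ p $ q = 0" using c0 by simp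
          then show ?thesis
            by (simp only: sum_component vector_scaleR_component scaleR_conv_of_real[where 'a = complex])
        qed
        then have "(\<Sum>p\<in>UNIV. \<Sum>q\<in>UNIV. (\<Sum>l\<in>UNIV. of_real (c $ l) * T $ l $ p $ q) * x $ q * cnj (y $ p)) = 0"
          by simp
        also have "(\<Sum>p\<in>UNIV. \<Sum>q\<in>UNIV. (\<Sum>l\<in>UNIV. of_real (c $ l) * T $ l $ p $ q) * x $ q * cnj (y $ p)) =
            (\<Sum>l\<in>UNIV. of_real (c $ l) * sform T x y $ l)"
          by (simp add: sform_def sum_4 algebra_simps)
        finally show ?thesis .
      qed
      from this[of "C' *v x" "C' *v y"]
      have "(\<Sum>l\<in>UNIV. \<Sum>m\<in>UNIV. of_real (c $ l * \<rho>' $ l $ m) * sform H_tilde x y $ m) = 0"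
        by (simp add: sT CC' sum_distrib_left mult.assoc)
      then show ?thesis unfolding d_def by (subst (asm) sum.swap) (simp add: sum_distrib_right)
    qed
    note d0 = this
    have "of_real (d 1) - \<i> * of_real (d 2) = 0"
      using d0[of "axis 2 1" "axis 1 1"] by (simp add: sum_4 H_tilde_sform axis_def mult.commute)
    then have "d 1 = 0" "d 2 = 0" by (simp_all add: complex_eq_iff)
    moreover have "d 3 = 0" "d 4 = 0"
      using d0[of "axis 2 1" "axis 2 1"] d0[of "axis 4 1" "axis 1 1"]
      by (simp_all add: sum_4 H_tilde_sform axis_def)
    ultimately have d: "d m = 0" for m using exhaust_4[of m] by auto
    have "c $ k = 0" for k
    proof -
      have "(\<Sum>m\<in>UNIV. d m * \<rho> $ m $ k) = (\<Sum>l\<in>UNIV. c $ l * (\<Sum>m\<in>UNIV. \<rho>' $ l $ m * \<rho> $ m $ k))"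
        unfolding d_def by (simp add: sum_distrib_left sum_distrib_right mult.assoc) (rule sum.swap)
      also have "\<dots> = c $ k" unfolding \<rho>1 by (simp add: if_distrib cong: if_cong)
      finally show ?thesis by (simp add: d)
    qed
    then show "c = 0" by (simp add: vec_eq_iff)
  next
    fix z assume "\<forall>l. T $ l *v z = 0"
    then have "sform T z y $ l = 0" for y l by (simp add: sform_nth)
    then have "sform H_tilde (C *v z) (C *v y) $ 4 = 0" for y unfolding sH by simp
    from this[of "C' *v _"] have "hyp (C *v z) y = 0" for y by (simp add: CC' H_tilde_sform hyp_def)
    then have "C *v z = 0" by (rule hyp_nondegenerate)
    then show "z = 0" using CC'(2)[of z] by simp
  qed
  define P where "P = (\<lambda>p :: (complex^4) \<times> (complex^4). (C *v fst p, map_matrix complex_of_real \<rho> *v snd p))"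
  define X where "X = (\<lambda>p. (C' *v fst (model_field (P p)), map_matrix complex_of_real \<rho>' *v snd (model_field (P p))))"
  have "quadric_tangent T X"
    unfolding quadric_tangent_def
  proof (intro allI impI)
    fix z w l assume zw: "(z, w) \<in> quadric T"
    have "P (z, w) \<in> quadric H_tilde"
    proof -
      have "Im (snd (P (z, w)) $ k) = Re (hform H_tilde (C *v z) $ k)" for k
      proof -
        have "Im (w $ l) = Re (sform T z z $ l)" for l
          using zw by (simp add: quadric_iff_Im[OF H] hform_eq_sform)
        then have "Im (snd (P (z, w)) $ k) = Re (\<Sum>l\<in>UNIV. of_real (\<rho> $ k $ l) * sform T z z $ l)"
          by (simp add: P_def matrix_vector_mult_def)
        then show ?thesis by (simp only: hform_eq_sform sH)
      qed
      then show ?thesis using quadric_iff_Im[OF H_tilde_hermitian] by (simp add: P_def)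
    qed
    then have m: "Im (snd (model_field (P (z, w))) $ m) = 2 * Re (sform H_tilde (fst (model_field (P (z, w)))) (C *v z) $ m)" for m
      using model_field_tangent unfolding quadric_tangent_def by (simp add: P_def)
    have "Im (snd (X (z, w)) $ l) = (\<Sum>m\<in>UNIV. \<rho>' $ l $ m * Im (snd (model_field (P (z, w))) $ m))"
      by (simp add: X_def matrix_vector_mult_def)
    also have "\<dots> = 2 * Re (sform T (fst (X (z, w))) z $ l)"
      unfolding m sT by (simp add: X_def CC' sum_distrib_left mult.left_commute)
    finally show "Im (snd (X (z, w)) $ l) = 2 * Re (sform T (fst (X (z, w))) z $ l)" .
  qed
  moreover have Pz: "wpoly 1 (\<lambda>p. fst (P p) $ i)" and Pw: "wpoly 2 (\<lambda>p. snd (P p) $ i)" for i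
    unfolding P_def matrix_vector_mult_def
    by (auto intro!: wpoly_sum wpoly_cmult wpoly_fst[unfolded One_nat_def] wpoly_snd)
  define v where "v = (\<lambda>p. 2 * (fst (P p) $ 1 * snd (P p) $ 3) - fst (P p) $ 2 * (snd (P p) $ 1 - \<i> * snd (P p) $ 2))"
  have "wpoly (1 + 2) v"
    unfolding v_def by (intro wpoly_diff wpoly_mult wpoly_cmult Pz Pw)
  then have v: "wpoly 3 v" by (simp add: numeral_3_eq_3)
  have f3: "wpoly 4 (\<lambda>p. 2 * \<i> * (fst (P p) $ 2 * v p) - (snd (P p) $ 1 + \<i> * snd (P p) $ 2) * snd (P p) $ 3)"
    using wpoly_diff[OF wpoly_cmult[OF wpoly_mult[OF Pz[of 2] v], of "2 * \<i>"], of
        "\<lambda>p. (snd (P p) $ 1 + \<i> * snd (P p) $ 2) * snd (P p) $ 3"]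
      wpoly_mult[OF wpoly_add[OF Pw[of 1] wpoly_cmult[OF Pw[of 2], of \<i>]] Pw[of 3]] by simp
  have f4: "wpoly 4 (\<lambda>p. 2 * (snd (P p) $ 3 * snd (P p) $ 3))"
    using wpoly_cmult[OF wpoly_mult[OF Pw[of 3] Pw[of 3]], of 2] by simp
  have h4: "wpoly 5 (\<lambda>p. 2 * \<i> * (v p * snd (P p) $ 3))"
    using wpoly_cmult[OF wpoly_mult[OF v Pw[of 3]], of "2 * \<i>"] by simp
  have mf: "wpoly 4 (\<lambda>p. fst (model_field (P p)) $ i)" for i
    using f3 f4 wpoly_0[of 4] exhaust_4[of i] by (auto simp: model_field_def Let_def split_def v_def)
  have mh: "wpoly 5 (\<lambda>p. snd (model_field (P p)) $ i)" for i
    using h4 wpoly_0[of 5] exhaust_4[of i] by (auto simp: model_field_def Let_def split_def v_def)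
  have "wpoly (3 + 1) (\<lambda>p. fst (X p) $ i)" for i
    unfolding X_def matrix_vector_mult_def using mf by (auto intro!: wpoly_sum wpoly_cmult)
  moreover have "wpoly (3 + 2) (\<lambda>p. snd (X p) $ i)" for i
    unfolding X_def matrix_vector_mult_def using mh by (auto intro!: wpoly_sum wpoly_cmult)
  ultimately have "X \<in> aut_component T (int 3)"
    by (intro wpoly_aut_component[OF H])
  moreover have "\<not> (\<forall>\<^sub>F p in nhds 0. X p = 0)"
  proof
    assume ev: "\<forall>\<^sub>F p in nhds 0. X p = 0"
    \<comment> \<open>A point sent by \<open>P\<close> to the third unit vector in the
      w-coordinates, where the fourth entry of the model field is 2; its dilations reach every
      neighbourhood of 0.\<close>
    define w where "w = map_matrix complex_of_real \<rho>' *v axis 3 1"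
    obtain t :: real where t: "t > 0" and X0: "X (of_real t *s 0, (of_real t)\<^sup>2 *s w) = 0"
      using exists_scaled[OF ev, of 0 w] by blast
    have "snd (P (of_real t *s 0, (of_real t)\<^sup>2 *s w)) $ 3 = (of_real t)\<^sup>2"
    proof -
      have "map_matrix complex_of_real \<rho> ** map_matrix complex_of_real \<rho>' = mat 1"
        using \<rho>1(1) by (simp add: matrix_matrix_mult_def mat_def vec_eq_iff flip: of_real_mult of_real_sum)
      then have "map_matrix complex_of_real \<rho> *v w = axis 3 1"
        unfolding w_def by (simp add: matrix_vector_mul_assoc)
      then have "map_matrix complex_of_real \<rho> *v ((of_real t)\<^sup>2 *s w) = (of_real t)\<^sup>2 *s axis 3 1"
        by (simp add: vector_scalar_commute)
      then show ?thesis by (simp add: P_def axis_def)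
    qed
    then have "fst (model_field (P (of_real t *s 0, (of_real t)\<^sup>2 *s w))) $ 4 = 2 * ((of_real t)\<^sup>2 * (of_real t)\<^sup>2)"
      by (simp add: model_field_def Let_def split_def)
    moreover have "fst (model_field (P (of_real t *s 0, (of_real t)\<^sup>2 *s w))) = 0"
    proof -
      have "C' *v fst (model_field (P (of_real t *s 0, (of_real t)\<^sup>2 *s w))) = 0"
        using arg_cong[OF X0, of fst] by (simp only: X_def fst_conv fst_zero)
      then show ?thesis using CC'(1) by (metis matrix_vector_mult_0_right)
    qed
    ultimately show False using t by simp
  qed
  ultimately show ?thesis
    unfolding exceptional_tuple_def using H nd by (intro conjI exI[of _ "int 3"] bexI[of _ X]) auto
qed

subsection \<open>The neighbourhood\<close>

text \<open>Four real directions at the second unit vector along which \<langle>z, z\<rangle> for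
  \<open>H_tilde\<close> has, up to the factor 2, the identity as derivative.\<close>

definition probe :: "4 \<Rightarrow> complex^4" where
  "probe i = (if i = 1 then axis 1 1 else if i = 2 then axis 1 (- \<i>) else if i = 3 then axis 2 1 else axis 3 1)"

definition probe_mat :: "complex^4^4^4 \<Rightarrow> real^4^4" where
  "probe_mat H = (\<chi> l i. Re (sform H (probe i) (axis 2 1) $ l))"

lemma probe_mat_H_tilde: "probe_mat H_tilde = mat 1"
  by (simp add: vec_eq_iff forall_4 probe_mat_def probe_def H_tilde_sform axis_def mat_def)

text \<open>The determinant condition makes \<langle>z, z\<rangle> a submersion at the second unit
  vector, so its values fill a ball in R^4. A polynomial map vanishing there vanishes on R^4, by
  continuation along lines through the centre, and then on C^4.\<close>

lemma isotropic_map_nonzero: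
  fixes H :: "complex^4^4^4" and a :: "complex^4 \<Rightarrow> complex^4"
  assumes H: "H \<in> hermitian_tuples" and J: "det (probe_mat H) \<noteq> 0"
    and a_poly: "\<And>\<gamma> i. (\<And>l. poly_fun (\<lambda>t. \<gamma> t $ l)) \<Longrightarrow> poly_fun (\<lambda>t. a (\<gamma> t) $ i)"
    and nz: "a w0 \<noteq> 0"
  shows "\<exists>z. a (hform H z) \<noteq> 0"
proof (rule ccontr)
  assume "\<not> ?thesis"
  then have a0: "a (hform H z) = 0" for z by blast
  define \<phi> where "\<phi> = (\<lambda>z. (\<chi> l. Re (hform H z $ l)) :: real^4)"
  define cv where "cv = (\<lambda>d::real^4. (\<chi> l. complex_of_real (d $ l)) :: complex^4)"
  have cv\<phi>: "cv (\<phi> z) = hform H z" for z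
    by (simp add: cv_def \<phi>_def vec_eq_iff hform_real[OF H])
  define e :: "complex^4" where "e = axis 2 1"
  define L where "L = (\<lambda>x::complex^4. (\<chi> l. Re (x $ l)) :: real^4)"
  have L: "bounded_linear L"
    unfolding L_def by (intro linear_conv_bounded_linear[THEN iffD1] linearI) (auto simp: vec_eq_iff)
  define \<phi>' where "\<phi>' = (\<lambda>\<delta>. L (sform H e \<delta> + sform H \<delta> e))"
  have der: "(\<phi> has_derivative \<phi>') (at e)"
  proof -
    have "((\<lambda>z. L (sform H z z)) has_derivative (\<lambda>\<delta>. L (sform H e \<delta> + sform H \<delta> e))) (at e)"
      by (intro bounded_linear.has_derivative[OF L] bounded_bilinear.FDERIV[OF bounded_bilinear_sform] has_derivative_ident)
    then show ?thesis by (simp add: \<phi>_def \<phi>'_def L_def hform_eq_sform)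
  qed
  have \<phi>'2: "\<phi>' \<delta> $ l = 2 * Re (sform H \<delta> e $ l)" for \<delta> l
    using arg_cong[OF sform_cnj[OF H, of \<delta> e l], of Re] by (simp add: \<phi>'_def L_def)
  have "invertible (probe_mat H)" using J by (simp add: invertible_det_nz)
  then obtain K where K: "probe_mat H ** K = mat 1" unfolding invertible_def by blast
  \<comment> \<open>A right inverse of the derivative with values in the span of the probes; halving
    compensates the factor 2 in \<open>\<phi>'2\<close>.\<close>
  define g' where "g' = (\<lambda>v. \<Sum>i\<in>UNIV. ((K *v v) $ i / 2) *\<^sub>R probe i)"
  have g'lin: "bounded_linear g'"
    unfolding g'_def
    by (intro linear_conv_bounded_linear[THEN iffD1] linearI)
       (auto simp: matrix_vector_right_distrib add_divide_distrib scaleR_left_distrib sum.distrib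
         matrix_vector_mult_scaleR scaleR_sum_right)
  have "\<phi>' (g' v) = v" for v
  proof -
    have "\<phi>' (g' v) $ l = v $ l" for l
    proof -
      have "sform H (g' v) e = (\<Sum>i\<in>UNIV. ((K *v v) $ i / 2) *\<^sub>R sform H (probe i) e)"
        by (simp add: g'_def sum_4 sform_add_left sform_scaleR_left)
      then have "\<phi>' (g' v) $ l = (\<Sum>i\<in>UNIV. probe_mat H $ l $ i * (K *v v) $ i)"
        by (simp add: \<phi>'2 sum_4 probe_mat_def e_def algebra_simps)
      also have "\<dots> = (probe_mat H *v (K *v v)) $ l" by (simp add: matrix_vector_mult_def)
      also have "\<dots> = v $ l" by (simp add: matrix_vector_mul_assoc K)
      finally show ?thesis .
    qed
    then show ?thesis by (simp add: vec_eq_iff)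
  qed
  then have "\<phi>' \<circ> g' = id" by auto
  moreover have "continuous_on UNIV \<phi>"
  proof -
    have "\<phi> = (\<lambda>z. L (sform H z z))" by (simp add: \<phi>_def L_def hform_eq_sform)
    then show ?thesis
      by (auto intro!: continuous_on_compose2[OF linear_continuous_on[OF L, of UNIV]]
          bounded_bilinear.continuous_on[OF bounded_bilinear_sform] continuous_on_id)
  qed
  ultimately have "\<phi> e \<in> interior (\<phi> ` UNIV)"
    using sussmann_open_mapping[OF open_UNIV _ UNIV_I der g'lin, of UNIV] by simp
  then obtain r where r: "r > 0" "ball (\<phi> e) r \<subseteq> range \<phi>" using mem_interior by blast
  have a_ball: "a (cv d) = 0" if "dist (\<phi> e) d < r" for d
  proof -
    have "d \<in> range \<phi>" using r(2) that by (simp add: subset_iff)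
    then obtain z where "d = \<phi> z" by blast
    then show ?thesis using a0 cv\<phi> by simp
  qed
  have a_real: "a (cv d) = 0" for d
  proof -
    define \<delta> where "\<delta> = d - \<phi> e"
    have "a (cv (\<phi> e) + t *s cv \<delta>) $ i = 0" for i t
    proof (rule poly_fun_eqI[where t = t and f = "\<lambda>t. a (cv (\<phi> e) + t *s cv \<delta>) $ i" and g = "\<lambda>_. 0"
          and S = "of_real ` {0<..<r / (norm \<delta> + 1)}"])
      show "poly_fun (\<lambda>t. a (cv (\<phi> e) + t *s cv \<delta>) $ i)"
        by (rule a_poly) (auto intro!: poly_fun_add poly_fun_mult)
      have "r / (norm \<delta> + 1) > 0" using r(1) by (simp add: add_nonneg_pos)
      then show "infinite (complex_of_real ` {0<..<r / (norm \<delta> + 1)})"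
        by (simp add: finite_image_iff inj_on_def infinite_Ioo)
      fix t assume "t \<in> complex_of_real ` {0<..<r / (norm \<delta> + 1)}"
      then obtain s where s: "t = of_real s" "0 < s" "s < r / (norm \<delta> + 1)" by auto
      have "norm \<delta> + 1 > 0" by (simp add: add_nonneg_pos)
      then have "s * (norm \<delta> + 1) < r" using s(3) by (simp add: pos_less_divide_eq)
      then have "s * norm \<delta> < r" using s(2) by (simp add: distrib_left)
      then have "dist (\<phi> e) (\<phi> e + s *\<^sub>R \<delta>) < r" using s(2) by (simp add: dist_norm)
      moreover have "cv (\<phi> e + s *\<^sub>R \<delta>) = cv (\<phi> e) + t *s cv \<delta>" by (simp add: cv_def vec_eq_iff s(1))
      ultimately show "a (cv (\<phi> e) + t *s cv \<delta>) $ i = 0" using a_ball by (metis zero_index)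
    qed auto
    from this[of 1] have "a (cv (\<phi> e) + cv \<delta>) = 0" by (simp add: vec_eq_iff)
    moreover have "cv (\<phi> e) + cv \<delta> = cv d" by (simp add: cv_def \<delta>_def vec_eq_iff)
    ultimately show ?thesis by simp
  qed
  define d1 d2 :: "real^4" where "d1 = (\<chi> l. Re (w0 $ l))" and "d2 = (\<chi> l. Im (w0 $ l))"
  have "a (cv d1 + t *s cv d2) $ i = 0" for i t
  proof (rule poly_fun_eqI_real[where t = t and g = "\<lambda>_. 0"])
    show "poly_fun (\<lambda>t. a (cv d1 + t *s cv d2) $ i)"
      by (rule a_poly) (auto intro!: poly_fun_add poly_fun_mult)
    fix x :: real
    have "cv d1 + of_real x *s cv d2 = cv (d1 + x *\<^sub>R d2)" by (simp add: cv_def vec_eq_iff)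
    then show "a (cv d1 + of_real x *s cv d2) $ i = 0" using a_real by simp
  qed auto
  moreover have "w0 = cv d1 + \<i> *s cv d2" by (simp add: cv_def d1_def d2_def vec_eq_iff complex_eq_iff)
  ultimately have "a w0 $ i = 0" for i by simp
  then have "a w0 = 0" by (simp add: vec_eq_iff)
  with nz show False by simp
qed

lemma exceptional_in_orbit:
  assumes ex: "exceptional_tuple H" and det: "det (H $ 4) \<noteq> 0" "det (probe_mat H) \<noteq> 0"
  shows "H \<in> tuple_orbit H_tilde"
proof -
  have H: "H \<in> hermitian_tuples" "nondegenerate H" using ex unfolding exceptional_tuple_def by auto
  obtain j X w0 where X: "weighted_field j X" and iso: "\<And>z. sform H z (fst (X (0, hform H z))) = 0"
    and nz: "fst (X (0, w0)) \<noteq> 0"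
    using exceptional_isotropic_map[OF ex] by blast
  have P: "poly_field X" using X weighted_fieldD by blast
  have poly: "poly_fun (\<lambda>t. fst (X (0, \<gamma> t)) $ i)" if "\<And>l. poly_fun (\<lambda>t. \<gamma> t $ l)" for \<gamma> i
    by (rule poly_field_curve[OF P]) (use that in auto)
  obtain z0 where z0: "fst (X (0, hform H z0)) \<noteq> 0"
    using isotropic_map_nonzero[of H "\<lambda>w. fst (X (0, w))", OF H(1) det(2) poly nz] by blast
  have "isotropic_map H (\<lambda>w. fst (X (0, w))) (j + 1) z0"
  proof
    show "fst (X (0, t\<^sup>2 *s w)) = t ^ (j + 1) *s fst (X (0, w))" for t w
      using weighted_fieldD(2)[OF X, of t 0 w] by simp
  qed (use H det iso z0 poly in auto)
  then show ?thesis by (rule isotropic_map.in_orbit_H_tilde)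
qed

theorem theorem1:
  shows "\<exists>U. openin (top_of_set (hermitian_tuples :: (complex^4^4^4) set)) U \<and> H_tilde \<in> U \<and>
           {H. exceptional_tuple H} \<inter> U = tuple_orbit H_tilde \<inter> U"
proof -
  \<comment> \<open>The restriction serves one inclusion only: points of the orbit are exceptional
    everywhere.\<close>
  define V :: "(complex^4^4^4) set" where "V = {H. det (H $ 4) \<noteq> 0} \<inter> {H. det (probe_mat H) \<noteq> 0}"
  have "open {H :: complex^4^4^4. det (H $ 4) \<noteq> 0}"
    unfolding det_def by (intro open_Collect_neq continuous_intros)
  moreover have "open {H :: complex^4^4^4. det (probe_mat H) \<noteq> 0}"
    unfolding det_def probe_mat_def sform_def vec_lambda_beta by (intro open_Collect_neq continuous_intros)
  ultimately have "open V" unfolding V_def by (rule open_Int)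
  then have "openin (top_of_set hermitian_tuples) (hermitian_tuples \<inter> V)" by (rule openin_open_Int)
  moreover have "H_tilde \<in> hermitian_tuples \<inter> V"
  proof -
    have "invertible (H_tilde $ 4)"
      unfolding invertible_left_inverse matrix_left_invertible_ker
    proof (intro allI impI)
      fix x assume "H_tilde $ 4 *v x = 0"
      then have "hyp x y = 0" for y using H_tilde_sform(4)[of x y] by (simp add: sform_nth hyp_def)
      then show "x = 0" by (rule hyp_nondegenerate)
    qed
    then show ?thesis
      by (simp add: V_def H_tilde_hermitian probe_mat_H_tilde invertible_det_nz)
  qed
  moreover have "{H. exceptional_tuple H} \<inter> (hermitian_tuples \<inter> V) = tuple_orbit H_tilde \<inter> (hermitian_tuples \<inter> V)"
    using exceptional_in_orbit orbit_exceptional unfolding V_def by auto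
  ultimately show ?thesis by blast
qed

end
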